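(* A concrete category $(\mathcal{K},U)$ over $\mathbf{Pos}$ is concretely equivalent to a variety of ordered algebras if and only if (1) $\mathcal{K}$ has tensors, subkernel pairs and reflexive coinserters, and (2) $U$ is a finitary right adjoint which reflects isomorphisms and preserves reflexive coinserters.
   Context: Everything is enriched over the cartesian closed category $\mathbf{Pos}$ of posets and monotone maps: categories have partially ordered hom-sets with monotone composition; functors are monotone on hom-sets; adjunctions are enriched. A concrete category over $\mathbf{Pos}$ is a category $\mathcal{K}$ with a faithful enriched functor $U\colon\mathcal{K}\to\mathbf{Pos}$ (faithful in the enriched sense: for parallel $f,g$, $f\le g$ iff $Uf\le Ug$). $(\mathcal{K},U)$ and $(\mathcal{K}',U')$ are concretely equivalent if there is an (enriched) equivalence $E\colon\mathcal{K}\to\mathcal{K}'$ with $U=U'E$. Variety: for a finitary signature $\Sigma=(\Sigma_n)_{n\in\mathbb{N}}$, an ordered $\Sigma$-algebra is a poset with a $\Sigma$-algebra structure whose operations are monotone; $\Sigma\text{-}\mathbf{Alg}$ is the category of ordered $\Sigma$-algebras and monotone homomorphisms (ordered pointwise). A variety of ordered algebras is a full subcategory of some $\Sigma\text{-}\mathbf{Alg}$ consisting of all algebras satisfying a given set of inequations $s\le t$ between terms; it is concrete via the underlying-poset functor. Tensors: a tensor $P\otimes K$ of an object $K$ with a poset $P$ is an object with isomorphisms $\mathbf{Pos}(P,\mathcal{K}(K,X))\cong\mathcal{K}(P\otimes K,X)$ of posets natural in $X$; $\mathcal{K}$ has tensors if $P\otimes K$ exists for all $P$ and $K$. A subkernel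 pair of $f\colon X\to Y$ is a pair $u_0,u_1\colon U\to X$ with $fu_0\le fu_1$ such that every pair $v_0,v_1\colon V\to X$ with $fv_0\le fv_1$ factorizes as $v_i=u_ik$ ($i=0,1$) for some $k\colon V\to U$, and whenever $k,\bar k\colon V\to U$ satisfy $u_ik\le u_i\bar k$ for $i=0,1$, then $k\le\bar k$. A coinserter of $u_0,u_1\colon U\to X$ is a morphism $f\colon X\to Y$ with $fu_0\le fu_1$ such that every $f'\colon X\to Y'$ with $f'u_0\le f'u_1$ factorizes as $f'=gf$, and $gf\le\bar gf$ implies $g\le\bar g$ for parallel $g,\bar g\colon Y\to Y'$. A pair $u_0,u_1\colon U\to X$ is reflexive if there is $d\colon X\to U$ with $u_0d=u_1d=\mathrm{id}_X$; a reflexive coinserter is a coinserter of a reflexive pair. "Finitary" means preserving filtered (equivalently, directed) colimits. *)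

theory Defs
  imports "HOL-Library.FuncSet" "HOL-Library.Countable_Set"
begin

unbundle cardinal_syntax

section \<open>Posets and monotone maps\<close>

text \<open>
  A poset is a relation \<open>r\<close> with \<^const>\<open>Partial_order\<close> \<open>r\<close>. By reflexivity its carrier is
  \<^term>\<open>Field r\<close>, so a poset on a given carrier is determined by its relation, and
  \<open>(x, y) \<in> r\<close> reads \<open>x \<le> y\<close>.
\<close>

definition monotone_maps :: "'a rel \<Rightarrow> 'b rel \<Rightarrow> ('a \<Rightarrow> 'b) set" where
  "monotone_maps r s = {f \<in> Field r \<rightarrow>\<^sub>E Field s. \<forall>(x, y) \<in> r. (f x, f y) \<in> s}"

definition map_poset :: "'a rel \<Rightarrow> 'b rel \<Rightarrow> ('a \<Rightarrow> 'b) rel" where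
  "map_poset r s = {(f, g). f \<in> monotone_maps r s \<and> g \<in> monotone_maps r s \<and>
     (\<forall>x \<in> Field r. (f x, g x) \<in> s)}"

definition poset_iso :: "'a rel \<Rightarrow> 'b rel \<Rightarrow> ('a \<Rightarrow> 'b) \<Rightarrow> bool" where
  "poset_iso r s f \<longleftrightarrow> bij_betw f (Field r) (Field s) \<and>
     (\<forall>x \<in> Field r. \<forall>y \<in> Field r. (x, y) \<in> r \<longleftrightarrow> (f x, f y) \<in> s)"

definition directed_poset :: "'a rel \<Rightarrow> bool" where
  "directed_poset r \<longleftrightarrow> Partial_order r \<and> Field r \<noteq> {} \<and>
     (\<forall>x \<in> Field r. \<forall>y \<in> Field r. \<exists>z. (x, z) \<in> r \<and> (y, z) \<in> r)"

text \<open>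
  Small sets are the subsets of a type \<open>'u\<close> of cardinality less than that of \<open>'u\<close>. The type
  plays the role of the universe of sets over which \<open>Pos\<close> is formed: if its cardinality is
  strongly inaccessible, the small sets are, up to bijection, those of a Grothendieck universe.
\<close>

definition small :: "'u set \<Rightarrow> bool" where
  "small A \<longleftrightarrow> |A| <o |UNIV :: 'u set|"


section \<open>Categories, functors and adjunctions enriched over posets\<close>

text \<open>
  \<open>Hom K X Y\<close> is the hom-poset (a relation on arrows), its field is the hom-set. As usual,
  hom-sets are pairwise disjoint, so that composition and the arrow part of a functor need not
  be indexed by objects.
\<close>

record ('o, 'm) pcat =
  Obj :: "'o set"
  Hom :: "'o \<Rightarrow> 'o \<Rightarrow> 'm rel"
  Idt :: "'o \<Rightarrow> 'm"
  Cmp :: "'m \<Rightarrow> 'm \<Rightarrow> 'm"  (infixl "\<odot>\<index>" 70)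

definition arrows :: "('o, 'm) pcat \<Rightarrow> 'o \<Rightarrow> 'o \<Rightarrow> 'm set" where
  "arrows K X Y = {f. X \<in> Obj K \<and> Y \<in> Obj K \<and> f \<in> Field (Hom K X Y)}"

locale pos_category =
  fixes K :: "('o, 'm) pcat" (structure)
  assumes hom_poset: "\<lbrakk>X \<in> Obj K; Y \<in> Obj K\<rbrakk> \<Longrightarrow> Partial_order (Hom K X Y)"
    and hom_disjoint: "\<lbrakk>f \<in> arrows K X Y; f \<in> arrows K X' Y'\<rbrakk> \<Longrightarrow> X = X' \<and> Y = Y'"
    and id_arrow: "X \<in> Obj K \<Longrightarrow> Idt K X \<in> arrows K X X"
    and comp_arrow: "\<lbrakk>f \<in> arrows K X Y; g \<in> arrows K Y Z\<rbrakk> \<Longrightarrow> g \<odot> f \<in> arrows K X Z"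
    and comp_id: "f \<in> arrows K X Y \<Longrightarrow> f \<odot> Idt K X = f"
    and id_comp: "f \<in> arrows K X Y \<Longrightarrow> Idt K Y \<odot> f = f"
    and comp_assoc: "\<lbrakk>f \<in> arrows K W X; g \<in> arrows K X Y; h \<in> arrows K Y Z\<rbrakk>
      \<Longrightarrow> (h \<odot> g) \<odot> f = h \<odot> (g \<odot> f)"
    and comp_mono: "\<lbrakk>X \<in> Obj K; Y \<in> Obj K; Z \<in> Obj K; (f, f') \<in> Hom K X Y; (g, g') \<in> Hom K Y Z\<rbrakk>
      \<Longrightarrow> (g \<odot> f, g' \<odot> f') \<in> Hom K X Z"

definition is_iso :: "('o, 'm) pcat \<Rightarrow> 'o \<Rightarrow> 'o \<Rightarrow> 'm \<Rightarrow> bool" where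
  "is_iso K X Y f \<longleftrightarrow> f \<in> arrows K X Y \<and>
     (\<exists>g \<in> arrows K Y X. g \<odot>\<^bsub>K\<^esub> f = Idt K X \<and> f \<odot>\<^bsub>K\<^esub> g = Idt K Y)"

record ('o, 'm, 'p, 'n) pfunctor =
  ob :: "'o \<Rightarrow> 'p"
  ar :: "'m \<Rightarrow> 'n"

definition enriched_functor ::
  "('o, 'm) pcat \<Rightarrow> ('p, 'n) pcat \<Rightarrow> ('o, 'm, 'p, 'n) pfunctor \<Rightarrow> bool" where
  "enriched_functor K L F \<longleftrightarrow>
     (\<forall>X \<in> Obj K. ob F X \<in> Obj L \<and> ar F (Idt K X) = Idt L (ob F X)) \<and>
     (\<forall>X \<in> Obj K. \<forall>Y \<in> Obj K. \<forall>(f, g) \<in> Hom K X Y.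
        (ar F f, ar F g) \<in> Hom L (ob F X) (ob F Y)) \<and>
     (\<forall>X Y Z. \<forall>f \<in> arrows K X Y. \<forall>g \<in> arrows K Y Z. ar F (g \<odot>\<^bsub>K\<^esub> f) = ar F g \<odot>\<^bsub>L\<^esub> ar F f)"

definition id_functor :: "('o, 'm, 'o, 'm) pfunctor" where
  "id_functor = \<lparr>ob = id, ar = id\<rparr>"

definition comp_functor ::
  "('p, 'n, 'q, 'l) pfunctor \<Rightarrow> ('o, 'm, 'p, 'n) pfunctor \<Rightarrow> ('o, 'm, 'q, 'l) pfunctor" where
  "comp_functor G F = \<lparr>ob = ob G \<circ> ob F, ar = ar G \<circ> ar F\<rparr>"

definition functor_eq ::
  "('o, 'm) pcat \<Rightarrow> ('o, 'm, 'p, 'n) pfunctor \<Rightarrow> ('o, 'm, 'p, 'n) pfunctor \<Rightarrow> bool" where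
  "functor_eq K F G \<longleftrightarrow> (\<forall>X \<in> Obj K. ob F X = ob G X) \<and>
     (\<forall>X Y. \<forall>f \<in> arrows K X Y. ar F f = ar G f)"

definition naturally_isomorphic ::
  "('o, 'm) pcat \<Rightarrow> ('p, 'n) pcat \<Rightarrow> ('o, 'm, 'p, 'n) pfunctor \<Rightarrow> ('o, 'm, 'p, 'n) pfunctor \<Rightarrow> bool"
where
  "naturally_isomorphic K L F G \<longleftrightarrow> (\<exists>\<alpha>.
     (\<forall>X \<in> Obj K. is_iso L (ob F X) (ob G X) (\<alpha> X)) \<and>
     (\<forall>X Y. \<forall>f \<in> arrows K X Y. \<alpha> Y \<odot>\<^bsub>L\<^esub> ar F f = ar G f \<odot>\<^bsub>L\<^esub> \<alpha> X))"

definition equivalence ::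
  "('o, 'm) pcat \<Rightarrow> ('p, 'n) pcat \<Rightarrow> ('o, 'm, 'p, 'n) pfunctor \<Rightarrow> bool" where
  "equivalence K L E \<longleftrightarrow> enriched_functor K L E \<and>
     (\<exists>G. enriched_functor L K G \<and>
        naturally_isomorphic K K id_functor (comp_functor G E) \<and>
        naturally_isomorphic L L (comp_functor E G) id_functor)"

text \<open>\<open>F \<stileturn> G\<close>, via isomorphisms of hom-posets \<open>L(F P, X) \<cong> K(P, G X)\<close> natural in \<open>P\<close> and \<open>X\<close>.\<close>

definition enriched_adjunction ::
  "('o, 'm) pcat \<Rightarrow> ('p, 'n) pcat \<Rightarrow> ('o, 'm, 'p, 'n) pfunctor \<Rightarrow> ('p, 'n, 'o, 'm) pfunctor \<Rightarrow> bool"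
where
  "enriched_adjunction K L F G \<longleftrightarrow> (\<exists>\<phi>.
     (\<forall>P \<in> Obj K. \<forall>X \<in> Obj L. poset_iso (Hom L (ob F P) X) (Hom K P (ob G X)) (\<phi> P X)) \<and>
     (\<forall>P P' X X'. \<forall>p \<in> arrows K P' P. \<forall>g \<in> arrows L X X'. \<forall>f \<in> arrows L (ob F P) X.
        \<phi> P' X' (g \<odot>\<^bsub>L\<^esub> f \<odot>\<^bsub>L\<^esub> ar F p) = ar G g \<odot>\<^bsub>K\<^esub> \<phi> P X f \<odot>\<^bsub>K\<^esub> p))"

definition right_adjoint ::
  "('p, 'n) pcat \<Rightarrow> ('o, 'm) pcat \<Rightarrow> ('p, 'n, 'o, 'm) pfunctor \<Rightarrow> bool" where
  "right_adjoint L K G \<longleftrightarrow> enriched_functor L K G \<and>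
     (\<exists>F. enriched_functor K L F \<and> enriched_adjunction K L F G)"

definition reflects_isos ::
  "('o, 'm) pcat \<Rightarrow> ('p, 'n) pcat \<Rightarrow> ('o, 'm, 'p, 'n) pfunctor \<Rightarrow> bool" where
  "reflects_isos K L F \<longleftrightarrow>
     (\<forall>X Y. \<forall>f \<in> arrows K X Y. is_iso L (ob F X) (ob F Y) (ar F f) \<longrightarrow> is_iso K X Y f)"


section \<open>Tensors, subkernel pairs, coinserters, directed colimits\<close>

definition is_tensor ::
  "('o, 'm) pcat \<Rightarrow> 'u rel \<Rightarrow> 'o \<Rightarrow> 'o \<Rightarrow> bool" where
  "is_tensor K P X T \<longleftrightarrow> T \<in> Obj K \<and> (\<exists>\<phi>.
     (\<forall>Y \<in> Obj K. poset_iso (map_poset P (Hom K X Y)) (Hom K T Y) (\<phi> Y)) \<and>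
     (\<forall>Y Z. \<forall>g \<in> arrows K Y Z. \<forall>h \<in> monotone_maps P (Hom K X Y).
        \<phi> Z (\<lambda>p \<in> Field P. g \<odot>\<^bsub>K\<^esub> h p) = g \<odot>\<^bsub>K\<^esub> \<phi> Y h))"

definition has_tensors :: "'u itself \<Rightarrow> ('o, 'm) pcat \<Rightarrow> bool" where
  "has_tensors _ K \<longleftrightarrow> (\<forall>P :: 'u rel. \<forall>X \<in> Obj K.
     Partial_order P \<and> small (Field P) \<longrightarrow> (\<exists>T. is_tensor K P X T))"

definition is_subkernel_pair ::
  "('o, 'm) pcat \<Rightarrow> 'o \<Rightarrow> 'o \<Rightarrow> 'm \<Rightarrow> 'o \<Rightarrow> 'm \<Rightarrow> 'm \<Rightarrow> bool" where
  "is_subkernel_pair K X Y f W u\<^sub>0 u\<^sub>1 \<longleftrightarrow>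
     u\<^sub>0 \<in> arrows K W X \<and> u\<^sub>1 \<in> arrows K W X \<and> (f \<odot>\<^bsub>K\<^esub> u\<^sub>0, f \<odot>\<^bsub>K\<^esub> u\<^sub>1) \<in> Hom K W Y \<and>
     (\<forall>V. \<forall>v\<^sub>0 \<in> arrows K V X. \<forall>v\<^sub>1 \<in> arrows K V X. (f \<odot>\<^bsub>K\<^esub> v\<^sub>0, f \<odot>\<^bsub>K\<^esub> v\<^sub>1) \<in> Hom K V Y \<longrightarrow>
        (\<exists>k \<in> arrows K V W. v\<^sub>0 = u\<^sub>0 \<odot>\<^bsub>K\<^esub> k \<and> v\<^sub>1 = u\<^sub>1 \<odot>\<^bsub>K\<^esub> k)) \<and>
     (\<forall>V. \<forall>k \<in> arrows K V W. \<forall>k' \<in> arrows K V W.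
        (u\<^sub>0 \<odot>\<^bsub>K\<^esub> k, u\<^sub>0 \<odot>\<^bsub>K\<^esub> k') \<in> Hom K V X \<and> (u\<^sub>1 \<odot>\<^bsub>K\<^esub> k, u\<^sub>1 \<odot>\<^bsub>K\<^esub> k') \<in> Hom K V X \<longrightarrow>
        (k, k') \<in> Hom K V W)"

definition has_subkernel_pairs :: "('o, 'm) pcat \<Rightarrow> bool" where
  "has_subkernel_pairs K \<longleftrightarrow>
     (\<forall>X Y. \<forall>f \<in> arrows K X Y. \<exists>W u\<^sub>0 u\<^sub>1. is_subkernel_pair K X Y f W u\<^sub>0 u\<^sub>1)"

definition is_coinserter ::
  "('o, 'm) pcat \<Rightarrow> 'o \<Rightarrow> 'o \<Rightarrow> 'm \<Rightarrow> 'm \<Rightarrow> 'o \<Rightarrow> 'm \<Rightarrow> bool" where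
  "is_coinserter K W X u\<^sub>0 u\<^sub>1 Y f \<longleftrightarrow>
     f \<in> arrows K X Y \<and> (f \<odot>\<^bsub>K\<^esub> u\<^sub>0, f \<odot>\<^bsub>K\<^esub> u\<^sub>1) \<in> Hom K W Y \<and>
     (\<forall>Y'. \<forall>f' \<in> arrows K X Y'. (f' \<odot>\<^bsub>K\<^esub> u\<^sub>0, f' \<odot>\<^bsub>K\<^esub> u\<^sub>1) \<in> Hom K W Y' \<longrightarrow>
        (\<exists>g \<in> arrows K Y Y'. f' = g \<odot>\<^bsub>K\<^esub> f)) \<and>
     (\<forall>Y'. \<forall>g \<in> arrows K Y Y'. \<forall>g' \<in> arrows K Y Y'.
        (g \<odot>\<^bsub>K\<^esub> f, g' \<odot>\<^bsub>K\<^esub> f) \<in> Hom K X Y' \<longrightarrow> (g, g') \<in> Hom K Y Y')"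

definition reflexive_pair :: "('o, 'm) pcat \<Rightarrow> 'o \<Rightarrow> 'o \<Rightarrow> 'm \<Rightarrow> 'm \<Rightarrow> bool" where
  "reflexive_pair K W X u\<^sub>0 u\<^sub>1 \<longleftrightarrow> u\<^sub>0 \<in> arrows K W X \<and> u\<^sub>1 \<in> arrows K W X \<and>
     (\<exists>d \<in> arrows K X W. u\<^sub>0 \<odot>\<^bsub>K\<^esub> d = Idt K X \<and> u\<^sub>1 \<odot>\<^bsub>K\<^esub> d = Idt K X)"

definition has_reflexive_coinserters :: "('o, 'm) pcat \<Rightarrow> bool" where
  "has_reflexive_coinserters K \<longleftrightarrow>
     (\<forall>W X u\<^sub>0 u\<^sub>1. reflexive_pair K W X u\<^sub>0 u\<^sub>1 \<longrightarrow> (\<exists>Y f. is_coinserter K W X u\<^sub>0 u\<^sub>1 Y f))"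

definition preserves_reflexive_coinserters ::
  "('o, 'm) pcat \<Rightarrow> ('p, 'n) pcat \<Rightarrow> ('o, 'm, 'p, 'n) pfunctor \<Rightarrow> bool" where
  "preserves_reflexive_coinserters K L F \<longleftrightarrow>
     (\<forall>W X u\<^sub>0 u\<^sub>1 Y f. reflexive_pair K W X u\<^sub>0 u\<^sub>1 \<and> is_coinserter K W X u\<^sub>0 u\<^sub>1 Y f \<longrightarrow>
        is_coinserter L (ob F W) (ob F X) (ar F u\<^sub>0) (ar F u\<^sub>1) (ob F Y) (ar F f))"

text \<open>
  A diagram over a poset \<open>I\<close> has objects \<open>D i\<close> and connecting arrows \<open>d i j\<close> for \<open>i \<le> j\<close>.
  Colimits are (conical) colimits in the enriched sense: the universal property includes the
  order of the hom-posets.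
\<close>

definition is_diagram ::
  "('o, 'm) pcat \<Rightarrow> 'i rel \<Rightarrow> ('i \<Rightarrow> 'o) \<Rightarrow> ('i \<Rightarrow> 'i \<Rightarrow> 'm) \<Rightarrow> bool" where
  "is_diagram K I D d \<longleftrightarrow>
     (\<forall>i \<in> Field I. D i \<in> Obj K \<and> d i i = Idt K (D i)) \<and>
     (\<forall>(i, j) \<in> I. d i j \<in> arrows K (D i) (D j)) \<and>
     (\<forall>i j k. (i, j) \<in> I \<and> (j, k) \<in> I \<longrightarrow> d i k = d j k \<odot>\<^bsub>K\<^esub> d i j)"

definition is_cocone ::
  "('o, 'm) pcat \<Rightarrow> 'i rel \<Rightarrow> ('i \<Rightarrow> 'o) \<Rightarrow> ('i \<Rightarrow> 'i \<Rightarrow> 'm) \<Rightarrow> 'o \<Rightarrow> ('i \<Rightarrow> 'm) \<Rightarrow> bool" where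
  "is_cocone K I D d C c \<longleftrightarrow> C \<in> Obj K \<and>
     (\<forall>i \<in> Field I. c i \<in> arrows K (D i) C) \<and>
     (\<forall>(i, j) \<in> I. c j \<odot>\<^bsub>K\<^esub> d i j = c i)"

definition is_colimit ::
  "('o, 'm) pcat \<Rightarrow> 'i rel \<Rightarrow> ('i \<Rightarrow> 'o) \<Rightarrow> ('i \<Rightarrow> 'i \<Rightarrow> 'm) \<Rightarrow> 'o \<Rightarrow> ('i \<Rightarrow> 'm) \<Rightarrow> bool" where
  "is_colimit K I D d C c \<longleftrightarrow> is_cocone K I D d C c \<and>
     (\<forall>Z e. is_cocone K I D d Z e \<longrightarrow>
        (\<exists>g \<in> arrows K C Z. \<forall>i \<in> Field I. g \<odot>\<^bsub>K\<^esub> c i = e i)) \<and>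
     (\<forall>Z. \<forall>g \<in> arrows K C Z. \<forall>g' \<in> arrows K C Z.
        (\<forall>i \<in> Field I. (g \<odot>\<^bsub>K\<^esub> c i, g' \<odot>\<^bsub>K\<^esub> c i) \<in> Hom K (D i) Z) \<longrightarrow> (g, g') \<in> Hom K C Z)"

definition finitary ::
  "'u itself \<Rightarrow> ('o, 'm) pcat \<Rightarrow> ('p, 'n) pcat \<Rightarrow> ('o, 'm, 'p, 'n) pfunctor \<Rightarrow> bool" where
  "finitary _ K L F \<longleftrightarrow> (\<forall>(I :: 'u rel) D d C c.
     directed_poset I \<and> small (Field I) \<and> is_diagram K I D d \<and> is_colimit K I D d C c \<longrightarrow>
     is_colimit L I (\<lambda>i. ob F (D i)) (\<lambda>i j. ar F (d i j)) (ob F C) (\<lambda>i. ar F (c i)))"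


section \<open>The category of posets and concrete categories\<close>

text \<open>Arrows are triples (domain, function, codomain), which makes the hom-sets disjoint.\<close>

type_synonym 'u pos_arrow = "'u rel \<times> ('u \<Rightarrow> 'u) \<times> 'u rel"

definition Pos :: "('u rel, 'u pos_arrow) pcat" where
  "Pos = \<lparr>Obj = {r. Partial_order r \<and> small (Field r)},
          Hom = (\<lambda>r s. {((r, f, s), (r, g, s)) | f g. (f, g) \<in> map_poset r s}),
          Idt = (\<lambda>r. (r, \<lambda>x \<in> Field r. x, r)),
          Cmp = (\<lambda>(_, g, t) (r, f, _). (r, compose (Field r) g f, t))\<rparr>"

definition concrete_category ::
  "('o, 'm) pcat \<Rightarrow> ('o, 'm, 'u rel, 'u pos_arrow) pfunctor \<Rightarrow> bool" where
  "concrete_category K U \<longleftrightarrow> pos_category K \<and> enriched_functor K Pos U \<and>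
     (\<forall>X Y. \<forall>f \<in> arrows K X Y. \<forall>g \<in> arrows K X Y.
        (f, g) \<in> Hom K X Y \<longleftrightarrow> (ar U f, ar U g) \<in> Hom Pos (ob U X) (ob U Y))"

definition concretely_equivalent ::
  "('o, 'm) pcat \<Rightarrow> ('o, 'm, 'u rel, 'u pos_arrow) pfunctor \<Rightarrow>
   ('p, 'n) pcat \<Rightarrow> ('p, 'n, 'u rel, 'u pos_arrow) pfunctor \<Rightarrow> bool" where
  "concretely_equivalent K U K' U' \<longleftrightarrow>
     (\<exists>E. equivalence K K' E \<and> functor_eq K U (comp_functor U' E))"


section \<open>Varieties of ordered algebras\<close>

text \<open>
  A signature is a family \<open>S\<close> of small sets \<open>S n\<close> of \<open>n\<close>-ary operation symbols. The sets \<open>S n\<close>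
  need not be disjoint: a symbol applied to a list of arguments is read with the length of
  that list as its arity.
\<close>

type_synonym 'u signature = "nat \<Rightarrow> 'u set"

definition is_signature :: "'u signature \<Rightarrow> bool" where
  "is_signature S \<longleftrightarrow> (\<forall>n. small (S n))"

record 'u ordered_alg =
  under :: "'u rel"
  oper :: "'u \<Rightarrow> 'u list \<Rightarrow> 'u"

definition ordered_algebra :: "'u signature \<Rightarrow> 'u ordered_alg \<Rightarrow> bool" where
  "ordered_algebra S A \<longleftrightarrow> under A \<in> Obj Pos \<and>
     (\<forall>f xs. f \<in> S (length xs) \<and> set xs \<subseteq> Field (under A) \<longrightarrow> oper A f xs \<in> Field (under A)) \<and>
     (\<forall>f xs ys. f \<in> S (length xs) \<and> list_all2 (\<lambda>x y. (x, y) \<in> under A) xs ys \<longrightarrow>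
        (oper A f xs, oper A f ys) \<in> under A) \<and>
     (\<forall>f xs. \<not> (f \<in> S (length xs) \<and> set xs \<subseteq> Field (under A)) \<longrightarrow> oper A f xs = undefined)"

definition monotone_homs ::
  "'u signature \<Rightarrow> 'u ordered_alg \<Rightarrow> 'u ordered_alg \<Rightarrow> ('u \<Rightarrow> 'u) set" where
  "monotone_homs S A B = {h \<in> monotone_maps (under A) (under B).
     \<forall>f xs. f \<in> S (length xs) \<and> set xs \<subseteq> Field (under A) \<longrightarrow>
       h (oper A f xs) = oper B f (map h xs)}"

datatype 'u trm = Var nat | App 'u "'u trm list"

fun is_term :: "'u signature \<Rightarrow> 'u trm \<Rightarrow> bool" where
  "is_term S (Var n) \<longleftrightarrow> True"
| "is_term S (App f ts) \<longleftrightarrow> f \<in> S (length ts) \<and> (\<forall>t \<in> set ts. is_term S t)"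

fun eval_term :: "'u ordered_alg \<Rightarrow> (nat \<Rightarrow> 'u) \<Rightarrow> 'u trm \<Rightarrow> 'u" where
  "eval_term A v (Var n) = v n"
| "eval_term A v (App f ts) = oper A f (map (eval_term A v) ts)"

text \<open>A pair \<open>(s, t)\<close> of terms stands for the inequation \<open>s \<le> t\<close>.\<close>

definition satisfies :: "'u ordered_alg \<Rightarrow> 'u trm \<times> 'u trm \<Rightarrow> bool" where
  "satisfies A e \<longleftrightarrow> (\<forall>v. range v \<subseteq> Field (under A) \<longrightarrow>
     (eval_term A v (fst e), eval_term A v (snd e)) \<in> under A)"

definition are_inequations :: "'u signature \<Rightarrow> ('u trm \<times> 'u trm) set \<Rightarrow> bool" where
  "are_inequations S \<Gamma> \<longleftrightarrow> (\<forall>(s, t) \<in> \<Gamma>. is_term S s \<and> is_term S t)"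

type_synonym 'u alg_arrow = "'u ordered_alg \<times> ('u \<Rightarrow> 'u) \<times> 'u ordered_alg"

definition Variety ::
  "'u signature \<Rightarrow> ('u trm \<times> 'u trm) set \<Rightarrow> ('u ordered_alg, 'u alg_arrow) pcat" where
  "Variety S \<Gamma> =
     \<lparr>Obj = {A. ordered_algebra S A \<and> (\<forall>e \<in> \<Gamma>. satisfies A e)},
      Hom = (\<lambda>A B. {((A, f, B), (A, g, B)) | f g.
               f \<in> monotone_homs S A B \<and> g \<in> monotone_homs S A B \<and>
               (f, g) \<in> map_poset (under A) (under B)}),
      Idt = (\<lambda>A. (A, \<lambda>x \<in> Field (under A). x, A)),
      Cmp = (\<lambda>(_, g, C) (A, f, _). (A, compose (Field (under A)) g f, C))\<rparr>"

definition Underlying ::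
  "('u ordered_alg, 'u alg_arrow, 'u rel, 'u pos_arrow) pfunctor" where
  "Underlying = \<lparr>ob = under, ar = (\<lambda>(A, f, B). (under A, f, under B))\<rparr>"

end

theory Submission
  imports Defs
begin

text \<open>
  If \<open>K\<close> is concretely equivalent to a variety, its objects are the algebras up to isomorphism.
  All constructions are quotients of small preordered algebras: free objects and tensors are
  presented by generators and relations, subkernel pairs are subalgebras of squares, and
  directed colimits and reflexive coinserters carry the structure of those formed in \<open>Pos\<close>.

  Conversely, let \<open>F\<close> be the left adjoint of \<open>U\<close>. The elements of \<open>U F n\<close>, for the finite
  discrete posets \<open>n\<close>, are the \<open>n\<close>-ary operation symbols; they act on \<open>U X\<close> by
  \<open>\<sigma>(x) = U x\<^sup>#(\<sigma>)\<close>, where \<open>x\<^sup># : F n \<rightarrow> X\<close> is the transpose of \<open>x : n \<rightarrow> U X\<close>, and the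
  inequations are those that hold in all \<open>X\<close>. Since \<open>U\<close> is finitary and every poset is a
  reflexive coinserter of discrete posets, \<open>F P\<close> is the free algebra on \<open>P\<close>. The kernel of a
  homomorphism out of \<open>F P\<close> is covered by a reflexive pair in \<open>K\<close>, whose coinserter is preserved
  by \<open>U\<close>: applied to \<open>F U X \<rightarrow> X\<close> this shows that the comparison is full, and applied to the
  canonical map \<open>F P \<rightarrow> A\<close> for an algebra \<open>A\<close> on \<open>P\<close> that it is essentially surjective.
\<close>

section \<open>Posets, terms and small sets\<close>

text \<open>The type \<open>'u\<close> is assumed uncountable of regular cardinality. Uncountability
  makes countable sets small, regularity closes small sets under small unions; as terms have finite
  depth, this keeps the terms over a small signature small. No powerset has to be small, only sets
  of pairs, lists and finite subsets.

  Carriers of algebras, generating posets and index posets must lie inside \<open>'u\<close>,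
  whereas the constructions naturally live on pairs, terms or sets. They are carried out on those
  types and moved into \<open>'u\<close> along an injection.

  The obstacle of the converse direction: an algebra \<open>C\<close> of the variety is not known to
  come from \<open>K\<close>, so the universal property of \<open>F P\<close> says nothing about
  maps into \<open>C\<close>. The only link is syntax. Elements of \<open>F P\<close> are values of
  terms, and for discrete \<open>P\<close> an inequality between such values at the generators is a
  law of \<open>C\<close>. Hence generation by terms must be proved before anything can map from
  \<open>F P\<close> to \<open>C\<close>. For general \<open>P\<close> an inequality holds only
  relative to the order of the generators, so the discrete case is transported along the coinserter
  that presents \<open>P\<close>.\<close>

lemma Partial_orderI:
  assumes "\<And>x. x \<in> Field r \<Longrightarrow> (x, x) \<in> r"
    and "\<And>x y z. (x, y) \<in> r \<Longrightarrow> (y, z) \<in> r \<Longrightarrow> (x, z) \<in> r"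
    and "\<And>x y. (x, y) \<in> r \<Longrightarrow> (y, x) \<in> r \<Longrightarrow> x = y"
  shows "Partial_order r"
  unfolding partial_order_on_def preorder_on_def refl_on_def trans_def antisym_def
  using assms by (auto simp: Field_def)

lemma Partial_orderD:
  assumes "Partial_order r"
  shows "x \<in> Field r \<Longrightarrow> (x, x) \<in> r"
    and "(x, y) \<in> r \<Longrightarrow> (y, z) \<in> r \<Longrightarrow> (x, z) \<in> r"
    and "(x, y) \<in> r \<Longrightarrow> (y, x) \<in> r \<Longrightarrow> x = y"
  using assms unfolding partial_order_on_def preorder_on_def refl_on_def
  by (blast, meson transD, meson antisymD)

text \<open>Operations on an image or a quotient are computed by lifting the list of arguments entry
  by entry.\<close>

lemma set_subset_imageE:
  assumes "set us \<subseteq> f ` M" obtains xs where "us = map f xs" "set xs \<subseteq> M"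
proof
  show "us = map f (map (inv_into M f) us)"
    using assms by (induction us) (auto simp: f_inv_into_f)
  show "set (map (inv_into M f) us) \<subseteq> M"
    using assms inv_into_into[of _ f M] by fastforce
qed

lemma list_all2_Field:
  assumes "list_all2 (\<lambda>x y. (x, y) \<in> r) xs ys"
  shows "set xs \<subseteq> Field r" "set ys \<subseteq> Field r" "length xs = length ys"
  using assms by (induction rule: list_all2_induct) (auto intro: FieldI1 FieldI2)

lemma list_all2_mapI:
  assumes "list_all2 P xs ys" "\<And>x y. x \<in> set xs \<Longrightarrow> y \<in> set ys \<Longrightarrow> P x y \<Longrightarrow> Q (f x) (g y)"
  shows "list_all2 Q (map f xs) (map g ys)"
  using assms by (induction rule: list_all2_induct) auto

text \<open>Applied to the preorder that a parallel pair generates on a poset: a map that respects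
  the generating steps respects every chain of them. The relation \<open>s\<close> will be the order
  of a poset, reflexive on its field only, so for the chain of length zero reflexivity is asked at
  the values of \<open>h\<close> on \<open>X\<close>.\<close>

lemma rtrancl_map_mono:
  assumes "(x, y) \<in> r\<^sup>*" "x \<in> X" "r \<subseteq> X \<times> X" "\<And>a. a \<in> X \<Longrightarrow> (h a, h a) \<in> s" "trans s"
    "\<And>a b. (a, b) \<in> r \<Longrightarrow> (h a, h b) \<in> s"
  shows "(h x, h y) \<in> s"
  using assms(1)
proof (induction rule: rtrancl_induct)
  case base
  then show ?case using assms(2,4) by blast
next
  case (step y z)
  then show ?case using assms(5,6) by (meson transD)
qed

text \<open>The variables of \<open>trm\<close> are natural numbers. Presentations and free objects
  need terms whose variables are the generators themselves, and these are elements of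
  \<open>'u\<close> or pairs of such elements.\<close>

datatype ('f, 'v) gterm = GVar 'v | GApp 'f "('f, 'v) gterm list"

fun is_gterm :: "(nat \<Rightarrow> 'f set) \<Rightarrow> 'v set \<Rightarrow> ('f, 'v) gterm \<Rightarrow> bool" where
  "is_gterm S V (GVar x) \<longleftrightarrow> x \<in> V"
| "is_gterm S V (GApp f ts) \<longleftrightarrow> f \<in> S (length ts) \<and> (\<forall>t \<in> set ts. is_gterm S V t)"

fun geval :: "('f \<Rightarrow> 'a list \<Rightarrow> 'a) \<Rightarrow> ('v \<Rightarrow> 'a) \<Rightarrow> ('f, 'v) gterm \<Rightarrow> 'a" where
  "geval p v (GVar x) = v x"
| "geval p v (GApp f ts) = p f (map (geval p v) ts)"

text \<open>\<open>eval_term\<close> only knows algebras with carrier in \<open>'u\<close>.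
  Inequations also have to be evaluated in algebras of pairs or of terms, before these are
  transported to \<open>'u\<close>.\<close>

fun teval :: "('u \<Rightarrow> 'a list \<Rightarrow> 'a) \<Rightarrow> (nat \<Rightarrow> 'a) \<Rightarrow> 'u trm \<Rightarrow> 'a" where
  "teval p v (Var n) = v n"
| "teval p v (App f ts) = p f (map (teval p v) ts)"

lemma eval_term_teval: "eval_term A v t = teval (oper A) v t"
  by (induction t) (auto cong: map_cong)

section \<open>Small sets: arithmetic below an uncountable regular cardinal\<close>

locale universe =
  fixes univ :: "'u set"
  assumes univ: "univ = UNIV" and unc: "uncountable (UNIV :: 'u set)" and reg: "regularCard |UNIV :: 'u set|"
begin

text \<open>\<open>small\<close> applies to subsets of \<open>'u\<close> only, \<open>sm\<close> to
  sets of any type. The parameter \<open>univ\<close> always equals \<open>UNIV\<close>; it ties the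
  type \<open>'u\<close> to the locale.\<close>

abbreviation sm :: "'a set \<Rightarrow> bool" where
  "sm A \<equiv> |A| <o |univ|"

lemma infinite_univ: "infinite (UNIV :: 'u set)"
  using unc uncountable_infinite by blast

lemma stable_univ: "stable |univ|"
  unfolding univ
  using regularCard_stable[OF card_of_Card_order _ reg] infinite_univ by (simp add: Field_card_of)

text \<open>A set that is not small receives an injection from \<open>'u\<close>, and a countable
  set cannot receive one because \<open>'u\<close> is uncountable.\<close>

lemma sm_countable: assumes "countable A" shows "sm A"
proof -
  have "\<not> |UNIV :: 'u set| \<le>o |A|"
  proof
    assume "|UNIV :: 'u set| \<le>o |A|"
    then obtain f :: "'u \<Rightarrow> 'a" where "inj f" "range f \<subseteq> A"
      using card_of_ordLeq[of "UNIV :: 'u set" A] by auto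
    then have "countable (UNIV :: 'u set)"
      using assms countable_image_inj_on countable_subset by blast
    then show False using unc by simp
  qed
  then show ?thesis using not_ordLeq_iff_ordLess[OF card_of_Well_order card_of_Well_order, of "UNIV :: 'u set" A] by (simp add: univ)
qed

lemma sm_UN: "sm I \<Longrightarrow> (\<And>i. i \<in> I \<Longrightarrow> sm (A i)) \<Longrightarrow> sm (\<Union>i \<in> I. A i)"
  using stable_UNION[OF stable_univ] by blast

lemma sm_Sigma: "sm I \<Longrightarrow> (\<And>i. i \<in> I \<Longrightarrow> sm (A i)) \<Longrightarrow> sm (Sigma I A)"
  using stable_elim[OF stable_univ] by blast

lemma sm_image: "sm A \<Longrightarrow> sm (f ` A)"
  using card_of_image ordLeq_ordLess_trans by blast

lemma sm_subset: "sm A \<Longrightarrow> B \<subseteq> A \<Longrightarrow> sm B"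
  using card_of_mono1 ordLeq_ordLess_trans by blast

lemma sm_Un: assumes "sm A" "sm B" shows "sm (A \<union> B)"
proof -
  have "sm (\<Union>b \<in> (UNIV :: bool set). if b then A else B)"
    by (rule sm_UN) (use assms in \<open>auto intro: sm_countable\<close>)
  moreover have "(\<Union>b \<in> (UNIV :: bool set). if b then A else B) = A \<union> B"
    by auto
  ultimately show ?thesis by simp
qed

lemma sm_lists: assumes "sm A" shows "sm (lists A)"
proof -
  have *: "sm {xs \<in> lists A. length xs = n}" for n
  proof (induction n)
    case 0
    have "{xs \<in> lists A. length xs = 0} = {[]}" by auto
    then show ?case using sm_countable[of "{[]}"] by simp
  next
    case (Suc n)
    have "{xs \<in> lists A. length xs = Suc n} \<subseteq> (\<lambda>(x, xs). x # xs) ` (A \<times> {xs \<in> lists A. length xs = n})"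
      by (auto simp: length_Suc_conv)
    moreover have "sm (A \<times> {xs \<in> lists A. length xs = n})"
      using sm_Sigma[OF assms, of "\<lambda>_. {xs \<in> lists A. length xs = n}"] Suc by blast
    ultimately show ?case using sm_image sm_subset by meson
  qed
  have "lists A = (\<Union>n. {xs \<in> lists A. length xs = n})" by auto
  moreover have "sm (\<Union>n. {xs \<in> lists A. length xs = n})"
    by (rule sm_UN) (simp_all only: * sm_countable countableI_type)
  ultimately show ?thesis by simp
qed

text \<open>Terms have finite depth, so they are exhausted by a countable chain of levels
  \<open>L n\<close>. A level is obtained from the previous one by products and lists, hence stays
  small. Arities are disregarded in the levels, which therefore contain ill-formed terms as
  well.\<close>

lemma sm_gterms:
  fixes S :: "nat \<Rightarrow> 'f set" and V :: "'v set"
  assumes "\<And>n. sm (S n)" "sm V"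
  shows "sm {t. is_gterm S V t}"
proof -
  define L where "L n = ((\<lambda>T. GVar ` V \<union> (\<lambda>(f, ts). GApp f ts) ` ((\<Union>n. S n) \<times> lists T)) ^^ n) {}" for n
  have L_Suc: "L (Suc n) = GVar ` V \<union> (\<lambda>(f, ts). GApp f ts) ` ((\<Union>n. S n) \<times> lists (L n))" for n
    by (simp add: L_def)
  have smS: "sm (\<Union>n. S n)"
    by (rule sm_UN) (simp_all only: assms sm_countable countableI_type)
  have smL: "sm (L n)" for n
  proof (induction n)
    case 0
    then show ?case by (simp add: L_def sm_countable)
  next
    case (Suc n)
    have "sm ((\<Union>n. S n) \<times> lists (L n))"
      using sm_Sigma[OF smS, of "\<lambda>_. lists (L n)"] sm_lists[OF Suc] by blast
    then show ?case unfolding L_Suc using sm_Un sm_image assms(2) by meson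
  qed
  have mono: "L n \<subseteq> L (Suc n)" for n
  proof (induction n)
    case 0
    then show ?case by (simp add: L_def)
  next
    case (Suc n)
    then have "lists (L n) \<subseteq> lists (L (Suc n))" by (rule lists_mono)
    note L_Suc[of n]
    also have "GVar ` V \<union> (\<lambda>(f, ts). GApp f ts) ` ((\<Union>n. S n) \<times> lists (L n))
        \<subseteq> GVar ` V \<union> (\<lambda>(f, ts). GApp f ts) ` ((\<Union>n. S n) \<times> lists (L (Suc n)))"
      by (intro Un_mono image_mono Sigma_mono) (use \<open>lists (L n) \<subseteq> lists (L (Suc n))\<close> in auto)
    also note L_Suc[of "Suc n", symmetric]
    finally show ?case .
  qed
  have mono': "L n \<subseteq> L m" if "n \<le> m" for n m
    using lift_Suc_mono_le[of L, OF mono that] .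
  have "\<exists>n. t \<in> L n" if "is_gterm S V t" for t
    using that
  proof (induction t)
    case (GVar x)
    then have "GVar x \<in> L (Suc 0)" by (simp add: L_Suc)
    then show ?case by blast
  next
    case (GApp f ts)
    then have "\<forall>t \<in> set ts. \<exists>n. t \<in> L n" by simp
    then obtain k where k: "\<And>t. t \<in> set ts \<Longrightarrow> t \<in> L (k t)" by metis
    \<comment> \<open>The arguments lie on different levels; the sum of these finitely many levels
      bounds each of them, also when there are no arguments.\<close>
    have "t \<in> L (sum_list (map k ts))" if "t \<in> set ts" for t
      using k[OF that] mono'[OF member_le_sum_list[of "k t" "map k ts"]] that by auto
    then have "GApp f ts \<in> L (Suc (sum_list (map k ts)))"
      using GApp.prems unfolding L_Suc by (intro UnI2 image_eqI[of _ _ "(f, ts)"]) auto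
    then show ?case by blast
  qed
  then have "{t. is_gterm S V t} \<subseteq> (\<Union>n. L n)" by blast
  moreover have "sm (\<Union>n. L n)"
    by (rule sm_UN) (simp_all only: smL sm_countable countableI_type)
  ultimately show ?thesis using sm_subset by blast
qed

lemma sm_Fpow: assumes "sm A" shows "sm (Fpow A)"
proof -
  have "Fpow A \<subseteq> set ` lists A"
  proof
    fix X assume X: "X \<in> Fpow A"
    then obtain xs where "set xs = X" using finite_list by (auto simp: Fpow_def)
    then show "X \<in> set ` lists A" using X by (auto simp: Fpow_def in_lists_conv_set)
  qed
  then show ?thesis by (rule sm_subset[OF sm_image[OF sm_lists[OF assms]]])
qed

text \<open>The source of all codings in \<open>'u\<close>: quotients, index posets and generating
  posets are transported along such an injection.\<close>

lemma sm_embed: assumes "sm A" obtains e :: "'a \<Rightarrow> 'u" where "inj_on e A"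
  using assms card_of_ordLeq[of A univ] ordLess_imp_ordLeq by blast

lemma small_iff_sm: "small (A :: 'u set) \<longleftrightarrow> sm A"
  by (simp add: small_def univ)

end

section \<open>Quotients of preordered algebras\<close>

text \<open>An algebra up to equivalence: \<open>le\<close> is only a preorder, and monotonicity of
  the operations makes the equivalence induced by \<open>le\<close> a congruence. The poset
  reflection is an ordered algebra on a subset of \<open>'u\<close>.\<close>

locale preordered_algebra = universe univ for univ :: "'u set" +
  fixes S :: "'u signature" and M :: "'x set" and le :: "'x \<Rightarrow> 'x \<Rightarrow> bool" and p :: "'u \<Rightarrow> 'x list \<Rightarrow> 'x"
  assumes sm_M: "sm M"
    and le_refl: "x \<in> M \<Longrightarrow> le x x"
    and le_trans: "x \<in> M \<Longrightarrow> y \<in> M \<Longrightarrow> z \<in> M \<Longrightarrow> le x y \<Longrightarrow> le y z \<Longrightarrow> le x z"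
    and p_closed: "f \<in> S (length xs) \<Longrightarrow> set xs \<subseteq> M \<Longrightarrow> p f xs \<in> M"
    and p_mono: "f \<in> S (length xs) \<Longrightarrow> set xs \<subseteq> M \<Longrightarrow> set ys \<subseteq> M \<Longrightarrow> list_all2 le xs ys \<Longrightarrow> le (p f xs) (p f ys)"
begin

definition cls :: "'x \<Rightarrow> 'x set" where
  "cls x = {y \<in> M. le x y \<and> le y x}"

text \<open>The class of \<open>x\<close>, coded in \<open>'u\<close> by one injection that is
  chosen for the whole set of classes.\<close>

definition proj :: "'x \<Rightarrow> 'u" where
  "proj x = (SOME e. inj_on e (cls ` M)) (cls x)"

definition quot_rel :: "'u rel" where
  "quot_rel = {(proj x, proj y) | x y. x \<in> M \<and> y \<in> M \<and> le x y}"

definition quot :: "'u ordered_alg" where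
  "quot = \<lparr>under = quot_rel,
    oper = (\<lambda>f us. if f \<in> S (length us) \<and> set us \<subseteq> proj ` M then proj (p f (map (inv_into M proj) us)) else undefined)\<rparr>"

lemma proj_eq: assumes "x \<in> M" "y \<in> M" shows "proj x = proj y \<longleftrightarrow> le x y \<and> le y x"
proof -
  obtain e :: "'x set \<Rightarrow> 'u" where "inj_on e (cls ` M)"
    using sm_embed[OF sm_image[OF sm_M]] .
  then have "inj_on (SOME e :: 'x set \<Rightarrow> 'u. inj_on e (cls ` M)) (cls ` M)"
    by (rule someI[where P = "\<lambda>e. inj_on e (cls ` M)"])
  then have "proj x = proj y \<longleftrightarrow> cls x = cls y"
    using assms unfolding proj_def by (simp add: inj_on_eq_iff)
  also have "\<dots> \<longleftrightarrow> le x y \<and> le y x"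
    using assms le_refl le_trans unfolding cls_def by blast
  finally show ?thesis .
qed

lemma proj_le: assumes "x \<in> M" "y \<in> M" shows "(proj x, proj y) \<in> under quot \<longleftrightarrow> le x y"
proof
  assume "(proj x, proj y) \<in> under quot"
  then obtain x' y' where "x' \<in> M" "y' \<in> M" "proj x = proj x'" "proj y = proj y'" "le x' y'"
    by (auto simp: quot_def quot_rel_def)
  then show "le x y" using assms proj_eq le_trans by metis
qed (use assms in \<open>auto simp: quot_def quot_rel_def\<close>)

lemma Field_quot: "Field (under quot) = proj ` M"
  using le_refl by (auto simp: quot_def quot_rel_def Field_def)

lemma quot_order: "Partial_order (under quot)"
proof (rule Partial_orderI)
  have F: "\<exists>x \<in> M. u = proj x" "\<exists>x \<in> M. v = proj x" if "(u, v) \<in> under quot" for u v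
    using that Field_quot by (auto simp: Field_def)
  show "(u, u) \<in> under quot" if "u \<in> Field (under quot)" for u
    using that le_refl proj_le unfolding Field_quot by blast
  show "(u, w) \<in> under quot" if uv: "(u, v) \<in> under quot" and vw: "(v, w) \<in> under quot" for u v w
  proof -
    obtain x y z where "x \<in> M" "y \<in> M" "z \<in> M" "u = proj x" "v = proj y" "w = proj z"
      using F[OF uv] F[OF vw] by blast
    then show ?thesis using uv vw proj_le le_trans by metis
  qed
  show "u = v" if uv: "(u, v) \<in> under quot" and vu: "(v, u) \<in> under quot" for u v
  proof -
    obtain x y where "x \<in> M" "y \<in> M" "u = proj x" "v = proj y"
      using F[OF uv] by blast
    then show ?thesis using uv vu proj_le proj_eq by metis
  qed
qed

text \<open>\<open>quot\<close> computes with the representatives picked by \<open>inv_into\<close>.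
  These are equivalent, entry by entry, to the given arguments, and \<open>p_mono\<close> in both
  directions makes the results equivalent.\<close>

lemma proj_oper:
  assumes "f \<in> S (length xs)" "set xs \<subseteq> M"
  shows "proj (p f xs) = oper quot f (map proj xs)"
proof -
  let ?ys = "map (inv_into M proj) (map proj xs)"
  have 1: "set ?ys \<subseteq> M" using assms(2) by (auto intro!: inv_into_into)
  have 2: "list_all2 le xs ?ys" "list_all2 le ?ys xs"
    using assms(2) proj_eq inv_into_into[of _ proj M] f_inv_into_f[of _ proj M]
    by (auto simp: list_all2_conv_all_nth) (metis imageI nth_mem subsetD)+
  have "proj (p f xs) = proj (p f ?ys)"
    using p_mono[OF _ _ _ 2(1)] p_mono[OF _ _ _ 2(2)] p_closed 1 assms by (subst proj_eq) auto
  then show ?thesis using assms by (auto simp: quot_def)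
qed

lemma ordered_algebra_quot: "ordered_algebra S quot"
  unfolding ordered_algebra_def
proof (intro conjI allI impI)
  show "under quot \<in> Obj Pos"
    using quot_order sm_image[OF sm_M] by (simp add: Pos_def small_iff_sm Field_quot)
next
  fix f us assume A: "f \<in> S (length us) \<and> set us \<subseteq> Field (under quot)"
  then obtain xs where "us = map proj xs" "set xs \<subseteq> M"
    unfolding Field_quot by (auto elim: set_subset_imageE)
  then show "oper quot f us \<in> Field (under quot)"
    using A proj_oper p_closed by (metis Field_quot image_eqI length_map)
next
  fix f us vs assume A: "f \<in> S (length us) \<and> list_all2 (\<lambda>x y. (x, y) \<in> under quot) us vs"
  then have "set us \<subseteq> proj ` M" "set vs \<subseteq> proj ` M"
    using list_all2_Field[of "under quot" us vs] by (auto simp: Field_quot)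
  then obtain xs ys where xs: "us = map proj xs" "set xs \<subseteq> M" and ys: "vs = map proj ys" "set ys \<subseteq> M"
    by (auto elim!: set_subset_imageE)
  have l: "list_all2 le xs ys"
    unfolding list_all2_conv_all_nth
  proof (intro conjI allI impI)
    show len: "length xs = length ys"
      using A xs ys by (auto dest: list_all2_lengthD)
    fix i assume i: "i < length xs"
    then have "(proj (xs ! i), proj (ys ! i)) \<in> under quot"
      using A xs ys len by (auto simp: list_all2_conv_all_nth)
    then show "le (xs ! i) (ys ! i)"
      using i len xs ys by (subst (asm) proj_le) auto
  qed
  then have "length xs = length ys" by (rule list_all2_lengthD)
  then show "(oper quot f us, oper quot f vs) \<in> under quot"
    using A xs ys p_mono[OF _ xs(2) ys(2) l] proj_oper[of f xs] proj_oper[of f ys] proj_le p_closed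
    by (metis length_map)
next
  fix f us assume "\<not> (f \<in> S (length us) \<and> set us \<subseteq> Field (under quot))"
  then have "\<not> (f \<in> S (length us) \<and> set us \<subseteq> proj ` M)"
    by (simp add: Field_quot)
  then show "oper quot f us = undefined" by (auto simp: quot_def)
qed

lemma teval_closed:
  assumes "is_term S t" "range v \<subseteq> M" shows "teval p v t \<in> M"
  using assms by (induction t) (auto intro!: p_closed)

lemma proj_teval:
  assumes "is_term S t" "range v \<subseteq> M"
  shows "proj (teval p v t) = teval (oper quot) (\<lambda>n. proj (v n)) t"
  using assms
proof (induction t)
  case (App f ts)
  have "proj (p f (map (teval p v) ts)) = oper quot f (map proj (map (teval p v) ts))"
    by (rule proj_oper) (use App.prems teval_closed in auto)
  also have "map proj (map (teval p v) ts) = map (teval (oper quot) (\<lambda>n. proj (v n))) ts"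
    using App by auto
  finally show ?case by simp
qed simp

text \<open>Every valuation in the quotient lifts along the surjection \<open>proj\<close>, and
  evaluation of terms commutes with it; so a law can be checked before passing to classes.\<close>

lemma quot_satisfies:
  assumes "is_term S s" "is_term S t"
    and "\<And>v. range v \<subseteq> M \<Longrightarrow> le (teval p v s) (teval p v t)"
  shows "satisfies quot (s, t)"
  unfolding satisfies_def
proof (intro allI impI)
  fix v :: "nat \<Rightarrow> 'u" assume "range v \<subseteq> Field (under quot)"
  then have "\<forall>n. \<exists>x \<in> M. v n = proj x" by (auto simp: Field_quot)
  then obtain w where w: "range w \<subseteq> M" "v = (\<lambda>n. proj (w n))"
    unfolding image_subset_iff by metis
  then show "(eval_term quot v (fst (s, t)), eval_term quot v (snd (s, t))) \<in> under quot"
    using assms proj_le teval_closed proj_teval by (metis eval_term_teval fst_conv snd_conv)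
qed

end

section \<open>Monotone maps elementwise\<close>

text \<open>Each element of \<open>Field r\<close> occurs in a pair of \<open>r\<close>, so
  preservation of the relation already puts the values into \<open>Field s\<close>.\<close>

lemma monotone_maps_iff:
  "f \<in> monotone_maps r s \<longleftrightarrow> f \<in> extensional (Field r) \<and> (\<forall>x y. (x, y) \<in> r \<longrightarrow> (f x, f y) \<in> s)"
proof
  assume f: "f \<in> extensional (Field r) \<and> (\<forall>x y. (x, y) \<in> r \<longrightarrow> (f x, f y) \<in> s)"
  have "f x \<in> Field s" if "x \<in> Field r" for x
    using that f unfolding Field_def by blast
  then show "f \<in> monotone_maps r s" using f by (auto simp: monotone_maps_def PiE_def Pi_def)
qed (auto simp: monotone_maps_def PiE_def)

lemma monotone_mapsD:
  assumes "f \<in> monotone_maps r s"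
  shows "x \<in> Field r \<Longrightarrow> f x \<in> Field s" "(x, y) \<in> r \<Longrightarrow> (f x, f y) \<in> s" "f \<in> extensional (Field r)"
  using assms by (auto simp: monotone_maps_def PiE_def)

lemma monotone_mapsI:
  assumes "\<And>x y. (x, y) \<in> r \<Longrightarrow> (h x, h y) \<in> s"
  shows "restrict h (Field r) \<in> monotone_maps r s"
  using assms by (simp add: monotone_maps_iff FieldI1 FieldI2)

lemma monotone_maps_ext:
  assumes "f \<in> monotone_maps r s" "g \<in> monotone_maps r s'" "\<And>x. x \<in> Field r \<Longrightarrow> f x = g x"
  shows "f = g"
  using extensionalityI[OF monotone_mapsD(3)[OF assms(1)] monotone_mapsD(3)[OF assms(2)]] assms(3) by blast

lemma compose_monotone:
  assumes "f \<in> monotone_maps r s" "g \<in> monotone_maps s t"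
  shows "compose (Field r) g f \<in> monotone_maps r t"
  using assms by (simp add: monotone_maps_iff compose_def FieldI1 FieldI2)

lemma id_monotone: "(\<lambda>x \<in> Field r. x) \<in> monotone_maps r r"
  using monotone_mapsI[of r "\<lambda>x. x" r] by simp

lemma map_poset_refl: "Partial_order s \<Longrightarrow> f \<in> monotone_maps r s \<Longrightarrow> (f, f) \<in> map_poset r s"
  by (simp add: map_poset_def monotone_mapsD(1) Partial_orderD(1))

lemma Field_map_poset: "Partial_order s \<Longrightarrow> Field (map_poset r s) = monotone_maps r s"
proof (intro equalityI subsetI)
  fix f assume "f \<in> Field (map_poset r s)"
  then show "f \<in> monotone_maps r s" by (auto simp: Field_def map_poset_def)
qed (auto dest: map_poset_refl intro: FieldI1)

lemma Partial_order_map_poset: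
  assumes "Partial_order s" shows "Partial_order (map_poset r s)"
proof (rule Partial_orderI)
  show "(f, f) \<in> map_poset r s" if "f \<in> Field (map_poset r s)" for f
    using that assms map_poset_refl by (simp add: Field_map_poset)
  show "(f, h) \<in> map_poset r s" if "(f, g) \<in> map_poset r s" "(g, h) \<in> map_poset r s" for f g h
    using that Partial_orderD(2)[OF assms] unfolding map_poset_def by blast
  show "f = g" if "(f, g) \<in> map_poset r s" "(g, f) \<in> map_poset r s" for f g
    using that Partial_orderD(3)[OF assms] monotone_maps_ext[of f r s g s] unfolding map_poset_def by blast
qed

lemma Obj_Pos: "r \<in> Obj Pos \<longleftrightarrow> Partial_order r \<and> small (Field r)"
  by (simp add: Pos_def)

lemma Hom_Pos: "(m, m') \<in> Hom Pos r s \<longleftrightarrow> (\<exists>f g. m = (r, f, s) \<and> m' = (r, g, s) \<and>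
    f \<in> monotone_maps r s \<and> g \<in> monotone_maps r s \<and> (\<forall>x \<in> Field r. (f x, g x) \<in> s))"
  by (auto simp: Pos_def map_poset_def)

lemma arrows_Pos:
  "m \<in> arrows Pos r s \<longleftrightarrow> r \<in> Obj Pos \<and> s \<in> Obj Pos \<and> (\<exists>f \<in> monotone_maps r s. m = (r, f, s))"
proof -
  have "Partial_order s \<Longrightarrow> f \<in> monotone_maps r s \<Longrightarrow> ((r, f, s), (r, f, s)) \<in> Hom Pos r s" for f
    unfolding Hom_Pos using Partial_orderD(1)[of s] monotone_mapsD(1)[of f r s] by auto
  then show ?thesis
    unfolding arrows_def by (auto simp: Field_def Obj_Pos) (auto simp: Hom_Pos)
qed

lemma Cmp_Pos: "(s', g, t) \<odot>\<^bsub>Pos\<^esub> (r, f, s) = (r, compose (Field r) g f, t)"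
  by (simp add: Pos_def)

lemma Idt_Pos: "Idt Pos r = (r, \<lambda>x \<in> Field r. x, r)"
  by (simp add: Pos_def)

lemma image_poset:
  assumes "Y \<in> Obj Pos" "A \<subseteq> Field Y"
  shows "Y \<inter> A \<times> A \<in> Obj Pos" "Field (Y \<inter> A \<times> A) = A"
proof -
  have Y: "Partial_order Y" "small (Field Y)" using assms(1) by (auto simp: Obj_Pos)
  show F: "Field (Y \<inter> A \<times> A) = A"
    using assms(2) Partial_orderD(1)[OF Y(1)] unfolding Field_def by blast
  have "Partial_order (Y \<inter> A \<times> A)"
    by (rule Partial_orderI) (use F assms(2) Partial_orderD[OF Y(1)] in blast)+
  moreover have "small A"
    using Y(2) assms(2) card_of_mono1 ordLeq_ordLess_trans unfolding small_def by blast
  ultimately show "Y \<inter> A \<times> A \<in> Obj Pos" by (simp add: Obj_Pos F)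
qed

text \<open>
  A family of maps into \<open>Y\<close> that is jointly epic in the enriched sense, and through which the
  corestriction to its joint image \<open>A\<close> factorizes, is jointly surjective.
\<close>

lemma retract_onto_image:
  assumes "Y \<in> Obj Pos" "A \<subseteq> Field Y" "g \<in> arrows Pos Y (Y \<inter> A \<times> A)"
    and retr: "\<And>y. y \<in> A \<Longrightarrow> fst (snd g) y = y"
    and epi: "\<And>h h'. h \<in> arrows Pos Y Y \<Longrightarrow> h' \<in> arrows Pos Y Y \<Longrightarrow>
      (\<And>y. y \<in> A \<Longrightarrow> fst (snd h) y = fst (snd h') y) \<Longrightarrow> (h, h') \<in> Hom Pos Y Y"
  shows "A = Field Y"
proof -
  have Y: "Partial_order Y" using assms(1) by (simp add: Obj_Pos)
  obtain k where k: "k \<in> monotone_maps Y (Y \<inter> A \<times> A)" "g = (Y, k, Y \<inter> A \<times> A)"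
    using assms(3) by (auto simp: arrows_Pos)
  \<comment> \<open>Regarded as an endomap of \<open>Y\<close>, the map \<open>k\<close> agrees with
    the identity on \<open>A\<close>. Joint epimorphy, used in both directions, makes it the
    identity everywhere, while its values lie in \<open>A\<close>.\<close>
  have k': "k \<in> monotone_maps Y Y"
    using k(1) by (simp add: monotone_maps_iff)
  let ?i = "\<lambda>x \<in> Field Y. x"
  have ar: "(Y, k, Y) \<in> arrows Pos Y Y" "(Y, ?i, Y) \<in> arrows Pos Y Y"
    using k' id_monotone assms(1) by (auto simp: arrows_Pos)
  have eq: "k y = ?i y" if "y \<in> A" for y
    using that retr[of y] k assms(2) by auto
  have "((Y, k, Y), (Y, ?i, Y)) \<in> Hom Pos Y Y" "((Y, ?i, Y), (Y, k, Y)) \<in> Hom Pos Y Y"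
    using epi ar eq by auto
  then have "k y = y" if "y \<in> Field Y" for y
    using that Partial_orderD(3)[OF Y] by (auto simp: Hom_Pos)
  then show ?thesis
    using k(1) monotone_mapsD(1) image_poset(2)[OF assms(1,2)] assms(2) by fastforce
qed

section \<open>Coinserters and directed colimits of posets\<close>

context universe
begin

text \<open>The two-element chain with \<open>a\<close> below \<open>b\<close>. A monotone map into
  it amounts to a down-set, the inverse image of \<open>a\<close>; such maps detect the order of a
  poset.\<close>

lemma test_poset:
  obtains a b :: 'u where "a \<noteq> b" "{(a, a), (b, b), (a, b)} \<in> Obj Pos" "Field {(a, a), (b, b), (a, b)} = {a, b}"
proof -
  define a :: 'u where "a = undefined"
  obtain b where "b \<noteq> a"
    using infinite_univ finite_subset[of UNIV "{a}"] by auto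
  then have "Partial_order {(a, a), (b, b), (a, b)}"
    by (intro Partial_orderI) (auto simp: Field_def)
  moreover have "Field {(a, a), (b, b), (a, b)} = {a, b}" by (auto simp: Field_def)
  moreover have "small {a, b}" by (simp add: small_iff_sm sm_countable)
  ultimately show ?thesis using that[of a b] \<open>b \<noteq> a\<close> by (simp add: Obj_Pos)
qed

text \<open>The preorder on \<open>X\<close> generated by its order and the steps from
  \<open>u w\<close> to \<open>v w\<close>; the coinserter in \<open>Pos\<close> is its poset
  reflection. The closure is reflexive outside \<open>Field X\<close> too, hence the membership
  conditions in the lemmas about it.\<close>

abbreviation coinserter_rel :: "'u rel \<Rightarrow> 'u rel \<Rightarrow> ('u \<Rightarrow> 'u) \<Rightarrow> ('u \<Rightarrow> 'u) \<Rightarrow> 'u rel" where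
  "coinserter_rel W X u v \<equiv> (X \<union> {(u w, v w) | w. w \<in> Field W})\<^sup>*"

text \<open>Surjectivity comes from factorizing the corestriction of \<open>f\<close> to its image.
  For the order, the elements from which \<open>y\<close> is reachable form a down-set that contains
  \<open>u w\<close> whenever it contains \<open>v w\<close>. Its characteristic map into the
  two-element chain therefore factors through \<open>f\<close>, so it contains every
  \<open>x\<close> with \<open>f x\<close> below \<open>f y\<close>.\<close>

lemma pos_coinserterD:
  assumes co: "is_coinserter Pos W X (W, u, X) (W, v, X) Y (X, f, Y)"
    and W: "W \<in> Obj Pos" and u: "u \<in> monotone_maps W X" and v: "v \<in> monotone_maps W X"
  shows "f ` Field X = Field Y"
    and "x \<in> Field X \<Longrightarrow> y \<in> Field X \<Longrightarrow> (f x, f y) \<in> Y \<Longrightarrow> (x, y) \<in> coinserter_rel W X u v"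
proof -
  have X: "X \<in> Obj Pos" and Y: "Y \<in> Obj Pos" and f: "f \<in> monotone_maps X Y"
    using co by (auto simp: is_coinserter_def arrows_Pos)
  have fuv: "(f (u w), f (v w)) \<in> Y" if "w \<in> Field W" for w
    using co that unfolding is_coinserter_def Cmp_Pos Hom_Pos by (auto simp: compose_def)
  have ins: "\<exists>g \<in> arrows Pos Y Z. (X, h, Z) = g \<odot>\<^bsub>Pos\<^esub> (X, f, Y)"
    if "Z \<in> Obj Pos" "h \<in> monotone_maps X Z" "\<And>w. w \<in> Field W \<Longrightarrow> (h (u w), h (v w)) \<in> Z" for Z h
  proof -
    have "((X, h, Z) \<odot>\<^bsub>Pos\<^esub> (W, u, X), (X, h, Z) \<odot>\<^bsub>Pos\<^esub> (W, v, X)) \<in> Hom Pos W Z"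
      unfolding Cmp_Pos Hom_Pos using compose_monotone[OF u that(2)] compose_monotone[OF v that(2)] that(3)
      by (auto simp: compose_def)
    moreover have "(X, h, Z) \<in> arrows Pos X Z" using that X by (auto simp: arrows_Pos)
    ultimately show ?thesis using co unfolding is_coinserter_def by blast
  qed
  let ?A = "f ` Field X"
  have A: "?A \<subseteq> Field Y" using f monotone_mapsD(1) by auto
  have fA: "f \<in> monotone_maps X (Y \<inter> ?A \<times> ?A)"
    using f by (auto simp: monotone_maps_iff intro: FieldI1 FieldI2)
  have "(f (u w), f (v w)) \<in> Y \<inter> ?A \<times> ?A" if "w \<in> Field W" for w
    using fuv[OF that] monotone_mapsD(1)[OF u that] monotone_mapsD(1)[OF v that] by simp
  then obtain g where g: "g \<in> arrows Pos Y (Y \<inter> ?A \<times> ?A)" "(X, f, Y \<inter> ?A \<times> ?A) = g \<odot>\<^bsub>Pos\<^esub> (X, f, Y)"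
    using ins[OF image_poset(1)[OF Y A] fA] by blast
  show "?A = Field Y"
  proof (rule retract_onto_image[OF Y A g(1)])
    obtain k where k: "g = (Y, k, Y \<inter> ?A \<times> ?A)" using g(1) by (auto simp: arrows_Pos)
    have "f = compose (Field X) k f" using g(2) by (simp add: k Cmp_Pos)
    then have "f x = k (f x)" if "x \<in> Field X" for x using that by (metis compose_eq)
    then show "fst (snd g) y = y" if "y \<in> ?A" for y using that k by auto
    fix h h' assume h: "h \<in> arrows Pos Y Y" "h' \<in> arrows Pos Y Y"
      and eq: "\<And>y. y \<in> ?A \<Longrightarrow> fst (snd h) y = fst (snd h') y"
    obtain m m' where m: "h = (Y, m, Y)" "h' = (Y, m', Y)" "m \<in> monotone_maps Y Y" "m' \<in> monotone_maps Y Y"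
      using h by (auto simp: arrows_Pos)
    have "(h \<odot>\<^bsub>Pos\<^esub> (X, f, Y), h' \<odot>\<^bsub>Pos\<^esub> (X, f, Y)) \<in> Hom Pos X Y"
      unfolding m Cmp_Pos Hom_Pos using compose_monotone[OF f m(3)] compose_monotone[OF f m(4)] eq m A
        Partial_orderD(1)[of Y] Y monotone_mapsD(1)[OF m(4)]
      by (auto simp: compose_def Obj_Pos)
    then show "(h, h') \<in> Hom Pos Y Y" using co h unfolding is_coinserter_def by blast
  qed
  let ?R = "coinserter_rel W X u v"
  assume x: "x \<in> Field X" and y: "y \<in> Field X" and fxy: "(f x, f y) \<in> Y"
  obtain a b :: 'u where ab: "a \<noteq> b" "{(a, a), (b, b), (a, b)} \<in> Obj Pos" "Field {(a, a), (b, b), (a, b)} = {a, b}"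
    by (rule test_poset)
  define t where "t = (\<lambda>z \<in> Field X. if (z, y) \<in> ?R then a else b)"
  have t: "t \<in> monotone_maps X {(a, a), (b, b), (a, b)}"
    unfolding t_def
  proof (rule monotone_mapsI)
    fix z z' assume z: "(z, z') \<in> X"
    have "(z, y) \<in> ?R" if "(z', y) \<in> ?R"
      using z by (intro converse_rtrancl_into_rtrancl[OF _ that]) simp
    then show "(if (z, y) \<in> ?R then a else b, if (z', y) \<in> ?R then a else b) \<in> {(a, a), (b, b), (a, b)}"
      by auto
  qed
  have "(t (u w), t (v w)) \<in> {(a, a), (b, b), (a, b)}" if "w \<in> Field W" for w
  proof -
    have "u w \<in> Field X" "v w \<in> Field X" using monotone_mapsD(1)[OF u that] monotone_mapsD(1)[OF v that] .
    moreover have "(u w, y) \<in> ?R" if "(v w, y) \<in> ?R"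
      using that \<open>w \<in> Field W\<close> by (intro converse_rtrancl_into_rtrancl[of "u w" "v w"]) auto
    ultimately show ?thesis by (auto simp: t_def)
  qed
  then obtain g where g: "g \<in> arrows Pos Y {(a, a), (b, b), (a, b)}"
    "(X, t, {(a, a), (b, b), (a, b)}) = g \<odot>\<^bsub>Pos\<^esub> (X, f, Y)"
    using ins[OF ab(2) t] by blast
  obtain k where k: "g = (Y, k, {(a, a), (b, b), (a, b)})" "k \<in> monotone_maps Y {(a, a), (b, b), (a, b)}"
    using g(1) by (auto simp: arrows_Pos)
  have tk: "t = compose (Field X) k f" using g(2) by (simp add: k Cmp_Pos)
  have "(k (f x), k (f y)) \<in> {(a, a), (b, b), (a, b)}" using monotone_mapsD(2)[OF k(2) fxy] .
  then have "(t x, t y) \<in> {(a, a), (b, b), (a, b)}" unfolding tk using x y by (simp add: compose_eq)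
  moreover have "t y = a" using y by (simp add: t_def)
  ultimately have "t x = a" using ab(1) by auto
  then show "(x, y) \<in> ?R" using x ab(1) by (auto simp: t_def split: if_splits)
qed

text \<open>The converse of \<open>pos_coinserterD\<close>. A mediating map is defined on the
  representatives \<open>s y\<close>; the description of the order makes it monotone and independent
  of the representatives.\<close>

lemma pos_coinserterI:
  assumes W: "W \<in> Obj Pos" and X: "X \<in> Obj Pos" and Y: "Y \<in> Obj Pos"
    and u: "u \<in> monotone_maps W X" and v: "v \<in> monotone_maps W X" and f: "f \<in> monotone_maps X Y"
    and fuv: "\<And>w. w \<in> Field W \<Longrightarrow> (f (u w), f (v w)) \<in> Y"
    and surj: "f ` Field X = Field Y"
    and ord: "\<And>x y. x \<in> Field X \<Longrightarrow> y \<in> Field X \<Longrightarrow> (f x, f y) \<in> Y \<Longrightarrow> (x, y) \<in> coinserter_rel W X u v"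
  shows "is_coinserter Pos W X (W, u, X) (W, v, X) Y (X, f, Y)"
  unfolding is_coinserter_def
proof (intro conjI allI ballI impI)
  show "(X, f, Y) \<in> arrows Pos X Y" using X Y f by (auto simp: arrows_Pos)
  show "((X, f, Y) \<odot>\<^bsub>Pos\<^esub> (W, u, X), (X, f, Y) \<odot>\<^bsub>Pos\<^esub> (W, v, X)) \<in> Hom Pos W Y"
    unfolding Cmp_Pos Hom_Pos using compose_monotone[OF u f] compose_monotone[OF v f] fuv
    by (auto simp: compose_def)
next
  fix Z h' assume h': "h' \<in> arrows Pos X Z"
    and le: "(h' \<odot>\<^bsub>Pos\<^esub> (W, u, X), h' \<odot>\<^bsub>Pos\<^esub> (W, v, X)) \<in> Hom Pos W Z"
  obtain h where h: "h \<in> monotone_maps X Z" "h' = (X, h, Z)" and Z: "Z \<in> Obj Pos"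
    using h' by (auto simp: arrows_Pos)
  have hw: "(h (u w), h (v w)) \<in> Z" if "w \<in> Field W" for w
    using le that unfolding h Cmp_Pos Hom_Pos by (auto simp: compose_def)
  have PZ: "Partial_order Z" using Z by (simp add: Obj_Pos)
  have mono: "(h x, h y) \<in> Z" if "x \<in> Field X" "y \<in> Field X" "(f x, f y) \<in> Y" for x y
  proof (rule rtrancl_map_mono[OF ord[OF that] that(1)])
    show "X \<union> {(u w, v w) | w. w \<in> Field W} \<subseteq> Field X \<times> Field X"
      using monotone_mapsD(1)[OF u] monotone_mapsD(1)[OF v] by (auto intro: FieldI1 FieldI2)
    show "(h a, h a) \<in> Z" if "a \<in> Field X" for a
      using that monotone_mapsD(1)[OF h(1)] Partial_orderD(1)[OF PZ] by blast
    show "trans Z" using Partial_orderD(2)[OF PZ] by (rule transI)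
    show "(h a, h b) \<in> Z" if "(a, b) \<in> X \<union> {(u w, v w) | w. w \<in> Field W}" for a b
      using that monotone_mapsD(2)[OF h(1)] hw by blast
  qed
  define s where "s = inv_into (Field X) f"
  have s: "s y \<in> Field X" "f (s y) = y" if "y \<in> Field Y" for y
    using that surj by (auto simp: s_def inv_into_into f_inv_into_f)
  let ?g = "\<lambda>y \<in> Field Y. h (s y)"
  have g: "?g \<in> monotone_maps Y Z"
  proof (rule monotone_mapsI)
    show "(h (s x), h (s y)) \<in> Z" if "(x, y) \<in> Y" for x y
      using mono[of "s x" "s y"] s[OF FieldI1[OF that]] s[OF FieldI2[OF that]] that by simp
  qed
  have "h x = ?g (f x)" if x: "x \<in> Field X" for x
  proof -
    have fx: "f x \<in> Field Y" using x surj by auto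
    have "(f x, f (s (f x))) \<in> Y" "(f (s (f x)), f x) \<in> Y"
      using s[OF fx] fx Y Partial_orderD(1)[of Y] by (auto simp: Obj_Pos)
    then have "(h x, h (s (f x))) \<in> Z" "(h (s (f x)), h x) \<in> Z"
      using mono x s[OF fx] by auto
    then show ?thesis using Partial_orderD(3)[OF PZ] fx by simp
  qed
  then have "h = compose (Field X) ?g f"
    by (intro monotone_maps_ext[OF h(1) compose_monotone[OF f g]]) (simp add: compose_eq)
  then show "\<exists>g \<in> arrows Pos Y Z. h' = g \<odot>\<^bsub>Pos\<^esub> (X, f, Y)"
    using g Y Z by (intro bexI[of _ "(Y, ?g, Z)"]) (auto simp: arrows_Pos Cmp_Pos h)
next
  fix Z g g' assume g: "g \<in> arrows Pos Y Z" and g': "g' \<in> arrows Pos Y Z"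
    and le: "(g \<odot>\<^bsub>Pos\<^esub> (X, f, Y), g' \<odot>\<^bsub>Pos\<^esub> (X, f, Y)) \<in> Hom Pos X Z"
  obtain m m' where m: "g = (Y, m, Z)" "g' = (Y, m', Z)" "m \<in> monotone_maps Y Z" "m' \<in> monotone_maps Y Z"
    using g g' by (auto simp: arrows_Pos)
  have "(m (f x), m' (f x)) \<in> Z" if "x \<in> Field X" for x
    using le that unfolding m Cmp_Pos Hom_Pos by (auto simp: compose_def)
  then have "\<forall>y \<in> Field Y. (m y, m' y) \<in> Z" unfolding surj[symmetric] by blast
  then show "(g, g') \<in> Hom Pos Y Z"
    unfolding Hom_Pos using m by simp
qed

text \<open>The cocone corestricts to the union of the images of its members. The mediating map into
  this smaller cocone fixes all its elements, as \<open>retract_onto_image\<close> requires.\<close>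

lemma pos_colimit_surj:
  assumes co: "is_colimit Pos I D d C c" and z: "z \<in> Field C"
  obtains i x where "i \<in> Field I" "x \<in> Field (D i)" "z = fst (snd (c i)) x"
proof -
  let ?c = "\<lambda>i. fst (snd (c i))"
  let ?A = "\<Union>i \<in> Field I. ?c i ` Field (D i)"
  have C: "C \<in> Obj Pos" and cc: "is_cocone Pos I D d C c"
    using co by (auto simp: is_colimit_def is_cocone_def)
  have c: "c i = (D i, ?c i, C)" "?c i \<in> monotone_maps (D i) C" "D i \<in> Obj Pos" if "i \<in> Field I" for i
  proof -
    have "c i \<in> arrows Pos (D i) C" using cc that by (auto simp: is_cocone_def)
    then show "c i = (D i, ?c i, C)" "?c i \<in> monotone_maps (D i) C" "D i \<in> Obj Pos"
      by (auto simp: arrows_Pos)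
  qed
  have A: "?A \<subseteq> Field C" using c(2) monotone_mapsD(1) by fast
  let ?C = "C \<inter> ?A \<times> ?A"
  have cA: "?c i \<in> monotone_maps (D i) ?C" if "i \<in> Field I" for i
    using c(2)[OF that] that unfolding monotone_maps_iff by (blast intro: FieldI1 FieldI2)
  have "is_cocone Pos I D d ?C (\<lambda>i. (D i, ?c i, ?C))"
    unfolding is_cocone_def
  proof (intro conjI ballI)
    show "?C \<in> Obj Pos" by (rule image_poset(1)[OF C A])
    then show "(D i, ?c i, ?C) \<in> arrows Pos (D i) ?C" if "i \<in> Field I" for i
      using cA[OF that] c(3)[OF that] by (auto simp: arrows_Pos)
    fix e assume e: "e \<in> I"
    obtain i j where ij: "e = (i, j)" by force
    then have F: "i \<in> Field I" "j \<in> Field I" using e by (auto intro: FieldI1 FieldI2)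
    have "c j \<odot>\<^bsub>Pos\<^esub> d i j = c i" using cc e ij unfolding is_cocone_def by blast
    then have "(D j, ?c j, C) \<odot>\<^bsub>Pos\<^esub> d i j = (D i, ?c i, C)" using c(1) F by metis
    then have "(D j, ?c j, ?C) \<odot>\<^bsub>Pos\<^esub> d i j = (D i, ?c i, ?C)"
      by (cases "d i j") (auto simp: Cmp_Pos)
    then show "case e of (i, j) \<Rightarrow> (D j, ?c j, ?C) \<odot>\<^bsub>Pos\<^esub> d i j = (D i, ?c i, ?C)" using ij by simp
  qed
  then obtain g where g: "g \<in> arrows Pos C ?C" "\<And>i. i \<in> Field I \<Longrightarrow> g \<odot>\<^bsub>Pos\<^esub> c i = (D i, ?c i, ?C)"
    using co unfolding is_colimit_def by blast
  have "?A = Field C"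
  proof (rule retract_onto_image[OF C A g(1)])
    obtain k where k: "g = (C, k, ?C)" using g(1) by (auto simp: arrows_Pos)
    show "fst (snd g) y = y" if "y \<in> ?A" for y
    proof -
      obtain i x where i: "i \<in> Field I" "x \<in> Field (D i)" "y = ?c i x" using \<open>y \<in> ?A\<close> by blast
      have "(C, k, ?C) \<odot>\<^bsub>Pos\<^esub> (D i, ?c i, C) = (D i, ?c i, ?C)"
        using g(2)[OF i(1)] c(1)[OF i(1)] k by metis
      then have "compose (Field (D i)) k (?c i) = ?c i" by (simp add: Cmp_Pos)
      then have "k (?c i x) = ?c i x" using i(2) by (metis compose_eq)
      then show ?thesis using i k by simp
    qed
    fix h h' assume h: "h \<in> arrows Pos C C" "h' \<in> arrows Pos C C"
      and eq: "\<And>y. y \<in> ?A \<Longrightarrow> fst (snd h) y = fst (snd h') y"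
    obtain m m' where m: "h = (C, m, C)" "h' = (C, m', C)" "m \<in> monotone_maps C C" "m' \<in> monotone_maps C C"
      using h by (auto simp: arrows_Pos)
    have "(h \<odot>\<^bsub>Pos\<^esub> c i, h' \<odot>\<^bsub>Pos\<^esub> c i) \<in> Hom Pos (D i) C" if i: "i \<in> Field I" for i
    proof -
      have "((C, m, C) \<odot>\<^bsub>Pos\<^esub> (D i, ?c i, C), (C, m', C) \<odot>\<^bsub>Pos\<^esub> (D i, ?c i, C)) \<in> Hom Pos (D i) C"
        unfolding Cmp_Pos Hom_Pos
      proof (intro exI conjI ballI, rule refl, rule refl)
        show "compose (Field (D i)) m (?c i) \<in> monotone_maps (D i) C" "compose (Field (D i)) m' (?c i) \<in> monotone_maps (D i) C"
          using compose_monotone c(2)[OF i] m by blast+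
        fix x assume x: "x \<in> Field (D i)"
        have "m (?c i x) = m' (?c i x)" using eq[of "?c i x"] x i m by auto
        moreover have "m' (?c i x) \<in> Field C" using x m(4) c(2)[OF i] monotone_mapsD(1) by metis
        ultimately show "(compose (Field (D i)) m (?c i) x, compose (Field (D i)) m' (?c i) x) \<in> C"
          using x C Partial_orderD(1)[of C] by (simp add: compose_eq Obj_Pos)
      qed
      then show ?thesis using c(1)[OF i] m by metis
    qed
    then show "(h, h') \<in> Hom Pos C C" using co h unfolding is_colimit_def by blast
  qed
  then show ?thesis using z that by blast
qed

text \<open>Directed colimits of posets are recognized by elements: every element comes from some
  stage, and an inequality is witnessed at a later stage. A mediating map is computed at any stage
  where the element lives; by \<open>ord\<close> the result does not depend on that stage and is
  monotone.\<close>

lemma pos_colimitI: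
  assumes I: "directed_poset I" and cc: "is_cocone Pos I D d C c"
    and d: "\<And>i j. (i, j) \<in> I \<Longrightarrow> d i j \<in> arrows Pos (D i) (D j)"
    and surj: "\<And>z. z \<in> Field C \<Longrightarrow> \<exists>i \<in> Field I. \<exists>x \<in> Field (D i). z = fst (snd (c i)) x"
    and ord: "\<And>i x j y. \<lbrakk>i \<in> Field I; x \<in> Field (D i); j \<in> Field I; y \<in> Field (D j);
      (fst (snd (c i)) x, fst (snd (c j)) y) \<in> C\<rbrakk>
      \<Longrightarrow> \<exists>k. (i, k) \<in> I \<and> (j, k) \<in> I \<and> (fst (snd (d i k)) x, fst (snd (d j k)) y) \<in> D k"
  shows "is_colimit Pos I D d C c"
  unfolding is_colimit_def
proof (intro conjI allI ballI impI)
  let ?c = "\<lambda>i. fst (snd (c i))"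
  have C: "C \<in> Obj Pos" using cc by (auto simp: is_cocone_def)
  have c: "c i = (D i, ?c i, C)" "?c i \<in> monotone_maps (D i) C" "D i \<in> Obj Pos" if "i \<in> Field I" for i
  proof -
    have "c i \<in> arrows Pos (D i) C" using cc that by (auto simp: is_cocone_def)
    then show "c i = (D i, ?c i, C)" "?c i \<in> monotone_maps (D i) C" "D i \<in> Obj Pos"
      by (auto simp: arrows_Pos)
  qed
  show "is_cocone Pos I D d C c" by (rule cc)
  fix Z
  show "\<exists>g \<in> arrows Pos C Z. \<forall>i \<in> Field I. g \<odot>\<^bsub>Pos\<^esub> c i = e i" if ez: "is_cocone Pos I D d Z e" for e
  proof -
    let ?e = "\<lambda>i. fst (snd (e i))"
    have Z: "Z \<in> Obj Pos" using ez by (auto simp: is_cocone_def)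
    then have PZ: "Partial_order Z" by (simp add: Obj_Pos)
    have e: "e i = (D i, ?e i, Z)" "?e i \<in> monotone_maps (D i) Z" if "i \<in> Field I" for i
    proof -
      have "e i \<in> arrows Pos (D i) Z" using ez that by (auto simp: is_cocone_def)
      then show "e i = (D i, ?e i, Z)" "?e i \<in> monotone_maps (D i) Z" by (auto simp: arrows_Pos)
    qed
    have ed: "?e j (fst (snd (d i j)) x) = ?e i x" if ij: "(i, j) \<in> I" and x: "x \<in> Field (D i)" for i j x
    proof -
      have F: "i \<in> Field I" "j \<in> Field I" using ij by (auto intro: FieldI1 FieldI2)
      have "e j \<odot>\<^bsub>Pos\<^esub> d i j = e i" using ez ij unfolding is_cocone_def by blast
      then have "(D j, ?e j, Z) \<odot>\<^bsub>Pos\<^esub> d i j = (D i, ?e i, Z)" using e(1) F by metis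
      moreover obtain k where "d i j = (D i, k, D j)" using d[OF ij] by (auto simp: arrows_Pos)
      ultimately have "compose (Field (D i)) (?e j) (fst (snd (d i j))) = ?e i" by (simp add: Cmp_Pos)
      then show ?thesis using x by (metis compose_eq)
    qed
    have mono: "(?e i x, ?e j y) \<in> Z"
      if xy: "i \<in> Field I" "x \<in> Field (D i)" "j \<in> Field I" "y \<in> Field (D j)" "(?c i x, ?c j y) \<in> C" for i x j y
    proof -
      obtain k where k: "(i, k) \<in> I" "(j, k) \<in> I" "(fst (snd (d i k)) x, fst (snd (d j k)) y) \<in> D k"
        using ord[OF xy] by blast
      then have "(?e k (fst (snd (d i k)) x), ?e k (fst (snd (d j k)) y)) \<in> Z"
        using e(2)[of k] monotone_mapsD(2) by (metis FieldI2)
      then show ?thesis using ed k that by simp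
    qed
    obtain ix xx where ix: "\<And>z. z \<in> Field C \<Longrightarrow> ix z \<in> Field I \<and> xx z \<in> Field (D (ix z)) \<and> z = ?c (ix z) (xx z)"
      using surj by metis
    let ?g = "\<lambda>z \<in> Field C. ?e (ix z) (xx z)"
    have g: "?g \<in> monotone_maps C Z"
    proof (rule monotone_mapsI)
        show "(?e (ix x) (xx x), ?e (ix y) (xx y)) \<in> Z" if "(x, y) \<in> C" for x y
        using mono ix[of x] ix[of y] that by (metis FieldI1 FieldI2)
    qed
    have "(C, ?g, Z) \<odot>\<^bsub>Pos\<^esub> c i = e i" if i: "i \<in> Field I" for i
    proof -
      have "compose (Field (D i)) ?g (?c i) = ?e i"
      proof (rule monotone_maps_ext[OF compose_monotone[OF c(2)[OF i] g] e(2)[OF i]])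
        fix x assume x: "x \<in> Field (D i)"
        let ?z = "?c i x"
        have z: "?z \<in> Field C" using monotone_mapsD(1)[OF c(2)[OF i] x] .
        then have zz: "(?z, ?z) \<in> C" using C Partial_orderD(1)[of C] by (simp add: Obj_Pos)
        have "(?e i x, ?e (ix ?z) (xx ?z)) \<in> Z" "(?e (ix ?z) (xx ?z), ?e i x) \<in> Z"
          using ix[OF z] mono[OF i x, of "ix ?z" "xx ?z"] mono[OF _ _ i x, of "ix ?z" "xx ?z"] zz by auto
        then show "compose (Field (D i)) ?g (?c i) x = ?e i x"
          using Partial_orderD(3)[OF PZ] x z by (simp add: compose_eq)
      qed
      then have "(C, ?g, Z) \<odot>\<^bsub>Pos\<^esub> (D i, ?c i, C) = (D i, ?e i, Z)" by (simp add: Cmp_Pos)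
      then show ?thesis using c(1)[OF i] e(1)[OF i] by metis
    qed
    moreover have "(C, ?g, Z) \<in> arrows Pos C Z" using g C Z by (auto simp: arrows_Pos)
    ultimately show ?thesis by blast
  qed
  show "(g, g') \<in> Hom Pos C Z"
    if g: "g \<in> arrows Pos C Z" "g' \<in> arrows Pos C Z"
      and le: "\<forall>i \<in> Field I. (g \<odot>\<^bsub>Pos\<^esub> c i, g' \<odot>\<^bsub>Pos\<^esub> c i) \<in> Hom Pos (D i) Z" for g g'
  proof -
    obtain m m' where m: "g = (C, m, Z)" "g' = (C, m', Z)" "m \<in> monotone_maps C Z" "m' \<in> monotone_maps C Z"
      using g by (auto simp: arrows_Pos)
    have "(m z, m' z) \<in> Z" if z: "z \<in> Field C" for z
    proof -
      obtain i x where i: "i \<in> Field I" "x \<in> Field (D i)" "z = ?c i x" using surj[OF z] by blast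
      have "((C, m, Z) \<odot>\<^bsub>Pos\<^esub> (D i, ?c i, C), (C, m', Z) \<odot>\<^bsub>Pos\<^esub> (D i, ?c i, C)) \<in> Hom Pos (D i) Z"
        using le i(1) c(1)[OF i(1)] m by metis
      then show ?thesis using i(2,3) by (auto simp: Cmp_Pos Hom_Pos compose_def)
    qed
    then show ?thesis unfolding Hom_Pos using m by blast
  qed
qed

end

section \<open>Concrete categories elementwise\<close>

lemma arrows_Obj: assumes "f \<in> arrows K X Y" shows "X \<in> Obj K" "Y \<in> Obj K"
  using assms by (auto simp: arrows_def)

lemma (in pos_category) arrow_antisym:
  "f \<in> arrows K X Y \<Longrightarrow> (f, g) \<in> Hom K X Y \<Longrightarrow> (g, f) \<in> Hom K X Y \<Longrightarrow> f = g"
  using Partial_orderD(3)[OF hom_poset] by (auto simp: arrows_def)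

lemma (in pos_category) arrow_refl: "f \<in> arrows K X Y \<Longrightarrow> (f, f) \<in> Hom K X Y"
  using Partial_orderD(1)[OF hom_poset] by (simp add: arrows_def)

locale concrete = pos_category K for K :: "('o, 'm) pcat" (structure) +
  fixes U :: "('o, 'm, 'u rel, 'u pos_arrow) pfunctor"
  assumes conc: "concrete_category K U"
begin

abbreviation und :: "'o \<Rightarrow> 'u rel" where "und \<equiv> ob U"

definition fn :: "'m \<Rightarrow> 'u \<Rightarrow> 'u" where "fn f = fst (snd (ar U f))"

lemma functor_U: "enriched_functor K Pos U"
  using conc by (simp add: concrete_category_def)

lemma und_Obj: "X \<in> Obj K \<Longrightarrow> und X \<in> Obj Pos"
  using functor_U by (simp add: enriched_functor_def)

lemma und_order: "X \<in> Obj K \<Longrightarrow> Partial_order (und X)"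
  using und_Obj by (simp add: Obj_Pos)

lemma Hom_arrows: "X \<in> Obj K \<Longrightarrow> Y \<in> Obj K \<Longrightarrow> (f, g) \<in> Hom K X Y \<Longrightarrow> f \<in> arrows K X Y \<and> g \<in> arrows K X Y"
  by (simp add: arrows_def FieldI1 FieldI2)

lemma ar_U: assumes "f \<in> arrows K X Y"
  shows "ar U f = (und X, fn f, und Y)" "fn f \<in> monotone_maps (und X) (und Y)"
proof -
  have "(ar U f, ar U f) \<in> Hom Pos (und X) (und Y)"
    using functor_U arrows_Obj[OF assms] arrow_refl[OF assms] unfolding enriched_functor_def by fast
  then show "ar U f = (und X, fn f, und Y)" "fn f \<in> monotone_maps (und X) (und Y)"
    by (auto simp: Hom_Pos fn_def)
qed

lemmas fn_closed = monotone_mapsD(1)[OF ar_U(2)]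
lemmas fn_mono = monotone_mapsD(2)[OF ar_U(2)]

lemma Hom_iff:
  assumes "f \<in> arrows K X Y" "g \<in> arrows K X Y"
  shows "(f, g) \<in> Hom K X Y \<longleftrightarrow> (\<forall>x \<in> Field (und X). (fn f x, fn g x) \<in> und Y)"
proof -
  have "(f, g) \<in> Hom K X Y \<longleftrightarrow> (ar U f, ar U g) \<in> Hom Pos (und X) (und Y)"
    using conc assms unfolding concrete_category_def by blast
  then show ?thesis using ar_U[OF assms(1)] ar_U[OF assms(2)] by (simp add: Hom_Pos)
qed

lemma arrow_eqI:
  assumes f: "f \<in> arrows K X Y" and g: "g \<in> arrows K X Y" and "\<And>x. x \<in> Field (und X) \<Longrightarrow> fn f x = fn g x"
  shows "f = g"
proof -
  have "(f, g) \<in> Hom K X Y" "(g, f) \<in> Hom K X Y"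
    using assms Partial_orderD(1)[OF und_order] fn_closed[OF g] arrows_Obj[OF f] by (auto simp: Hom_iff)
  then show ?thesis using Partial_orderD(3)[OF hom_poset] arrows_Obj[OF f] by blast
qed

lemma fn_comp:
  assumes f: "f \<in> arrows K X Y" and g: "g \<in> arrows K Y Z" and x: "x \<in> Field (und X)"
  shows "fn (g \<odot> f) x = fn g (fn f x)"
proof -
  have "ar U (g \<odot> f) = ar U g \<odot>\<^bsub>Pos\<^esub> ar U f"
    using functor_U f g unfolding enriched_functor_def by blast
  then show ?thesis using x unfolding ar_U(1)[OF f] ar_U(1)[OF g] Cmp_Pos by (simp add: fn_def compose_eq)
qed

lemma fn_id: assumes X: "X \<in> Obj K" and x: "x \<in> Field (und X)" shows "fn (Idt K X) x = x"
proof -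
  have "ar U (Idt K X) = Idt Pos (und X)" using functor_U X unfolding enriched_functor_def by blast
  then show ?thesis using x by (simp add: fn_def Idt_Pos)
qed

lemma iso_surj_reflecting:
  assumes f: "f \<in> arrows K X Y" and iso: "is_iso Pos (und X) (und Y) (ar U f)"
  shows "fn f ` Field (und X) = Field (und Y)"
    and "x \<in> Field (und X) \<Longrightarrow> y \<in> Field (und X) \<Longrightarrow> (fn f x, fn f y) \<in> und Y \<Longrightarrow> (x, y) \<in> und X"
proof -
  obtain m where m: "m \<in> monotone_maps (und Y) (und X)"
    "(und Y, m, und X) \<odot>\<^bsub>Pos\<^esub> ar U f = Idt Pos (und X)" "ar U f \<odot>\<^bsub>Pos\<^esub> (und Y, m, und X) = Idt Pos (und Y)"
    using iso unfolding is_iso_def by (auto simp: arrows_Pos)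
  have 1: "m (fn f x) = x" if "x \<in> Field (und X)" for x
  proof -
    have "compose (Field (und X)) m (fn f) = (\<lambda>x \<in> Field (und X). x)"
      using m(2) by (simp add: ar_U(1)[OF f] Cmp_Pos Idt_Pos)
    from fun_cong[OF this, of x] show ?thesis using that by (simp add: compose_eq)
  qed
  have 2: "fn f (m y) = y" if "y \<in> Field (und Y)" for y
  proof -
    have "compose (Field (und Y)) (fn f) m = (\<lambda>x \<in> Field (und Y). x)"
      using m(3) by (simp add: ar_U(1)[OF f] Cmp_Pos Idt_Pos)
    from fun_cong[OF this, of y] show ?thesis using that by (simp add: compose_eq)
  qed
  show "fn f ` Field (und X) = Field (und Y)"
    using fn_closed[OF f] 2 monotone_mapsD(1)[OF m(1)] by (metis image_eqI image_subsetI subsetI subset_antisym)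
  show "(x, y) \<in> und X" if "x \<in> Field (und X)" "y \<in> Field (und X)" "(fn f x, fn f y) \<in> und Y"
    using monotone_mapsD(2)[OF m(1) that(3)] 1 that by simp
qed

text \<open>An order-reflecting map is injective by antisymmetry, so \<open>inv_into\<close> gives a
  two-sided inverse, and reflection of the order makes this inverse monotone.\<close>

lemma iso_posI:
  assumes f: "f \<in> arrows K X Y"
    and surj: "Field (und Y) \<subseteq> fn f ` Field (und X)"
    and refl: "\<And>x y. x \<in> Field (und X) \<Longrightarrow> y \<in> Field (und X) \<Longrightarrow> (fn f x, fn f y) \<in> und Y \<Longrightarrow> (x, y) \<in> und X"
  shows "is_iso Pos (und X) (und Y) (ar U f)"
proof -
  let ?i = "inv_into (Field (und X)) (fn f)"
  let ?m = "\<lambda>y \<in> Field (und Y). ?i y"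
  have X: "X \<in> Obj K" and Y: "Y \<in> Obj K" using arrows_Obj[OF f] by auto
  have i: "?i y \<in> Field (und X)" "fn f (?i y) = y" if "y \<in> Field (und Y)" for y
    using that surj by (auto intro: inv_into_into f_inv_into_f)
  have m: "?m \<in> monotone_maps (und Y) (und X)"
  proof (rule monotone_mapsI)
    fix x y assume xy: "(x, y) \<in> und Y"
    show "(?i x, ?i y) \<in> und X"
      using refl[OF i(1)[OF FieldI1[OF xy]] i(1)[OF FieldI2[OF xy]]] i(2)[OF FieldI1[OF xy]] i(2)[OF FieldI2[OF xy]] xy by simp
  qed
  have if': "?i (fn f x) = x" if x: "x \<in> Field (und X)" for x
  proof (rule Partial_orderD(3)[OF und_order[OF X]])
    have y: "fn f x \<in> Field (und Y)" using fn_closed[OF f x] .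
    have r: "(fn f x, fn f x) \<in> und Y" using Partial_orderD(1)[OF und_order[OF Y] y] .
    show "(?i (fn f x), x) \<in> und X" "(x, ?i (fn f x)) \<in> und X"
      using refl[OF i(1)[OF y] x] refl[OF x i(1)[OF y]] i(2)[OF y] r by auto
  qed
  have "compose (Field (und X)) ?m (fn f) = (\<lambda>x \<in> Field (und X). x)"
    by (rule monotone_maps_ext[OF compose_monotone[OF ar_U(2)[OF f] m] id_monotone])
      (simp add: compose_eq if' fn_closed[OF f])
  moreover have "compose (Field (und Y)) (fn f) ?m = (\<lambda>x \<in> Field (und Y). x)"
    by (rule monotone_maps_ext[OF compose_monotone[OF m ar_U(2)[OF f]] id_monotone])
      (simp add: compose_eq i)
  moreover have "(und Y, ?m, und X) \<in> arrows Pos (und Y) (und X)"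
    "(und X, fn f, und Y) \<in> arrows Pos (und X) (und Y)"
    using m ar_U(2)[OF f] und_Obj[OF X] und_Obj[OF Y] by (auto simp: arrows_Pos)
  ultimately show ?thesis
    unfolding is_iso_def ar_U(1)[OF f] by (auto simp: Cmp_Pos Idt_Pos intro!: bexI[of _ "(und Y, ?m, und X)"])
qed

section \<open>Universal arrows and enriched right adjoints\<close>

definition is_free :: "'u rel \<Rightarrow> 'o \<Rightarrow> ('u \<Rightarrow> 'u) \<Rightarrow> bool" where
  "is_free P T e \<longleftrightarrow> T \<in> Obj K \<and> e \<in> monotone_maps P (und T) \<and>
     (\<forall>X \<in> Obj K. \<forall>m \<in> monotone_maps P (und X). \<exists>f \<in> arrows K T X. \<forall>p \<in> Field P. fn f (e p) = m p) \<and>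
     (\<forall>X. \<forall>f \<in> arrows K T X. \<forall>g \<in> arrows K T X.
        (\<forall>p \<in> Field P. (fn f (e p), fn g (e p)) \<in> und X) \<longrightarrow> (f, g) \<in> Hom K T X)"

text \<open>The unit \<open>e\<close> is the transpose of the identity of \<open>F P\<close>. By
  naturality every transpose is composition with \<open>e\<close>, so the isomorphism of hom-posets
  becomes the universal property; the comparison clause of \<open>is_free\<close> is its reflection
  of the order.\<close>

lemma right_adjoint_free:
  assumes "right_adjoint K Pos U" and P: "P \<in> Obj Pos"
  shows "\<exists>T e. is_free P T e"
proof -
  obtain F where F: "enriched_functor Pos K F" and adj: "enriched_adjunction Pos K F U"
    using assms(1) unfolding right_adjoint_def by blast
  obtain \<phi> where iso: "\<And>P X. P \<in> Obj Pos \<Longrightarrow> X \<in> Obj K \<Longrightarrow> poset_iso (Hom K (ob F P) X) (Hom Pos P (ob U X)) (\<phi> P X)"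
    and nat: "\<And>P P' X X' p g f. p \<in> arrows Pos P' P \<Longrightarrow> g \<in> arrows K X X' \<Longrightarrow> f \<in> arrows K (ob F P) X
      \<Longrightarrow> \<phi> P' X' (g \<odot> f \<odot> ar F p) = ar U g \<odot>\<^bsub>Pos\<^esub> \<phi> P X f \<odot>\<^bsub>Pos\<^esub> p"
    using adj unfolding enriched_adjunction_def by blast
  let ?T = "ob F P"
  have T: "?T \<in> Obj K" and FI: "ar F (Idt Pos P) = Idt K ?T"
    using F P unfolding enriched_functor_def by auto
  have FH: "Field (Hom K ?T X) = arrows K ?T X" if "X \<in> Obj K" for X
    using T that by (auto simp: arrows_def)
  have FP: "Field (Hom Pos P (und X)) = arrows Pos P (und X)" if "X \<in> Obj K" for X
    using P und_Obj[OF that] by (auto simp: arrows_def)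
  have bij: "bij_betw (\<phi> P X) (arrows K ?T X) (arrows Pos P (und X))" if "X \<in> Obj K" for X
    using iso[OF P that] by (simp add: poset_iso_def FH[OF that] FP[OF that])
  have "\<phi> P ?T (Idt K ?T) \<in> arrows Pos P (und ?T)"
    using bij_betw_apply[OF bij[OF T] id_arrow[OF T]] .
  then obtain e where e: "e \<in> monotone_maps P (und ?T)" "\<phi> P ?T (Idt K ?T) = (P, e, und ?T)"
    by (auto simp: arrows_Pos)
  have IP: "Idt Pos P \<in> arrows Pos P P"
    using P id_monotone by (auto simp: arrows_Pos Idt_Pos)
  have \<phi>: "\<phi> P X f = (P, compose (Field P) (fn f) e, und X)" if f: "f \<in> arrows K ?T X" for f X
  proof -
    have "\<phi> P X (f \<odot> Idt K ?T \<odot> ar F (Idt Pos P)) = ar U f \<odot>\<^bsub>Pos\<^esub> \<phi> P ?T (Idt K ?T) \<odot>\<^bsub>Pos\<^esub> Idt Pos P"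
      by (rule nat[OF IP f id_arrow[OF T]])
    moreover have "f \<odot> Idt K ?T \<odot> ar F (Idt Pos P) = f"
      using f by (simp add: FI comp_id)
    ultimately have "\<phi> P X f = (P, compose (Field P) (compose (Field P) (fn f) e) (\<lambda>x \<in> Field P. x), und X)"
      by (simp add: ar_U(1)[OF f] e(2) Cmp_Pos Idt_Pos)
    also have "compose (Field P) (compose (Field P) (fn f) e) (\<lambda>x \<in> Field P. x) = compose (Field P) (fn f) e"
      by (auto simp: compose_def)
    finally show ?thesis .
  qed
  have "is_free P ?T e"
    unfolding is_free_def
  proof (intro conjI ballI allI impI T e(1))
    fix X m assume X: "X \<in> Obj K" and m: "m \<in> monotone_maps P (und X)"
    have "(P, m, und X) \<in> arrows Pos P (und X)" using m P und_Obj[OF X] by (auto simp: arrows_Pos)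
    then have "(P, m, und X) \<in> \<phi> P X ` arrows K ?T X"
      by (simp only: bij_betw_imp_surj_on[OF bij[OF X]])
    then obtain f where f: "f \<in> arrows K ?T X" "\<phi> P X f = (P, m, und X)" by auto
    then have "m = compose (Field P) (fn f) e" using \<phi> by simp
    then show "\<exists>f \<in> arrows K ?T X. \<forall>p \<in> Field P. fn f (e p) = m p"
      using f(1) by (intro bexI[of _ f]) (simp_all add: compose_eq)
  next
    fix X f g assume f: "f \<in> arrows K ?T X" and g: "g \<in> arrows K ?T X"
      and le: "\<forall>p \<in> Field P. (fn f (e p), fn g (e p)) \<in> und X"
    have X: "X \<in> Obj K" using arrows_Obj[OF f] by simp
    have "(\<phi> P X f, \<phi> P X g) \<in> Hom Pos P (und X)"
      unfolding \<phi>[OF f] \<phi>[OF g] Hom_Pos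
      using compose_monotone[OF e(1) ar_U(2)[OF f]] compose_monotone[OF e(1) ar_U(2)[OF g]] le
      by (auto simp: compose_eq)
    then show "(f, g) \<in> Hom K ?T X"
      using iso[OF P X] f g FH[OF X] unfolding poset_iso_def by blast
  qed
  then show ?thesis by blast
qed

text \<open>Universal arrows chosen for all \<open>P\<close> assemble to a left adjoint:
  functoriality, monotonicity and naturality all reduce to comparisons at the generators
  \<open>e P p\<close>.\<close>

lemma free_right_adjoint:
  assumes free: "\<And>P. P \<in> Obj Pos \<Longrightarrow> \<exists>T e. is_free P T e"
  shows "right_adjoint K Pos U"
proof -
  obtain T e where Te: "\<And>P. P \<in> Obj Pos \<Longrightarrow> is_free P (T P) (e P)"
    using free by metis
  have T: "T P \<in> Obj K" and e: "e P \<in> monotone_maps P (und (T P))" if "P \<in> Obj Pos" for P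
    using Te[OF that] by (auto simp: is_free_def)
  have ex: "\<exists>f \<in> arrows K (T P) X. \<forall>p \<in> Field P. fn f (e P p) = m p"
    if "P \<in> Obj Pos" "X \<in> Obj K" "m \<in> monotone_maps P (und X)" for P X m
    using Te[OF that(1)] that(2,3) unfolding is_free_def by blast
  have canc: "(f, g) \<in> Hom K (T P) X"
    if "P \<in> Obj Pos" "f \<in> arrows K (T P) X" "g \<in> arrows K (T P) X"
      "\<And>p. p \<in> Field P \<Longrightarrow> (fn f (e P p), fn g (e P p)) \<in> und X" for P X f g
    using Te[OF that(1)] that(2-4) unfolding is_free_def by blast
  have uniq: "f = g"
    if "P \<in> Obj Pos" "f \<in> arrows K (T P) X" "g \<in> arrows K (T P) X"
      "\<And>p. p \<in> Field P \<Longrightarrow> fn f (e P p) = fn g (e P p)" for P X f g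
  proof -
    have "(fn f (e P p), fn g (e P p)) \<in> und X \<and> (fn g (e P p), fn f (e P p)) \<in> und X" if p: "p \<in> Field P" for p
    proof -
      have "fn g (e P p) \<in> Field (und X)"
        using fn_closed[OF \<open>g \<in> arrows K (T P) X\<close>] monotone_mapsD(1)[OF e[OF \<open>P \<in> Obj Pos\<close>] p] by blast
      then show ?thesis
        using Partial_orderD(1)[OF und_order] arrows_Obj(2)[OF \<open>f \<in> arrows K (T P) X\<close>] \<open>\<And>p. p \<in> Field P \<Longrightarrow> fn f (e P p) = fn g (e P p)\<close>[OF p] by simp
    qed
    then have "(f, g) \<in> Hom K (T P) X" "(g, f) \<in> Hom K (T P) X"
      using canc[OF that(1-3)] canc[OF that(1,3,2)] by auto
    then show ?thesis using Partial_orderD(3)[OF hom_poset] T[OF that(1)] arrows_Obj(2)[OF that(2)] by blast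
  qed
  define fa :: "'u pos_arrow \<Rightarrow> 'm" where
    "fa = (\<lambda>(P, m, Q). SOME f. f \<in> arrows K (T P) (T Q) \<and> (\<forall>p \<in> Field P. fn f (e P p) = e Q (m p)))"
  have fa: "fa (P, m, Q) \<in> arrows K (T P) (T Q)" "p \<in> Field P \<Longrightarrow> fn (fa (P, m, Q)) (e P p) = e Q (m p)"
    if "P \<in> Obj Pos" "Q \<in> Obj Pos" "m \<in> monotone_maps P Q" for P Q m p
  proof -
    have "\<exists>f. f \<in> arrows K (T P) (T Q) \<and> (\<forall>p \<in> Field P. fn f (e P p) = e Q (m p))"
      using ex[OF that(1) T[OF that(2)] compose_monotone[OF that(3) e[OF that(2)]]] by (auto simp: compose_eq)
    from someI_ex[OF this] show "fa (P, m, Q) \<in> arrows K (T P) (T Q)"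
      "p \<in> Field P \<Longrightarrow> fn (fa (P, m, Q)) (e P p) = e Q (m p)"
      by (auto simp: fa_def)
  qed
  let ?F = "\<lparr>ob = T, ar = fa\<rparr>"
  have F: "enriched_functor Pos K ?F"
    unfolding enriched_functor_def
  proof (intro conjI ballI allI, goal_cases)
    case (1 P)
    then show ?case using T by simp
  next
    case (2 P)
    have i: "fa (Idt Pos P) \<in> arrows K (T P) (T P)"
      using fa(1)[OF 2 2 id_monotone] by (simp add: Idt_Pos)
    have "fa (Idt Pos P) = Idt K (T P)"
    proof (rule uniq[OF 2 i id_arrow[OF T[OF 2]]])
      fix p assume p: "p \<in> Field P"
      show "fn (fa (Idt Pos P)) (e P p) = fn (Idt K (T P)) (e P p)"
        using fa(2)[OF 2 2 id_monotone p] p fn_id[OF T[OF 2] monotone_mapsD(1)[OF e[OF 2] p]]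
        by (simp add: Idt_Pos)
    qed
    then show ?case by simp
  next
    case (3 P Q z)
    obtain m m' where z: "z = ((P, m, Q), (P, m', Q))" "m \<in> monotone_maps P Q" "m' \<in> monotone_maps P Q"
      "\<And>x. x \<in> Field P \<Longrightarrow> (m x, m' x) \<in> Q"
      using 3(3) by (cases z) (auto simp: Hom_Pos)
    have "(fa (P, m, Q), fa (P, m', Q)) \<in> Hom K (T P) (T Q)"
    proof (rule canc[OF 3(1) fa(1)[OF 3(1,2) z(2)] fa(1)[OF 3(1,2) z(3)]])
      fix p assume p: "p \<in> Field P"
      show "(fn (fa (P, m, Q)) (e P p), fn (fa (P, m', Q)) (e P p)) \<in> und (T Q)"
        using fa(2)[OF 3(1,2) z(2) p] fa(2)[OF 3(1,2) z(3) p] monotone_mapsD(2)[OF e[OF 3(2)] z(4)[OF p]] by simp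
    qed
    then show ?case using z by simp
  next
    case (4 P Q R f g)
    obtain m where m: "f = (P, m, Q)" "m \<in> monotone_maps P Q" and PQ: "P \<in> Obj Pos" "Q \<in> Obj Pos"
      using 4(1) by (auto simp: arrows_Pos)
    obtain l where l: "g = (Q, l, R)" "l \<in> monotone_maps Q R" and R: "R \<in> Obj Pos"
      using 4(2) by (auto simp: arrows_Pos)
    have lm: "compose (Field P) l m \<in> monotone_maps P R" by (rule compose_monotone[OF m(2) l(2)])
    have "fa (P, compose (Field P) l m, R) = fa (Q, l, R) \<odot> fa (P, m, Q)"
    proof (rule uniq[OF PQ(1) fa(1)[OF PQ(1) R lm] comp_arrow[OF fa(1)[OF PQ m(2)] fa(1)[OF PQ(2) R l(2)]]])
      fix p assume p: "p \<in> Field P"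
      then show "fn (fa (P, compose (Field P) l m, R)) (e P p) = fn (fa (Q, l, R) \<odot> fa (P, m, Q)) (e P p)"
        using fa(2)[OF PQ(1) R lm p] fa(2)[OF PQ m(2) p] fa(2)[OF PQ(2) R l(2) monotone_mapsD(1)[OF m(2) p]]
          fn_comp[OF fa(1)[OF PQ m(2)] fa(1)[OF PQ(2) R l(2)] monotone_mapsD(1)[OF e[OF PQ(1)] p]]
        by (simp add: compose_eq)
    qed
    then show ?case by (simp add: m l Cmp_Pos)
  qed
  define \<phi> where "\<phi> P X f = (P, compose (Field P) (fn f) (e P), und X)" for P X f
  have "enriched_adjunction Pos K ?F U"
    unfolding enriched_adjunction_def
  proof (intro exI[of _ \<phi>] conjI ballI allI, goal_cases)
    case (1 P X)
    have FH: "Field (Hom K (T P) X) = arrows K (T P) X"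
      using 1 T by (auto simp: arrows_def)
    have FP: "Field (Hom Pos P (und X)) = arrows Pos P (und X)"
      using 1 und_Obj by (auto simp: arrows_def)
    have ar: "compose (Field P) (fn f) (e P) \<in> monotone_maps P (und X)" if "f \<in> arrows K (T P) X" for f
      using compose_monotone[OF e[OF 1(1)] ar_U(2)[OF that]] .
    have ord: "(f, g) \<in> Hom K (T P) X \<longleftrightarrow> (\<phi> P X f, \<phi> P X g) \<in> Hom Pos P (und X)"
      if f: "f \<in> arrows K (T P) X" and g: "g \<in> arrows K (T P) X" for f g
    proof
      assume "(f, g) \<in> Hom K (T P) X"
      then show "(\<phi> P X f, \<phi> P X g) \<in> Hom Pos P (und X)"
        using ar[OF f] ar[OF g] Hom_iff[OF f g] monotone_mapsD(1)[OF e[OF 1(1)]]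
        by (auto simp: \<phi>_def Hom_Pos compose_eq)
    next
      assume "(\<phi> P X f, \<phi> P X g) \<in> Hom Pos P (und X)"
      then show "(f, g) \<in> Hom K (T P) X"
        by (intro canc[OF 1(1) f g]) (auto simp: \<phi>_def Hom_Pos compose_def)
    qed
    have inj: "inj_on (\<phi> P X) (arrows K (T P) X)"
    proof (rule inj_onI)
      fix f g assume f: "f \<in> arrows K (T P) X" and g: "g \<in> arrows K (T P) X" and eq: "\<phi> P X f = \<phi> P X g"
      show "f = g"
      proof (rule uniq[OF 1(1) f g])
        fix p assume p: "p \<in> Field P"
        have "compose (Field P) (fn f) (e P) = compose (Field P) (fn g) (e P)"
          using eq by (simp add: \<phi>_def)
        from fun_cong[OF this, of p] show "fn f (e P p) = fn g (e P p)" using p by (simp add: compose_eq)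
      qed
    qed
    have "\<phi> P X ` arrows K (T P) X = arrows Pos P (und X)"
    proof (intro equalityI subsetI)
      fix z assume "z \<in> \<phi> P X ` arrows K (T P) X"
      then show "z \<in> arrows Pos P (und X)"
        using ar 1 und_Obj by (auto simp: \<phi>_def arrows_Pos)
    next
      fix z assume "z \<in> arrows Pos P (und X)"
      then obtain m where m: "z = (P, m, und X)" "m \<in> monotone_maps P (und X)" by (auto simp: arrows_Pos)
      obtain f where f: "f \<in> arrows K (T P) X" "\<And>p. p \<in> Field P \<Longrightarrow> fn f (e P p) = m p"
        using ex[OF 1 m(2)] by blast
      have "compose (Field P) (fn f) (e P) = m"
        by (rule monotone_maps_ext[OF ar[OF f(1)] m(2)]) (simp add: compose_eq f(2))
      then show "z \<in> \<phi> P X ` arrows K (T P) X" using f(1) m(1) by (auto simp: \<phi>_def)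
    qed
    then show ?case
      unfolding poset_iso_def pfunctor.simps FH FP bij_betw_def using inj ord by blast
  next
    case (2 P P' X X' p g f)
    then have f: "f \<in> arrows K (T P) X" by simp
    obtain m where m: "p = (P', m, P)" "m \<in> monotone_maps P' P" and P: "P \<in> Obj Pos" "P' \<in> Obj Pos"
      using 2(1) by (auto simp: arrows_Pos)
    have a: "fa p \<in> arrows K (T P') (T P)" unfolding m(1) by (rule fa(1)[OF P(2,1) m(2)])
    have "fn (g \<odot> f \<odot> fa p) (e P' x) = fn g (fn f (e P (m x)))" if x: "x \<in> Field P'" for x
      using fn_comp[OF a comp_arrow[OF f 2(2)] monotone_mapsD(1)[OF e[OF P(2)] x]] fa(2)[OF P(2,1) m(2) x]
        fn_comp[OF f 2(2) monotone_mapsD(1)[OF e[OF P(1)] monotone_mapsD(1)[OF m(2) x]]]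
      by (simp add: m(1))
    then show ?case
      using monotone_mapsD(1)[OF m(2)] by (auto simp: \<phi>_def m(1) ar_U(1)[OF 2(2)] Cmp_Pos compose_def fun_eq_iff)
  qed
  then show ?thesis unfolding right_adjoint_def using functor_U F by blast
qed

end

lemma concreteI: "concrete_category K U \<Longrightarrow> concrete K U"
  unfolding concrete_def concrete_axioms_def by (simp add: concrete_category_def)

section \<open>Categories concretely equivalent to a variety\<close>

text \<open>The chains in the single entries may have different lengths. As \<open>r\<close> is
  reflexive on \<open>X\<close>, one entry can be moved while the others stay fixed, which merges
  them into a single chain of lists. In this way a transitive closure inherits compatibility with
  operations of several arguments.\<close>

lemma list_all2_rtrancl:
  assumes "list_all2 (\<lambda>x y. (x, y) \<in> r\<^sup>*) xs ys" "set xs \<subseteq> X" "r \<subseteq> X \<times> X" "\<And>x. x \<in> X \<Longrightarrow> (x, x) \<in> r"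
  shows "(xs, ys) \<in> {(us, vs). list_all2 (\<lambda>x y. (x, y) \<in> r) us vs}\<^sup>*"
  using assms(1,2)
proof (induction rule: list_all2_induct)
  case Nil
  then show ?case by simp
next
  case (Cons x xs y ys)
  let ?L = "{(us, vs). list_all2 (\<lambda>x y. (x, y) \<in> r) us vs}"
  have xs: "list_all2 (\<lambda>x y. (x, y) \<in> r) xs xs"
    using Cons.prems assms(4) by (intro list.rel_refl_strong) auto
  have "(x # xs, y # xs) \<in> ?L\<^sup>*"
    using Cons.hyps(1)
  proof (induction rule: rtrancl_induct)
    case (step z w)
    have "(z # xs, w # xs) \<in> ?L" using step.hyps(2) xs by simp
    with step.IH show ?case by (rule rtrancl_into_rtrancl)
  qed simp
  moreover have "(xs, ys) \<in> ?L\<^sup>*" using Cons by simp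
  then have "(y # xs, y # ys) \<in> ?L\<^sup>*"
  proof (induction rule: rtrancl_induct)
    case (step us vs)
    have "y \<in> X" using Cons.hyps(1) Cons.prems assms(3) by (induction rule: rtrancl_induct) auto
    then have "(y # us, y # vs) \<in> ?L" using step.hyps(2) assms(4) by simp
    with step.IH show ?case by (rule rtrancl_into_rtrancl)
  qed simp
  ultimately show ?case by (rule rtrancl_trans)
qed

lemma geval_hom:
  assumes "is_gterm S V t" "v ` V \<subseteq> M"
    and "\<And>f xs. f \<in> S (length xs) \<Longrightarrow> set xs \<subseteq> M \<Longrightarrow> p f xs \<in> M"
    and "\<And>f xs. f \<in> S (length xs) \<Longrightarrow> set xs \<subseteq> M \<Longrightarrow> h (p f xs) = p' f (map h xs)"
  shows "geval p v t \<in> M \<and> h (geval p v t) = geval p' (\<lambda>x. h (v x)) t"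
  using assms(1)
proof (induction t)
  case (GVar x)
  then show ?case using assms(2) by auto
next
  case (GApp f ts)
  have M: "set (map (geval p v) ts) \<subseteq> M" using GApp by auto
  have f: "f \<in> S (length (map (geval p v) ts))" using GApp.prems by simp
  have eq: "map h (map (geval p v) ts) = map (geval p' (\<lambda>x. h (v x))) ts" using GApp by auto
  show ?case unfolding geval.simps eq[symmetric] using assms(3)[OF f M] assms(4)[OF f M] by blast
qed

lemma teval_hom:
  assumes "is_term S t" "range v \<subseteq> M"
    and "\<And>f xs. f \<in> S (length xs) \<Longrightarrow> set xs \<subseteq> M \<Longrightarrow> p f xs \<in> M"
    and "\<And>f xs. f \<in> S (length xs) \<Longrightarrow> set xs \<subseteq> M \<Longrightarrow> h (p f xs) = p' f (map h xs)"
  shows "teval p v t \<in> M \<and> h (teval p v t) = teval p' (\<lambda>n. h (v n)) t"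
  using assms(1)
proof (induction t)
  case (Var n)
  then show ?case using assms(2) by auto
next
  case (App f ts)
  have M: "set (map (teval p v) ts) \<subseteq> M" using App by auto
  have f: "f \<in> S (length (map (teval p v) ts))" using App.prems by simp
  have eq: "map h (map (teval p v) ts) = map (teval p' (\<lambda>n. h (v n))) ts" using App by auto
  show ?case unfolding teval.simps eq[symmetric] using assms(3)[OF f M] assms(4)[OF f M] by blast
qed

lemma Obj_Variety: "A \<in> Obj (Variety S \<Gamma>) \<longleftrightarrow> ordered_algebra S A \<and> (\<forall>e \<in> \<Gamma>. satisfies A e)"
  by (simp add: Variety_def)

lemma ordered_algebraD:
  assumes "ordered_algebra S A"
  shows "under A \<in> Obj Pos" "Partial_order (under A)"
    and "f \<in> S (length xs) \<Longrightarrow> set xs \<subseteq> Field (under A) \<Longrightarrow> oper A f xs \<in> Field (under A)"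
    and "f \<in> S (length xs) \<Longrightarrow> list_all2 (\<lambda>x y. (x, y) \<in> under A) xs ys \<Longrightarrow> (oper A f xs, oper A f ys) \<in> under A"
    and "\<not> (f \<in> S (length xs) \<and> set xs \<subseteq> Field (under A)) \<Longrightarrow> oper A f xs = undefined"
  using assms unfolding ordered_algebra_def by (auto simp: Obj_Pos)

lemma geval_mono:
  assumes A: "ordered_algebra S A" and t: "is_gterm S V t" and "\<And>x. x \<in> V \<Longrightarrow> (v x, w x) \<in> under A"
  shows "(geval (oper A) v t, geval (oper A) w t) \<in> under A"
  using t
proof (induction t)
  case (GApp f ts)
  have "list_all2 (\<lambda>x y. (x, y) \<in> under A) (map (geval (oper A) v) ts) (map (geval (oper A) w) ts)"
    using GApp by (auto simp: list_all2_map1 list_all2_map2 intro!: list.rel_refl_strong)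
  then show ?case using GApp.prems ordered_algebraD(4)[OF A] by simp
qed (use assms in simp)

text \<open>What an equivalence with a variety means elementwise: \<open>alg\<close> is its object
  part, arrows are exactly the homomorphisms, and \<open>ess\<close> says that every algebra is
  isomorphic to some \<open>alg X\<close>, in the form of a surjective order-reflecting
  homomorphism. So any algebra of the variety that can be built yields an object of
  \<open>K\<close>.\<close>

locale algebraic = concrete K U + universe univ
  for K :: "('o, 'm) pcat" (structure) and U :: "('o, 'm, 'u rel, 'u pos_arrow) pfunctor" and univ :: "'u set" +
  fixes S :: "'u signature" and \<Gamma> :: "('u trm \<times> 'u trm) set" and alg :: "'o \<Rightarrow> 'u ordered_alg"
  assumes sig: "is_signature S" and ineqs: "are_inequations S \<Gamma>"
    and alg_Obj: "X \<in> Obj K \<Longrightarrow> alg X \<in> Obj (Variety S \<Gamma>)"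
    and under_alg: "X \<in> Obj K \<Longrightarrow> under (alg X) = ob U X"
    and fn_hom: "f \<in> arrows K X Y \<Longrightarrow> fn f \<in> monotone_homs S (alg X) (alg Y)"
    and full: "X \<in> Obj K \<Longrightarrow> Y \<in> Obj K \<Longrightarrow> h \<in> monotone_homs S (alg X) (alg Y) \<Longrightarrow> \<exists>f \<in> arrows K X Y. fn f = h"
    and ess: "A \<in> Obj (Variety S \<Gamma>) \<Longrightarrow> \<exists>X \<in> Obj K. \<exists>j \<in> monotone_homs S A (alg X).
      j ` Field (under A) = Field (ob U X) \<and>
      (\<forall>x \<in> Field (under A). \<forall>y \<in> Field (under A). (j x, j y) \<in> ob U X \<longrightarrow> (x, y) \<in> under A)"
begin

abbreviation opr :: "'o \<Rightarrow> 'u \<Rightarrow> 'u list \<Rightarrow> 'u" where "opr X \<equiv> oper (alg X)"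

lemma alg_ordered: "X \<in> Obj K \<Longrightarrow> ordered_algebra S (alg X)"
  using alg_Obj by (simp add: Obj_Variety)

lemma opr_closed: "X \<in> Obj K \<Longrightarrow> f \<in> S (length xs) \<Longrightarrow> set xs \<subseteq> Field (und X) \<Longrightarrow> opr X f xs \<in> Field (und X)"
  using ordered_algebraD(3)[OF alg_ordered] under_alg by metis

lemma opr_mono: "X \<in> Obj K \<Longrightarrow> f \<in> S (length xs) \<Longrightarrow> list_all2 (\<lambda>x y. (x, y) \<in> und X) xs ys \<Longrightarrow>
    (opr X f xs, opr X f ys) \<in> und X"
  using ordered_algebraD(4)[OF alg_ordered, of X f xs ys] under_alg[of X] by simp

lemma ineq_terms: "(s, t) \<in> \<Gamma> \<Longrightarrow> is_term S s \<and> is_term S t"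
  using ineqs unfolding are_inequations_def by blast

lemma opr_sat: "X \<in> Obj K \<Longrightarrow> (s, t) \<in> \<Gamma> \<Longrightarrow> range v \<subseteq> Field (und X) \<Longrightarrow>
    (teval (opr X) v s, teval (opr X) v t) \<in> und X"
  using alg_Obj[of X] under_alg[of X] by (auto simp: Obj_Variety satisfies_def eval_term_teval)

lemma fn_opr:
  assumes "f \<in> arrows K X Y" "\<sigma> \<in> S (length xs)" "set xs \<subseteq> Field (und X)"
  shows "fn f (opr X \<sigma> xs) = opr Y \<sigma> (map (fn f) xs)"
  using fn_hom[OF assms(1)] assms(2,3) under_alg arrows_Obj[OF assms(1)] by (simp add: monotone_homs_def)

lemma arrowI:
  assumes X: "X \<in> Obj K" and Y: "Y \<in> Obj K"
    and mono: "\<And>x y. (x, y) \<in> und X \<Longrightarrow> (h x, h y) \<in> und Y"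
    and hom: "\<And>\<sigma> xs. \<sigma> \<in> S (length xs) \<Longrightarrow> set xs \<subseteq> Field (und X) \<Longrightarrow> h (opr X \<sigma> xs) = opr Y \<sigma> (map h xs)"
  shows "\<exists>f \<in> arrows K X Y. \<forall>x \<in> Field (und X). fn f x = h x"
proof -
  let ?h = "restrict h (Field (und X))"
  have "?h \<in> monotone_maps (und X) (und Y)" using mono by (rule monotone_mapsI)
  moreover have "?h (opr X \<sigma> xs) = opr Y \<sigma> (map ?h xs)" if "\<sigma> \<in> S (length xs)" "set xs \<subseteq> Field (und X)" for \<sigma> xs
  proof -
    have eq: "map ?h xs = map h xs" using that(2) by auto
    show ?thesis unfolding eq using hom[OF that] opr_closed[OF X that] by simp
  qed
  ultimately have "?h \<in> monotone_homs S (alg X) (alg Y)"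
    using X Y by (simp add: monotone_homs_def under_alg)
  then obtain f where "f \<in> arrows K X Y" "fn f = ?h" using full X Y by blast
  then show ?thesis by (intro bexI[of _ f]) simp_all
qed

text \<open>\<open>T\<close> is the poset reflection of the preordered algebra, realized inside
  \<open>K\<close>, and \<open>q\<close> is its projection.\<close>

definition is_quotient :: "'x set \<Rightarrow> ('x \<Rightarrow> 'x \<Rightarrow> bool) \<Rightarrow> ('u \<Rightarrow> 'x list \<Rightarrow> 'x) \<Rightarrow> 'o \<Rightarrow> ('x \<Rightarrow> 'u) \<Rightarrow> bool" where
  "is_quotient M le p T q \<longleftrightarrow> T \<in> Obj K \<and> q ` M = Field (und T) \<and>
     (\<forall>x \<in> M. \<forall>y \<in> M. (q x, q y) \<in> und T \<longleftrightarrow> le x y) \<and>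
     (\<forall>f xs. f \<in> S (length xs) \<and> set xs \<subseteq> M \<longrightarrow> p f xs \<in> M \<and> q (p f xs) = opr T f (map q xs))"

text \<open>The quotient algebra satisfies the inequations because they hold up to \<open>le\<close>
  before the quotient is taken. Essential surjectivity then supplies the object of \<open>K\<close>,
  and \<open>q\<close> is the class map followed by the isomorphism.\<close>

lemma quotient_exists:
  assumes pa: "preordered_algebra univ S M le p"
    and sat: "\<And>s t v. (s, t) \<in> \<Gamma> \<Longrightarrow> range v \<subseteq> M \<Longrightarrow> le (teval p v s) (teval p v t)"
  shows "\<exists>T q. is_quotient M le p T q"
proof -
  interpret pa: preordered_algebra univ S M le p by (rule pa)
  have "satisfies pa.quot e" if "e \<in> \<Gamma>" for e
    using that ineq_terms sat pa.quot_satisfies by (cases e) blast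
  then have "pa.quot \<in> Obj (Variety S \<Gamma>)"
    using pa.ordered_algebra_quot by (simp add: Obj_Variety)
  then obtain T where T: "T \<in> Obj K" and "\<exists>j \<in> monotone_homs S pa.quot (alg T).
      j ` Field (under pa.quot) = Field (und T) \<and>
      (\<forall>x \<in> Field (under pa.quot). \<forall>y \<in> Field (under pa.quot). (j x, j y) \<in> und T \<longrightarrow> (x, y) \<in> under pa.quot)"
    using ess by blast
  then obtain j where j: "j \<in> monotone_homs S pa.quot (alg T)"
    and surj: "j ` Field (under pa.quot) = Field (und T)"
    and refl: "\<forall>x \<in> Field (under pa.quot). \<forall>y \<in> Field (under pa.quot). (j x, j y) \<in> und T \<longrightarrow> (x, y) \<in> under pa.quot"
    by blast
  have jm: "j \<in> monotone_maps (under pa.quot) (und T)" using j T by (simp add: monotone_homs_def under_alg)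
  have "is_quotient M le p T (\<lambda>x. j (pa.proj x))"
    unfolding is_quotient_def
  proof (intro conjI ballI allI impI)
    show "(\<lambda>x. j (pa.proj x)) ` M = Field (und T)"
      using surj unfolding pa.Field_quot by (simp add: image_image)
    show "(j (pa.proj x), j (pa.proj y)) \<in> und T \<longleftrightarrow> le x y" if "x \<in> M" "y \<in> M" for x y
      using refl monotone_mapsD(2)[OF jm, of "pa.proj x" "pa.proj y"]
        pa.proj_le[OF that] that by (auto simp: pa.Field_quot)
    fix f and xs :: "'a list" assume A: "f \<in> S (length xs) \<and> set xs \<subseteq> M"
    then show "p f xs \<in> M" using pa.p_closed by blast
    have "set (map pa.proj xs) \<subseteq> Field (under pa.quot)" using A by (auto simp: pa.Field_quot)
    then have "j (oper pa.quot f (map pa.proj xs)) = opr T f (map j (map pa.proj xs))"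
      using j A by (simp add: monotone_homs_def)
    then show "j (pa.proj (p f xs)) = opr T f (map (\<lambda>x. j (pa.proj x)) xs)"
      using A by (simp add: pa.proj_oper comp_def)
  qed (rule T)
  then show ?thesis by blast
qed

text \<open>The universal property of the quotient. The arrow is defined on representatives;
  equivalent elements have equal values under \<open>h\<close> by antisymmetry in
  \<open>X\<close>.\<close>

lemma quotient_arrow:
  assumes q: "is_quotient M le p T q" and X: "X \<in> Obj K"
    and h: "\<And>x. x \<in> M \<Longrightarrow> h x \<in> Field (und X)"
    and mono: "\<And>x y. x \<in> M \<Longrightarrow> y \<in> M \<Longrightarrow> le x y \<Longrightarrow> (h x, h y) \<in> und X"
    and hom: "\<And>\<sigma> xs. \<sigma> \<in> S (length xs) \<Longrightarrow> set xs \<subseteq> M \<Longrightarrow> h (p \<sigma> xs) = opr X \<sigma> (map h xs)"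
  shows "\<exists>f \<in> arrows K T X. \<forall>x \<in> M. fn f (q x) = h x"
proof -
  have T: "T \<in> Obj K" and surj: "q ` M = Field (und T)"
    and ord: "\<And>x y. x \<in> M \<Longrightarrow> y \<in> M \<Longrightarrow> (q x, q y) \<in> und T \<longleftrightarrow> le x y"
    and ops: "\<And>f xs. f \<in> S (length xs) \<Longrightarrow> set xs \<subseteq> M \<Longrightarrow> p f xs \<in> M \<and> q (p f xs) = opr T f (map q xs)"
    using q unfolding is_quotient_def by auto
  let ?r = "inv_into M q"
  have r: "?r u \<in> M" "q (?r u) = u" if "u \<in> Field (und T)" for u
    using that unfolding surj[symmetric] by (auto intro: inv_into_into f_inv_into_f)
  have hr: "h (?r (q x)) = h x" if x: "x \<in> M" for x
  proof -
    have qx: "q x \<in> Field (und T)" using x surj by blast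
    then have "(q x, q x) \<in> und T" using Partial_orderD(1)[OF und_order[OF T]] by blast
    then have "(h (?r (q x)), h x) \<in> und X" "(h x, h (?r (q x))) \<in> und X"
      using mono[OF r(1)[OF qx] x] mono[OF x r(1)[OF qx]] ord[OF r(1)[OF qx] x] ord[OF x r(1)[OF qx]] r(2)[OF qx]
      by auto
    then show ?thesis using Partial_orderD(3)[OF und_order[OF X]] by blast
  qed
  have "\<exists>f \<in> arrows K T X. \<forall>u \<in> Field (und T). fn f u = h (?r u)"
  proof (rule arrowI[OF T X])
    show "(h (?r u), h (?r v)) \<in> und X" if uv: "(u, v) \<in> und T" for u v
      using mono[OF r(1)[OF FieldI1[OF uv]] r(1)[OF FieldI2[OF uv]]]
        ord[OF r(1)[OF FieldI1[OF uv]] r(1)[OF FieldI2[OF uv]]] r(2)[OF FieldI1[OF uv]] r(2)[OF FieldI2[OF uv]] uv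
      by simp
    fix \<sigma> us assume \<sigma>: "\<sigma> \<in> S (length us)" and us: "set us \<subseteq> Field (und T)"
    let ?xs = "map ?r us"
    have xs: "set ?xs \<subseteq> M" "\<sigma> \<in> S (length ?xs)" using us r(1) \<sigma> by auto
    have eq: "map q ?xs = us" using us r(2) by (induction us) auto
    have "opr T \<sigma> us = q (p \<sigma> ?xs)" using ops[OF xs(2,1)] unfolding eq by simp
    then have "h (?r (opr T \<sigma> us)) = h (p \<sigma> ?xs)" using hr[of "p \<sigma> ?xs"] ops[OF xs(2,1)] by (simp only:)
    also have "\<dots> = opr X \<sigma> (map h ?xs)" by (rule hom[OF xs(2,1)])
    finally show "h (?r (opr T \<sigma> us)) = opr X \<sigma> (map (\<lambda>u. h (?r u)) us)" by (simp add: comp_def)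
  qed
  then obtain f where f: "f \<in> arrows K T X" "\<forall>u \<in> Field (und T). fn f u = h (?r u)" by blast
  have "\<forall>x \<in> M. fn f (q x) = h x" using f(2) hr unfolding surj[symmetric] by simp
  then show ?thesis using f(1) by blast
qed

lemma fn_geval:
  assumes "f \<in> arrows K X Y" "is_gterm S V t" "v ` V \<subseteq> Field (und X)"
  shows "geval (opr X) v t \<in> Field (und X)" "fn f (geval (opr X) v t) = geval (opr Y) (\<lambda>x. fn f (v x)) t"
  using geval_hom[OF assms(2,3), of "opr X" "fn f" "opr Y"] opr_closed[OF arrows_Obj(1)[OF assms(1)]] fn_opr[OF assms(1)]
  by auto

section \<open>Presentations by generators and relations\<close>

definition is_presented :: "'v set \<Rightarrow> (('u, 'v) gterm \<times> ('u, 'v) gterm) set \<Rightarrow> 'o \<Rightarrow> ('v \<Rightarrow> 'u) \<Rightarrow> bool" where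
  "is_presented G R T e \<longleftrightarrow> T \<in> Obj K \<and> e ` G \<subseteq> Field (und T) \<and>
     (\<forall>(s, t) \<in> R. (geval (opr T) e s, geval (opr T) e t) \<in> und T) \<and>
     (\<forall>X \<in> Obj K. \<forall>h. h ` G \<subseteq> Field (und X) \<and> (\<forall>(s, t) \<in> R. (geval (opr X) h s, geval (opr X) h t) \<in> und X) \<longrightarrow>
        (\<exists>f \<in> arrows K T X. \<forall>g \<in> G. fn f (e g) = h g)) \<and>
     (\<forall>X. \<forall>f \<in> arrows K T X. \<forall>f' \<in> arrows K T X.
        (\<forall>g \<in> G. (fn f (e g), fn f' (e g)) \<in> und X) \<longrightarrow> (f, f') \<in> Hom K T X)"

lemma is_presentedD:
  assumes "is_presented G R T e"
  shows "T \<in> Obj K" and "g \<in> G \<Longrightarrow> e g \<in> Field (und T)"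
    and "(s, t) \<in> R \<Longrightarrow> (geval (opr T) e s, geval (opr T) e t) \<in> und T"
    and "X \<in> Obj K \<Longrightarrow> (\<And>g. g \<in> G \<Longrightarrow> h g \<in> Field (und X)) \<Longrightarrow>
      (\<And>s t. (s, t) \<in> R \<Longrightarrow> (geval (opr X) h s, geval (opr X) h t) \<in> und X) \<Longrightarrow>
      \<exists>f \<in> arrows K T X. \<forall>g \<in> G. fn f (e g) = h g"
    and "f \<in> arrows K T X \<Longrightarrow> f' \<in> arrows K T X \<Longrightarrow>
      (\<And>g. g \<in> G \<Longrightarrow> (fn f (e g), fn f' (e g)) \<in> und X) \<Longrightarrow> (f, f') \<in> Hom K T X"
  using assms unfolding is_presented_def by (blast, blast, blast, simp add: image_subset_iff split_beta, blast)

text \<open>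
  The terms are preordered by: \<open>s\<close> is below \<open>t\<close> if this holds for all interpretations of the
  generators in objects of \<open>K\<close> that satisfy the relations.
\<close>

lemma presented_exists:
  fixes G :: "'v set"
  assumes G: "sm G" and R: "\<And>s t. (s, t) \<in> R \<Longrightarrow> is_gterm S G s \<and> is_gterm S G t"
  shows "\<exists>T e. is_presented G R T e"
proof -
  define mdl where "mdl X h \<longleftrightarrow> X \<in> Obj K \<and> h ` G \<subseteq> Field (und X) \<and>
    (\<forall>(s, t) \<in> R. (geval (opr X) h s, geval (opr X) h t) \<in> und X)" for X and h :: "'v \<Rightarrow> 'u"
  define M where "M = {t. is_gterm S G t}"
  define le where "le s t \<longleftrightarrow> (\<forall>X h. mdl X h \<longrightarrow> (geval (opr X) h s, geval (opr X) h t) \<in> und X)"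
    for s t :: "('u, 'v) gterm"
  have ev: "geval (opr X) h t \<in> Field (und X)" if "mdl X h" "t \<in> M" for X h t
    using that geval_hom[of S G t h "Field (und X)" "opr X" id "opr X"] opr_closed by (auto simp: mdl_def M_def)
  have pa: "preordered_algebra univ S M le GApp"
  proof unfold_locales
    show "sm M" unfolding M_def using sm_gterms[of S G] sig G by (simp add: is_signature_def small_iff_sm)
    show "le t t" if "t \<in> M" for t
      using ev[OF _ that] Partial_orderD(1)[OF und_order] by (auto simp: le_def mdl_def)
    show "le r t" if rs: "le r s" and st: "le s t" for r s t
      unfolding le_def
    proof (intro allI impI)
      fix X h assume m: "mdl X h"
      have "X \<in> Obj K" using m by (simp add: mdl_def)
      then show "(geval (opr X) h r, geval (opr X) h t) \<in> und X"
        using Partial_orderD(2)[OF und_order] rs st m unfolding le_def by meson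
    qed
    show "GApp f ts \<in> M" if "f \<in> S (length ts)" "set ts \<subseteq> M" for f ts
      using that by (auto simp: M_def)
    show "le (GApp f ts) (GApp f ss)" if "f \<in> S (length ts)" "list_all2 le ts ss" for f ts ss
      unfolding le_def
    proof (intro allI impI)
      fix X h assume m: "mdl X h"
      have "list_all2 (\<lambda>x y. (x, y) \<in> und X) (map (geval (opr X) h) ts) (map (geval (opr X) h) ss)"
        by (rule list_all2_mapI[OF that(2)]) (use m in \<open>auto simp: le_def\<close>)
      then show "(geval (opr X) h (GApp f ts), geval (opr X) h (GApp f ss)) \<in> und X"
        using opr_mono m that(1) by (simp add: mdl_def)
    qed
  qed
  \<comment> \<open>Substituting terms and then evaluating is evaluation at the composed valuation.
    So an inequation of \<open>\<Gamma>\<close>, which holds in every \<open>X\<close>, holds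
    between terms up to \<open>le\<close>.\<close>
  have subst: "geval p h (teval GApp v t) = teval p (\<lambda>n. geval p h (v n)) t"
    for p :: "'u \<Rightarrow> 'u list \<Rightarrow> 'u" and h and v :: "nat \<Rightarrow> ('u, 'v) gterm" and t
    by (induction t) (auto simp: comp_def cong: map_cong)
  have "\<exists>T q. is_quotient M le GApp T q"
  proof (rule quotient_exists[OF pa])
    show "le (teval GApp v s) (teval GApp v t)" if "(s, t) \<in> \<Gamma>" "range v \<subseteq> M" for s t v
      unfolding le_def subst
    proof (intro allI impI)
      fix X h assume m: "mdl X h"
      have "range (\<lambda>n. geval (opr X) h (v n)) \<subseteq> Field (und X)" using ev[OF m] that(2) by blast
      then show "(teval (opr X) (\<lambda>n. geval (opr X) h (v n)) s, teval (opr X) (\<lambda>n. geval (opr X) h (v n)) t) \<in> und X"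
        using opr_sat that(1) m by (simp add: mdl_def)
    qed
  qed
  then obtain T q where q: "is_quotient M le GApp T q" by blast
  then have T: "T \<in> Obj K" and surj: "q ` M = Field (und T)"
    and ord: "\<And>x y. x \<in> M \<Longrightarrow> y \<in> M \<Longrightarrow> (q x, q y) \<in> und T \<longleftrightarrow> le x y"
    and ops: "\<And>f xs. f \<in> S (length xs) \<Longrightarrow> set xs \<subseteq> M \<Longrightarrow> q (GApp f xs) = opr T f (map q xs)"
    unfolding is_quotient_def by auto
  let ?e = "\<lambda>g. q (GVar g)"
  have e: "?e ` G \<subseteq> Field (und T)" unfolding surj[symmetric] by (auto simp: M_def)
  have qe: "q t = geval (opr T) ?e t" if "t \<in> M" for t
    using that
  proof (induction t)
    case (GApp f ts)
    then have eq: "map q ts = map (geval (opr T) ?e) ts" by (auto simp: M_def)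
    show ?case using GApp.prems ops[of f ts] unfolding eq by (auto simp: M_def)
  qed simp
  have "is_presented G R T ?e"
    unfolding is_presented_def
  proof (intro conjI ballI allI impI T e)
    fix z assume "z \<in> R"
    moreover obtain s t where z: "z = (s, t)" by force
    ultimately have st: "(s, t) \<in> R" "s \<in> M" "t \<in> M" using R by (auto simp: M_def)
    then have "le s t" by (auto simp: le_def mdl_def)
    then show "case z of (s, t) \<Rightarrow> (geval (opr T) ?e s, geval (opr T) ?e t) \<in> und T"
      using ord st qe z by simp
  next
    fix X h assume X: "X \<in> Obj K"
      and h: "h ` G \<subseteq> Field (und X) \<and> (\<forall>(s, t) \<in> R. (geval (opr X) h s, geval (opr X) h t) \<in> und X)"
    then have m: "mdl X h" by (simp add: mdl_def)
    have "\<exists>f \<in> arrows K T X. \<forall>t \<in> M. fn f (q t) = geval (opr X) h t"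
      by (rule quotient_arrow[OF q X]) (use ev[OF m] m in \<open>auto simp: le_def\<close>)
    then obtain f where f: "f \<in> arrows K T X" "\<And>t. t \<in> M \<Longrightarrow> fn f (q t) = geval (opr X) h t" by blast
    then have "\<forall>g \<in> G. fn f (?e g) = h g" by (simp add: M_def)
    then show "\<exists>f \<in> arrows K T X. \<forall>g \<in> G. fn f (?e g) = h g" using f(1) by blast
  next
    fix X f f' assume f: "f \<in> arrows K T X" and f': "f' \<in> arrows K T X"
      and le: "\<forall>g \<in> G. (fn f (?e g), fn f' (?e g)) \<in> und X"
    show "(f, f') \<in> Hom K T X"
      unfolding Hom_iff[OF f f'] surj[symmetric]
    proof
      fix u assume "u \<in> q ` M"
      then obtain t where t: "t \<in> M" "u = geval (opr T) ?e t" using qe by blast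
      have tt: "is_gterm S G t" using t(1) by (simp add: M_def)
      show "(fn f u, fn f' u) \<in> und X"
        using geval_mono[OF alg_ordered[OF arrows_Obj(2)[OF f]] tt, of "\<lambda>g. fn f (?e g)" "\<lambda>g. fn f' (?e g)"]
          le under_alg[OF arrows_Obj(2)[OF f]] fn_geval(2)[OF f tt e] fn_geval(2)[OF f' tt e] t(2) by simp
    qed
  qed
  then show ?thesis by blast
qed

lemma free_exists: assumes P: "P \<in> Obj Pos" shows "\<exists>T e. is_free P T e"
proof -
  have PP: "Partial_order P" "sm (Field P)" using P by (auto simp: Obj_Pos small_iff_sm)
  let ?R = "{(GVar x, GVar y) | x y. (x, y) \<in> P}"
  have "\<exists>T e. is_presented (Field P) ?R T e"
    by (rule presented_exists[OF PP(2)]) (auto intro: FieldI1 FieldI2)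
  then obtain T e where e: "is_presented (Field P) ?R T e" by blast
  let ?e = "restrict e (Field P)"
  have "is_free P T ?e"
    unfolding is_free_def
  proof (intro conjI ballI allI impI)
    show "T \<in> Obj K" by (rule is_presentedD(1)[OF e])
    show "?e \<in> monotone_maps P (und T)"
    proof (rule monotone_mapsI)
      fix x y assume "(x, y) \<in> P"
      then show "(e x, e y) \<in> und T" using is_presentedD(3)[OF e, of "GVar x" "GVar y"] by simp
    qed
    fix X m assume X: "X \<in> Obj K" and m: "m \<in> monotone_maps P (und X)"
    have "\<exists>f \<in> arrows K T X. \<forall>p \<in> Field P. fn f (e p) = m p"
      by (rule is_presentedD(4)[OF e X]) (use monotone_mapsD[OF m] in auto)
    then show "\<exists>f \<in> arrows K T X. \<forall>p \<in> Field P. fn f (?e p) = m p" by simp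
  next
    fix X f g assume fg: "f \<in> arrows K T X" "g \<in> arrows K T X" "\<forall>p \<in> Field P. (fn f (?e p), fn g (?e p)) \<in> und X"
    show "(f, g) \<in> Hom K T X" by (rule is_presentedD(5)[OF e fg(1,2)]) (use fg(3) in simp)
  qed
  then show ?thesis by blast
qed

text \<open>The inverse of a bijective homomorphism is a homomorphism, so the inverse map that
  exists in \<open>Pos\<close> lifts to \<open>K\<close> by \<open>arrowI\<close>.\<close>

lemma alg_reflects_isos: "reflects_isos K Pos U"
  unfolding reflects_isos_def
proof (intro allI ballI impI)
  fix X Y f assume f: "f \<in> arrows K X Y" and iso: "is_iso Pos (ob U X) (ob U Y) (ar U f)"
  have X: "X \<in> Obj K" and Y: "Y \<in> Obj K" using arrows_Obj[OF f] by auto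
  note surj = iso_surj_reflecting(1)[OF f iso] and refl = iso_surj_reflecting(2)[OF f iso]
  let ?i = "inv_into (Field (und X)) (fn f)"
  have i: "?i y \<in> Field (und X)" "fn f (?i y) = y" if "y \<in> Field (und Y)" for y
    using that unfolding surj[symmetric] by (auto intro: inv_into_into f_inv_into_f)
  have inj: "x = y" if "x \<in> Field (und X)" "y \<in> Field (und X)" "fn f x = fn f y" for x y
  proof -
    have "(fn f x, fn f y) \<in> und Y" "(fn f y, fn f x) \<in> und Y"
      using that fn_closed[OF f] Partial_orderD(1)[OF und_order[OF Y]] by auto
    then show ?thesis using refl that Partial_orderD(3)[OF und_order[OF X]] by blast
  qed
  have "\<exists>g \<in> arrows K Y X. \<forall>y \<in> Field (und Y). fn g y = ?i y"
  proof (rule arrowI[OF Y X])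
    show "(?i x, ?i y) \<in> und X" if xy: "(x, y) \<in> und Y" for x y
      using refl[OF i(1)[OF FieldI1[OF xy]] i(1)[OF FieldI2[OF xy]]] i(2)[OF FieldI1[OF xy]] i(2)[OF FieldI2[OF xy]] xy by simp
    fix \<sigma> ys assume \<sigma>: "\<sigma> \<in> S (length ys)" and ys: "set ys \<subseteq> Field (und Y)"
    have 1: "set (map ?i ys) \<subseteq> Field (und X)" "\<sigma> \<in> S (length (map ?i ys))" using ys i(1) \<sigma> by auto
    have 2: "map (fn f) (map ?i ys) = ys" using ys i(2) by (induction ys) auto
    have "opr Y \<sigma> ys \<in> Field (und Y)" by (rule opr_closed[OF Y \<sigma> ys])
    moreover have "fn f (opr X \<sigma> (map ?i ys)) = opr Y \<sigma> ys" using fn_opr[OF f 1(2,1)] 2 by simp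
    ultimately show "?i (opr Y \<sigma> ys) = opr X \<sigma> (map ?i ys)"
      using inj i opr_closed[OF X 1(2,1)] by simp
  qed
  then obtain g where g: "g \<in> arrows K Y X" "\<And>y. y \<in> Field (und Y) \<Longrightarrow> fn g y = ?i y" by blast
  have "g \<odot> f = Idt K X"
    by (rule arrow_eqI[OF comp_arrow[OF f g(1)] id_arrow[OF X]])
      (use inj i fn_closed[OF f] in \<open>simp add: fn_comp[OF f g(1)] g(2) fn_id[OF X]\<close>)
  moreover have "f \<odot> g = Idt K Y"
    by (rule arrow_eqI[OF comp_arrow[OF g(1) f] id_arrow[OF Y]])
      (simp add: fn_comp[OF g(1) f] g(2) i fn_id[OF Y])
  ultimately show "is_iso K X Y f" unfolding is_iso_def using f g(1) by blast
qed

text \<open>The pairs with \<open>fn f x\<close> below \<open>fn f y\<close> are closed under the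
  operations because those of \<open>Y\<close> are monotone. The componentwise order is already
  antisymmetric; the quotient construction serves to turn pairs into elements of \<open>'u\<close>
  and the subalgebra into an object of \<open>K\<close>.\<close>

lemma alg_subkernel_pairs: "has_subkernel_pairs K"
  unfolding has_subkernel_pairs_def
proof (intro allI ballI)
  fix X Y f assume f: "f \<in> arrows K X Y"
  have X: "X \<in> Obj K" and Y: "Y \<in> Obj K" using arrows_Obj[OF f] by auto
  define M where "M = {(x, y). x \<in> Field (und X) \<and> y \<in> Field (und X) \<and> (fn f x, fn f y) \<in> und Y}"
  define le where "le a b \<longleftrightarrow> (fst a, fst b) \<in> und X \<and> (snd a, snd b) \<in> und X" for a b :: "'u \<times> 'u"
  define p where "p \<sigma> as = (opr X \<sigma> (map fst as), opr X \<sigma> (map snd as))" for \<sigma> and as :: "('u \<times> 'u) list"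
  have M_fst: "set (map fst as) \<subseteq> Field (und X)" "set (map snd as) \<subseteq> Field (und X)" if "set as \<subseteq> M" for as
    using that by (auto simp: M_def)
  have closed: "p \<sigma> as \<in> M" if \<sigma>: "\<sigma> \<in> S (length as)" and as: "set as \<subseteq> M" for \<sigma> as
  proof -
    have "list_all2 (\<lambda>x y. (x, y) \<in> und Y) (map (fn f) (map fst as)) (map (fn f) (map snd as))"
      using as by (auto simp: list_all2_map1 list_all2_map2 M_def intro!: list.rel_refl_strong)
    then have "(fn f (opr X \<sigma> (map fst as)), fn f (opr X \<sigma> (map snd as))) \<in> und Y"
      using opr_mono[OF Y, of \<sigma> "map (fn f) (map fst as)"] fn_opr[OF f, of \<sigma>] M_fst[OF as] \<sigma> by simp
    then show ?thesis
      using opr_closed[OF X] M_fst[OF as] \<sigma> by (auto simp: p_def M_def)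
  qed
  have pa: "preordered_algebra univ S M le p"
  proof unfold_locales
    have "sm (Field (und X))" using und_Obj[OF X] by (simp add: Obj_Pos small_iff_sm)
    then have "sm (Field (und X) \<times> Field (und X))" using sm_Sigma[of "Field (und X)" "\<lambda>_. Field (und X)"] by blast
    then show "sm M" by (rule sm_subset) (auto simp: M_def)
    show "le a a" if "a \<in> M" for a
      using that Partial_orderD(1)[OF und_order[OF X]] by (auto simp: le_def M_def)
    show "le a c" if "le a b" "le b c" for a b c
      using that Partial_orderD(2)[OF und_order[OF X]] unfolding le_def by blast
    show "p \<sigma> as \<in> M" if "\<sigma> \<in> S (length as)" "set as \<subseteq> M" for \<sigma> as using closed that .
    show "le (p \<sigma> as) (p \<sigma> bs)" if "\<sigma> \<in> S (length as)" "list_all2 le as bs" for \<sigma> as bs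
      using opr_mono[OF X, of \<sigma> "map fst as" "map fst bs"] opr_mono[OF X, of \<sigma> "map snd as" "map snd bs"] that(1)
        list_all2_mapI[OF that(2), of "\<lambda>x y. (x, y) \<in> und X" fst fst] list_all2_mapI[OF that(2), of "\<lambda>x y. (x, y) \<in> und X" snd snd]
      by (auto simp: le_def p_def)
  qed
  have "\<exists>T q. is_quotient M le p T q"
  proof (rule quotient_exists[OF pa])
    fix s t and v :: "nat \<Rightarrow> 'u \<times> 'u" assume st: "(s, t) \<in> \<Gamma>" and v: "range v \<subseteq> M"
    have 1: "fst (teval p v r) = teval (opr X) (\<lambda>n. fst (v n)) r" if "is_term S r" for r
      using teval_hom[OF that v, of p fst "opr X"] closed by (simp add: p_def)
    have 2: "snd (teval p v r) = teval (opr X) (\<lambda>n. snd (v n)) r" if "is_term S r" for r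
      using teval_hom[OF that v, of p snd "opr X"] closed by (simp add: p_def)
    have "range (\<lambda>n. fst (v n)) \<subseteq> Field (und X)" "range (\<lambda>n. snd (v n)) \<subseteq> Field (und X)"
      using v by (auto simp: M_def)
    then show "le (teval p v s) (teval p v t)"
      using opr_sat[OF X st] ineq_terms[OF st] 1 2 by (simp add: le_def)
  qed
  then obtain W q where q: "is_quotient M le p W q" by blast
  then have W: "W \<in> Obj K" and surj: "q ` M = Field (und W)"
    and ord: "\<And>x y. x \<in> M \<Longrightarrow> y \<in> M \<Longrightarrow> (q x, q y) \<in> und W \<longleftrightarrow> le x y"
    and ops: "\<And>f xs. f \<in> S (length xs) \<Longrightarrow> set xs \<subseteq> M \<Longrightarrow> q (p f xs) = opr W f (map q xs)"
    unfolding is_quotient_def by auto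
  have "\<exists>u \<in> arrows K W X. \<forall>a \<in> M. fn u (q a) = fst a"
    by (rule quotient_arrow[OF q X]) (auto simp: M_def le_def p_def)
  then obtain u where u: "u \<in> arrows K W X" "\<And>a. a \<in> M \<Longrightarrow> fn u (q a) = fst a" by blast
  have "\<exists>u \<in> arrows K W X. \<forall>a \<in> M. fn u (q a) = snd a"
    by (rule quotient_arrow[OF q X]) (auto simp: M_def le_def p_def)
  then obtain v where v: "v \<in> arrows K W X" "\<And>a. a \<in> M \<Longrightarrow> fn v (q a) = snd a" by blast
  have "is_subkernel_pair K X Y f W u v"
    unfolding is_subkernel_pair_def
  proof (intro conjI allI ballI impI)
    show "(f \<odot> u, f \<odot> v) \<in> Hom K W Y"
      unfolding Hom_iff[OF comp_arrow[OF u(1) f] comp_arrow[OF v(1) f]]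
    proof
      fix w assume w: "w \<in> Field (und W)"
      then obtain a where a: "a \<in> M" "w = q a" using surj by blast
      have "(fn f (fst a), fn f (snd a)) \<in> und Y" using a(1) by (auto simp: M_def)
      then show "(fn (f \<odot> u) w, fn (f \<odot> v) w) \<in> und Y"
        unfolding fn_comp[OF u(1) f w] fn_comp[OF v(1) f w] using a u(2) v(2) by simp
    qed
  next
    fix V v0 v1 assume v0: "v0 \<in> arrows K V X" and v1: "v1 \<in> arrows K V X"
      and le: "(f \<odot> v0, f \<odot> v1) \<in> Hom K V Y"
    have V: "V \<in> Obj K" using arrows_Obj[OF v0] by simp
    have M: "(fn v0 x, fn v1 x) \<in> M" if "x \<in> Field (und V)" for x
      using le that fn_closed[OF v0 that] fn_closed[OF v1 that]
      by (simp add: Hom_iff[OF comp_arrow[OF v0 f] comp_arrow[OF v1 f]] fn_comp[OF v0 f] fn_comp[OF v1 f] M_def)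
    have "\<exists>k \<in> arrows K V W. \<forall>x \<in> Field (und V). fn k x = q (fn v0 x, fn v1 x)"
    proof (rule arrowI[OF V W])
      show "(q (fn v0 x, fn v1 x), q (fn v0 y, fn v1 y)) \<in> und W" if xy: "(x, y) \<in> und V" for x y
        using ord[OF M[OF FieldI1[OF xy]] M[OF FieldI2[OF xy]]] fn_mono[OF v0 xy] fn_mono[OF v1 xy] by (simp add: le_def)
      fix \<sigma> xs assume \<sigma>: "\<sigma> \<in> S (length xs)" and xs: "set xs \<subseteq> Field (und V)"
      let ?as = "map (\<lambda>x. (fn v0 x, fn v1 x)) xs"
      have "set ?as \<subseteq> M" using xs M by auto
      then have "q (p \<sigma> ?as) = opr W \<sigma> (map q ?as)" using ops[of \<sigma> ?as] \<sigma> by simp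
      then show "q (fn v0 (opr V \<sigma> xs), fn v1 (opr V \<sigma> xs)) = opr W \<sigma> (map (\<lambda>x. q (fn v0 x, fn v1 x)) xs)"
        using fn_opr[OF v0 \<sigma> xs] fn_opr[OF v1 \<sigma> xs] by (simp add: p_def comp_def)
    qed
    then obtain k where k: "k \<in> arrows K V W" "\<And>x. x \<in> Field (und V) \<Longrightarrow> fn k x = q (fn v0 x, fn v1 x)" by blast
    have "v0 = u \<odot> k"
      by (rule arrow_eqI[OF v0 comp_arrow[OF k(1) u(1)]]) (simp add: fn_comp[OF k(1) u(1)] k(2) u(2) M)
    moreover have "v1 = v \<odot> k"
      by (rule arrow_eqI[OF v1 comp_arrow[OF k(1) v(1)]]) (simp add: fn_comp[OF k(1) v(1)] k(2) v(2) M)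
    ultimately show "\<exists>k \<in> arrows K V W. v0 = u \<odot> k \<and> v1 = v \<odot> k" using k(1) by blast
  next
    fix V k k' assume k: "k \<in> arrows K V W" and k': "k' \<in> arrows K V W"
      and le': "(u \<odot> k, u \<odot> k') \<in> Hom K V X \<and> (v \<odot> k, v \<odot> k') \<in> Hom K V X"
    show "(k, k') \<in> Hom K V W"
      unfolding Hom_iff[OF k k']
    proof
      fix x assume x: "x \<in> Field (und V)"
      obtain a b where ab: "a \<in> M" "fn k x = q a" "b \<in> M" "fn k' x = q b"
        using fn_closed[OF k x] fn_closed[OF k' x] surj by (metis imageE)
      have "(fn u (fn k x), fn u (fn k' x)) \<in> und X" "(fn v (fn k x), fn v (fn k' x)) \<in> und X"
        using le' x by (auto simp: Hom_iff[OF comp_arrow[OF k u(1)] comp_arrow[OF k' u(1)]] fn_comp[OF k u(1)] fn_comp[OF k' u(1)]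
          Hom_iff[OF comp_arrow[OF k v(1)] comp_arrow[OF k' v(1)]] fn_comp[OF k v(1)] fn_comp[OF k' v(1)])
      then show "(fn k x, fn k' x) \<in> und W" using ab u(2) v(2) ord by (simp add: le_def)
    qed
  qed (rule u v)+
  then show "\<exists>W u v. is_subkernel_pair K X Y f W u v" by blast
qed

end

section \<open>Tensors, reflexive coinserters and directed colimits of algebras\<close>

context algebraic
begin

text \<open>A generator \<open>(p, x)\<close> stands for \<open>x\<close> in the copy of
  \<open>X\<close> indexed by \<open>p\<close>. The relations make each copy a homomorphic image of
  \<open>X\<close> and let the copies increase with \<open>p\<close>, so arrows out of
  \<open>T\<close> are monotone families of arrows out of \<open>X\<close>.\<close>

lemma alg_tensors: "has_tensors (TYPE('u)) K"
  unfolding has_tensors_def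
proof (intro allI ballI impI, elim conjE)
  fix P :: "'u rel" and X assume X: "X \<in> Obj K" and P: "Partial_order P" and smP: "small (Field P)"
  let ?G = "Field P \<times> Field (und X)"
  \<comment> \<open>Relations are inequations, so the homomorphism law of each copy enters as two
    opposite pairs.\<close>
  define R :: "(('u, 'u \<times> 'u) gterm \<times> ('u, 'u \<times> 'u) gterm) set" where
    "R = {(GVar (p, x), GVar (q, y)) | p q x y. (p, q) \<in> P \<and> (x, y) \<in> und X} \<union>
      {(GApp \<sigma> (map (\<lambda>x. GVar (p, x)) xs), GVar (p, opr X \<sigma> xs)) | p \<sigma> xs.
        p \<in> Field P \<and> \<sigma> \<in> S (length xs) \<and> set xs \<subseteq> Field (und X)} \<union>
      {(GVar (p, opr X \<sigma> xs), GApp \<sigma> (map (\<lambda>x. GVar (p, x)) xs)) | p \<sigma> xs.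
        p \<in> Field P \<and> \<sigma> \<in> S (length xs) \<and> set xs \<subseteq> Field (und X)}"
  have "sm (Field (und X))" using und_Obj[OF X] by (simp add: Obj_Pos small_iff_sm)
  then have smG: "sm ?G" using sm_Sigma[of "Field P" "\<lambda>_. Field (und X)"] smP by (simp add: small_iff_sm)
  have "is_gterm S ?G s \<and> is_gterm S ?G t" if "(s, t) \<in> R" for s t
    using that opr_closed[OF X] unfolding R_def by (auto intro: FieldI1 FieldI2)
  then obtain T e where e: "is_presented ?G R T e"
    using presented_exists[OF smG] by blast
  have T: "T \<in> Obj K" by (rule is_presentedD(1)[OF e])
  have e_mono: "(e (p, x), e (q, y)) \<in> und T" if "(p, q) \<in> P" "(x, y) \<in> und X" for p q x y
    using is_presentedD(3)[OF e, of "GVar (p, x)" "GVar (q, y)"] that by (auto simp: R_def)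
  have e_hom: "e (p, opr X \<sigma> xs) = opr T \<sigma> (map (\<lambda>x. e (p, x)) xs)"
    if "p \<in> Field P" "\<sigma> \<in> S (length xs)" "set xs \<subseteq> Field (und X)" for p \<sigma> xs
  proof (rule Partial_orderD(3)[OF und_order[OF T]])
    let ?s = "GApp \<sigma> (map (\<lambda>x. GVar (p, x)) xs)" and ?t = "GVar (p, opr X \<sigma> xs)"
    have "(?s, ?t) \<in> R" "(?t, ?s) \<in> R" using that unfolding R_def by blast+
    then show "(e (p, opr X \<sigma> xs), opr T \<sigma> (map (\<lambda>x. e (p, x)) xs)) \<in> und T"
      "(opr T \<sigma> (map (\<lambda>x. e (p, x)) xs), e (p, opr X \<sigma> xs)) \<in> und T"
      using is_presentedD(3)[OF e, of ?s ?t] is_presentedD(3)[OF e, of ?t ?s] by (simp_all add: comp_def)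
  qed
  have FH: "Field (Hom K A B) = arrows K A B" if "A \<in> Obj K" "B \<in> Obj K" for A B
    using that by (auto simp: arrows_def)
  have mh: "h p \<in> arrows K X Y" if "Y \<in> Obj K" "h \<in> monotone_maps P (Hom K X Y)" "p \<in> Field P" for Y h p
    using monotone_mapsD(1)[OF that(2,3)] FH[OF X that(1)] by simp
  have ex: "\<exists>f \<in> arrows K T Y. \<forall>g \<in> ?G. fn f (e g) = fn (h (fst g)) (snd g)"
    if Y: "Y \<in> Obj K" and h: "h \<in> monotone_maps P (Hom K X Y)" for Y h
  proof (rule is_presentedD(4)[OF e Y])
    show "fn (h (fst g)) (snd g) \<in> Field (und Y)" if "g \<in> ?G" for g
      using that fn_closed[OF mh[OF Y h]] by auto
    have 1: "(fn (h p) x, fn (h q) y) \<in> und Y" if pq: "(p, q) \<in> P" and xy: "(x, y) \<in> und X" for p q x y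
    proof -
      have hp: "h p \<in> arrows K X Y" "h q \<in> arrows K X Y" using mh[OF Y h] pq by (auto intro: FieldI1 FieldI2)
      have "(h p, h q) \<in> Hom K X Y" by (rule monotone_mapsD(2)[OF h pq])
      then have "(fn (h p) x, fn (h q) x) \<in> und Y" using xy by (simp add: Hom_iff[OF hp] FieldI1)
      then show ?thesis using Partial_orderD(2)[OF und_order[OF Y]] fn_mono[OF hp(2) xy] by blast
    qed
    have 2: "opr Y \<sigma> (map (fn (h p)) xs) = fn (h p) (opr X \<sigma> xs)"
      "(fn (h p) (opr X \<sigma> xs), fn (h p) (opr X \<sigma> xs)) \<in> und Y"
      if "p \<in> Field P" "\<sigma> \<in> S (length xs)" "set xs \<subseteq> Field (und X)" for p \<sigma> xs
      using fn_opr[OF mh[OF Y h that(1)] that(2,3)] fn_closed[OF mh[OF Y h that(1)] opr_closed[OF X that(2,3)]]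
        Partial_orderD(1)[OF und_order[OF Y]] by simp_all
    show "(geval (opr Y) (\<lambda>g. fn (h (fst g)) (snd g)) s, geval (opr Y) (\<lambda>g. fn (h (fst g)) (snd g)) t) \<in> und Y"
      if "(s, t) \<in> R" for s t
      using that 1 2 unfolding R_def by (auto simp: comp_def)
  qed
  define \<phi> where "\<phi> Y h = (SOME f. f \<in> arrows K T Y \<and> (\<forall>g \<in> ?G. fn f (e g) = fn (h (fst g)) (snd g)))" for Y h
  have \<phi>: "\<phi> Y h \<in> arrows K T Y" "p \<in> Field P \<Longrightarrow> x \<in> Field (und X) \<Longrightarrow> fn (\<phi> Y h) (e (p, x)) = fn (h p) x"
    if "Y \<in> Obj K" "h \<in> monotone_maps P (Hom K X Y)" for Y h p x
  proof -
    have "\<exists>f. f \<in> arrows K T Y \<and> (\<forall>g \<in> ?G. fn f (e g) = fn (h (fst g)) (snd g))"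
      using ex[OF that] by blast
    from someI_ex[OF this] have *: "\<phi> Y h \<in> arrows K T Y \<and> (\<forall>g \<in> ?G. fn (\<phi> Y h) (e g) = fn (h (fst g)) (snd g))"
      unfolding \<phi>_def .
    then show "\<phi> Y h \<in> arrows K T Y" by blast
    show "fn (\<phi> Y h) (e (p, x)) = fn (h p) x" if "p \<in> Field P" "x \<in> Field (und X)"
      using * that by auto
  qed
  have uniq: "f = f'" if f: "f \<in> arrows K T Y" and f': "f' \<in> arrows K T Y"
    and eq: "\<And>p x. p \<in> Field P \<Longrightarrow> x \<in> Field (und X) \<Longrightarrow> fn f (e (p, x)) = fn f' (e (p, x))" for Y f f'
  proof -
    have Y: "Y \<in> Obj K" using arrows_Obj[OF f] by simp
    have "(fn f (e g), fn f' (e g)) \<in> und Y \<and> (fn f' (e g), fn f (e g)) \<in> und Y" if "g \<in> ?G" for g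
      using eq[of "fst g" "snd g"] that Partial_orderD(1)[OF und_order[OF Y] fn_closed[OF f' is_presentedD(2)[OF e that]]]
      by auto
    then have "(f, f') \<in> Hom K T Y" "(f', f) \<in> Hom K T Y"
      using is_presentedD(5)[OF e f f'] is_presentedD(5)[OF e f' f] by auto
    then show ?thesis using Partial_orderD(3)[OF hom_poset[OF T Y]] by blast
  qed
  have iso: "poset_iso (map_poset P (Hom K X Y)) (Hom K T Y) (\<phi> Y)" if Y: "Y \<in> Obj K" for Y
  proof -
    have ord: "(h, h') \<in> map_poset P (Hom K X Y) \<longleftrightarrow> (\<phi> Y h, \<phi> Y h') \<in> Hom K T Y"
      if h: "h \<in> monotone_maps P (Hom K X Y)" and h': "h' \<in> monotone_maps P (Hom K X Y)" for h h'
    proof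
      assume "(h, h') \<in> map_poset P (Hom K X Y)"
      then have le: "(h p, h' p) \<in> Hom K X Y" if "p \<in> Field P" for p using that by (auto simp: map_poset_def)
      show "(\<phi> Y h, \<phi> Y h') \<in> Hom K T Y"
      proof (rule is_presentedD(5)[OF e \<phi>(1)[OF Y h] \<phi>(1)[OF Y h']])
        fix g assume "g \<in> ?G"
        then obtain p x where g: "g = (p, x)" "p \<in> Field P" "x \<in> Field (und X)" by auto
        then show "(fn (\<phi> Y h) (e g), fn (\<phi> Y h') (e g)) \<in> und Y"
          using le[OF g(2)] by (simp add: \<phi>(2)[OF Y h] \<phi>(2)[OF Y h'] Hom_iff[OF mh[OF Y h] mh[OF Y h']])
      qed
    next
      assume le: "(\<phi> Y h, \<phi> Y h') \<in> Hom K T Y"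
      have "(h p, h' p) \<in> Hom K X Y" if p: "p \<in> Field P" for p
        unfolding Hom_iff[OF mh[OF Y h p] mh[OF Y h' p]]
      proof
        fix x assume x: "x \<in> Field (und X)"
        have "e (p, x) \<in> Field (und T)" using is_presentedD(2)[OF e] p x by simp
        then have "(fn (\<phi> Y h) (e (p, x)), fn (\<phi> Y h') (e (p, x))) \<in> und Y"
          using le Hom_iff[OF \<phi>(1)[OF Y h] \<phi>(1)[OF Y h']] by simp
        then show "(fn (h p) x, fn (h' p) x) \<in> und Y" using \<phi>(2)[OF Y h p x] \<phi>(2)[OF Y h' p x] by simp
      qed
      then show "(h, h') \<in> map_poset P (Hom K X Y)" using h h' by (simp add: map_poset_def)
    qed
    have inj: "inj_on (\<phi> Y) (monotone_maps P (Hom K X Y))"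
    proof (rule inj_onI)
      fix h h' assume h: "h \<in> monotone_maps P (Hom K X Y)" "h' \<in> monotone_maps P (Hom K X Y)" and eq: "\<phi> Y h = \<phi> Y h'"
      have "(\<phi> Y h, \<phi> Y h) \<in> Hom K T Y" by (rule arrow_refl[OF \<phi>(1)[OF Y h(1)]])
      then have "(h, h') \<in> map_poset P (Hom K X Y)" "(h', h) \<in> map_poset P (Hom K X Y)"
        using ord h eq by auto
      then show "h = h'" using Partial_orderD(3)[OF Partial_order_map_poset[OF hom_poset[OF X Y]]] by blast
    qed
    have "f \<in> \<phi> Y ` monotone_maps P (Hom K X Y)" if f: "f \<in> arrows K T Y" for f
    proof -
      have "\<exists>a \<in> arrows K X Y. \<forall>x \<in> Field (und X). fn a x = fn f (e (p, x))" if p: "p \<in> Field P" for p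
      proof (rule arrowI[OF X Y])
        show "(fn f (e (p, x)), fn f (e (p, y))) \<in> und Y" if "(x, y) \<in> und X" for x y
          using fn_mono[OF f] e_mono[OF Partial_orderD(1)[OF P p] that] by blast
        fix \<sigma> xs assume \<sigma>: "\<sigma> \<in> S (length xs)" and xs: "set xs \<subseteq> Field (und X)"
        have "set (map (\<lambda>x. e (p, x)) xs) \<subseteq> Field (und T)" using is_presentedD(2)[OF e] p xs by auto
        then show "fn f (e (p, opr X \<sigma> xs)) = opr Y \<sigma> (map (\<lambda>x. fn f (e (p, x))) xs)"
          using fn_opr[OF f, of \<sigma> "map (\<lambda>x. e (p, x)) xs"] \<sigma> e_hom[OF p \<sigma> xs] by (simp add: comp_def)
      qed
      then obtain a where a: "\<And>p. p \<in> Field P \<Longrightarrow> a p \<in> arrows K X Y"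
        "\<And>p x. p \<in> Field P \<Longrightarrow> x \<in> Field (und X) \<Longrightarrow> fn (a p) x = fn f (e (p, x))" by metis
      have h: "restrict a (Field P) \<in> monotone_maps P (Hom K X Y)"
      proof (rule monotone_mapsI)
        fix p q assume pq: "(p, q) \<in> P"
        have F: "p \<in> Field P" "q \<in> Field P" using pq by (auto intro: FieldI1 FieldI2)
        show "(a p, a q) \<in> Hom K X Y"
          unfolding Hom_iff[OF a(1)[OF F(1)] a(1)[OF F(2)]]
        proof
          fix x assume x: "x \<in> Field (und X)"
          show "(fn (a p) x, fn (a q) x) \<in> und Y"
            using a(2)[OF F(1) x] a(2)[OF F(2) x] fn_mono[OF f e_mono[OF pq Partial_orderD(1)[OF und_order[OF X] x]]] by simp
        qed
      qed
      have "f = \<phi> Y (restrict a (Field P))"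
        by (rule uniq[OF f \<phi>(1)[OF Y h]]) (simp add: \<phi>(2)[OF Y h] a(2))
      then show ?thesis using h by blast
    qed
    then have "\<phi> Y ` monotone_maps P (Hom K X Y) = arrows K T Y" using \<phi>(1)[OF Y] by blast
    then show ?thesis
      unfolding poset_iso_def Field_map_poset[OF hom_poset[OF X Y]] FH[OF T Y] bij_betw_def using inj ord by blast
  qed
  have "is_tensor K P X T"
    unfolding is_tensor_def
  proof (intro conjI exI[of _ \<phi>] ballI allI T iso)
    fix Y Z g h assume g: "g \<in> arrows K Y Z" and h: "h \<in> monotone_maps P (Hom K X Y)"
    have Y: "Y \<in> Obj K" and Z: "Z \<in> Obj K" using arrows_Obj[OF g] by auto
    let ?h = "\<lambda>p \<in> Field P. g \<odot> h p"
    have h': "?h \<in> monotone_maps P (Hom K X Z)"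
      by (rule monotone_mapsI) (use comp_mono[OF X Y Z _ arrow_refl[OF g]] monotone_mapsD(2)[OF h] in blast)
    show "\<phi> Z ?h = g \<odot> \<phi> Y h"
    proof (rule uniq[OF \<phi>(1)[OF Z h'] comp_arrow[OF \<phi>(1)[OF Y h] g]])
      fix p x assume p: "p \<in> Field P" and x: "x \<in> Field (und X)"
      have ep: "e (p, x) \<in> Field (und T)" using is_presentedD(2)[OF e] p x by simp
      show "fn (\<phi> Z ?h) (e (p, x)) = fn (g \<odot> \<phi> Y h) (e (p, x))"
        using p x by (simp add: \<phi>(2)[OF Z h'] fn_comp[OF \<phi>(1)[OF Y h] g ep] \<phi>(2)[OF Y h] fn_comp[OF mh[OF Y h p] g x])
    qed
  qed
  then show "\<exists>T. is_tensor K P X T" by blast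
qed

text \<open>
  For a reflexive pair the relation \<open>x \<le> u w, v w \<le> y\<close> is reflexive and compatible with the
  operations, and so is its transitive closure: hence the coinserter in \<open>K\<close> is carried by the
  one in \<open>Pos\<close>.
\<close>

lemma reflexive_coinserter_exists:
  assumes rp: "reflexive_pair K W X u v"
  shows "\<exists>Y f. is_coinserter K W X u v Y f \<and> fn f ` Field (und X) = Field (und Y) \<and>
    (\<forall>x \<in> Field (und X). \<forall>y \<in> Field (und X). (fn f x, fn f y) \<in> und Y \<longrightarrow>
      (x, y) \<in> coinserter_rel (und W) (und X) (fn u) (fn v))"
proof -
  obtain d where u: "u \<in> arrows K W X" and v: "v \<in> arrows K W X" and d: "d \<in> arrows K X W"
    and ud: "u \<odot> d = Idt K X" and vd: "v \<odot> d = Idt K X"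
    using rp unfolding reflexive_pair_def by blast
  have X: "X \<in> Obj K" and W: "W \<in> Obj K" using arrows_Obj[OF u] by auto
  note oX = Partial_orderD[OF und_order[OF X]]
  define r where "r = {(x, y). \<exists>w \<in> Field (und W). (x, fn u w) \<in> und X \<and> (fn v w, y) \<in> und X}"
  define Q where "Q = coinserter_rel (und W) (und X) (fn u) (fn v)"
  have rX: "r \<subseteq> Field (und X) \<times> Field (und X)" by (auto simp: r_def intro: FieldI1 FieldI2)
  \<comment> \<open>Here the common section enters: the witness \<open>fn d x\<close> gives a step
    from \<open>x\<close> to itself, which the order of \<open>X\<close> extends to any pair above
    it.\<close>
  have r_und: "und X \<subseteq> r"
  proof
    fix z assume z: "z \<in> und X"
    obtain x y where xy: "z = (x, y)" by force
    have x: "x \<in> Field (und X)" using z xy by (simp add: FieldI1)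
    have "fn u (fn d x) = x" "fn v (fn d x) = x"
      using fn_comp[OF d u x] fn_comp[OF d v x] ud vd fn_id[OF X x] by auto
    then show "z \<in> r" using oX(1)[OF x] fn_closed[OF d x] z by (auto simp: r_def xy intro!: bexI[of _ "fn d x"])
  qed
  have r_uv: "(fn u w, fn v w) \<in> r" if "w \<in> Field (und W)" for w
    using that oX(1)[OF fn_closed[OF u that]] oX(1)[OF fn_closed[OF v that]] by (auto simp: r_def)
  have r_refl: "(x, x) \<in> r" if "x \<in> Field (und X)" for x using oX(1)[OF that] r_und by blast
  have Qr: "Q = r\<^sup>*"
  proof
    show "Q \<subseteq> r\<^sup>*" unfolding Q_def using r_und r_uv by (intro rtrancl_mono) auto
    have "r \<subseteq> Q"
    proof
      fix z assume "z \<in> r"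
      then obtain x y w where z: "z = (x, y)" "w \<in> Field (und W)" "(x, fn u w) \<in> und X" "(fn v w, y) \<in> und X"
        by (auto simp: r_def)
      let ?R = "und X \<union> {(fn u w, fn v w) | w. w \<in> Field (und W)}"
      have "(x, fn u w) \<in> ?R" "(fn u w, fn v w) \<in> ?R" "(fn v w, y) \<in> ?R" using z by auto
      then have "(x, y) \<in> ?R\<^sup>*" by (intro rtrancl_into_rtrancl[OF rtrancl_into_rtrancl[OF r_into_rtrancl]])
      then show "z \<in> Q" by (simp add: z(1) Q_def)
    qed
    then show "r\<^sup>* \<subseteq> Q" unfolding Q_def using rtrancl_subset_rtrancl by blast
  qed
  have r_hom: "(opr X \<sigma> xs, opr X \<sigma> ys) \<in> r"
    if \<sigma>: "\<sigma> \<in> S (length xs)" and xy: "list_all2 (\<lambda>x y. (x, y) \<in> r) xs ys" for \<sigma> xs ys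
  proof -
    \<comment> \<open>The witnesses for the entries form a list in \<open>W\<close>. Applying the
      operation to it there gives the witness for the result, since \<open>u\<close> and
      \<open>v\<close> are homomorphisms.\<close>
    have "\<exists>ws. set ws \<subseteq> Field (und W) \<and> list_all2 (\<lambda>x w. (x, fn u w) \<in> und X) xs ws \<and>
        list_all2 (\<lambda>w y. (fn v w, y) \<in> und X) ws ys"
      using xy
    proof (induction rule: list_all2_induct)
      case (Cons x xs y ys)
      then obtain w ws where "w \<in> Field (und W)" "(x, fn u w) \<in> und X" "(fn v w, y) \<in> und X"
        "set ws \<subseteq> Field (und W)" "list_all2 (\<lambda>x w. (x, fn u w) \<in> und X) xs ws"
        "list_all2 (\<lambda>w y. (fn v w, y) \<in> und X) ws ys" by (auto simp: r_def)
      then show ?case by (intro exI[of _ "w # ws"]) simp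
    qed simp
    then obtain ws where ws: "set ws \<subseteq> Field (und W)" "list_all2 (\<lambda>x w. (x, fn u w) \<in> und X) xs ws"
      "list_all2 (\<lambda>w y. (fn v w, y) \<in> und X) ws ys" by blast
    have l: "length ws = length xs" using ws(2) by (simp add: list_all2_lengthD)
    have "(opr X \<sigma> xs, opr X \<sigma> (map (fn u) ws)) \<in> und X" "(opr X \<sigma> (map (fn v) ws), opr X \<sigma> ys) \<in> und X"
      using opr_mono[OF X, of \<sigma> xs "map (fn u) ws"] opr_mono[OF X, of \<sigma> "map (fn v) ws" ys] ws \<sigma> l
      by (auto simp: list_all2_map1 list_all2_map2)
    then show ?thesis
      using fn_opr[OF u, of \<sigma> ws] fn_opr[OF v, of \<sigma> ws] opr_closed[OF W, of \<sigma> ws] ws(1) \<sigma> l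
      by (auto simp: r_def intro!: bexI[of _ "opr W \<sigma> ws"])
  qed
  have Q_hom: "(opr X \<sigma> xs, opr X \<sigma> ys) \<in> Q"
    if \<sigma>: "\<sigma> \<in> S (length xs)" and xs: "set xs \<subseteq> Field (und X)" and xy: "list_all2 (\<lambda>x y. (x, y) \<in> Q) xs ys" for \<sigma> xs ys
  proof -
    have "(xs, ys) \<in> {(us, vs). list_all2 (\<lambda>x y. (x, y) \<in> r) us vs}\<^sup>*"
      by (rule list_all2_rtrancl[OF _ xs rX r_refl]) (use xy in \<open>simp add: Qr\<close>)
    then have "(opr X \<sigma> xs, opr X \<sigma> ys) \<in> r\<^sup>* \<and> length ys = length xs"
    proof (induction rule: rtrancl_induct)
      case (step us vs)
      then have "list_all2 (\<lambda>x y. (x, y) \<in> r) us vs" by simp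
      then have "(opr X \<sigma> us, opr X \<sigma> vs) \<in> r" "length vs = length us"
        using r_hom[of \<sigma> us vs] step.IH \<sigma> by (auto dest: list_all2_lengthD)
      then show ?case using step.IH by (auto intro: rtrancl_into_rtrancl)
    qed simp
    then show ?thesis by (simp add: Qr)
  qed
  let ?le = "\<lambda>x y. (x, y) \<in> Q"
  have und_Q: "und X \<subseteq> Q" unfolding Q_def by (auto intro: r_into_rtrancl)
  have pa: "preordered_algebra univ S (Field (und X)) ?le (opr X)"
  proof unfold_locales
    show "sm (Field (und X))" using und_Obj[OF X] by (simp add: Obj_Pos small_iff_sm)
    show "?le x x" for x by (simp add: Q_def)
    show "?le x z" if "?le x y" "?le y z" for x y z using that unfolding Q_def by (rule rtrancl_trans)
  qed (use opr_closed[OF X] Q_hom in auto)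
  have "\<exists>T q. is_quotient (Field (und X)) ?le (opr X) T q"
    by (rule quotient_exists[OF pa]) (use opr_sat[OF X] und_Q in blast)
  then obtain Y q where q: "is_quotient (Field (und X)) ?le (opr X) Y q" by blast
  then have Y: "Y \<in> Obj K" and surj: "q ` Field (und X) = Field (und Y)"
    and ord: "\<And>x y. x \<in> Field (und X) \<Longrightarrow> y \<in> Field (und X) \<Longrightarrow> (q x, q y) \<in> und Y \<longleftrightarrow> (x, y) \<in> Q"
    and ops: "\<And>f xs. f \<in> S (length xs) \<Longrightarrow> set xs \<subseteq> Field (und X) \<Longrightarrow> q (opr X f xs) = opr Y f (map q xs)"
    unfolding is_quotient_def by auto
  have "\<exists>f \<in> arrows K X Y. \<forall>x \<in> Field (und X). fn f x = q x"
  proof (rule arrowI[OF X Y])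
    show "(q x, q y) \<in> und Y" if "(x, y) \<in> und X" for x y
      using ord[OF FieldI1[OF that] FieldI2[OF that]] und_Q that by blast
  qed (rule ops)
  then obtain f where f: "f \<in> arrows K X Y" and fq: "\<And>x. x \<in> Field (und X) \<Longrightarrow> fn f x = q x" by blast
  have surj': "fn f ` Field (und X) = Field (und Y)" using surj fq by simp
  have ord': "(fn f x, fn f y) \<in> und Y \<longleftrightarrow> (x, y) \<in> Q" if "x \<in> Field (und X)" "y \<in> Field (und X)" for x y
    using ord[OF that] fq that by simp
  have "is_coinserter K W X u v Y f"
    unfolding is_coinserter_def
  proof (intro conjI allI ballI impI f)
    show "(f \<odot> u, f \<odot> v) \<in> Hom K W Y"
      unfolding Hom_iff[OF comp_arrow[OF u f] comp_arrow[OF v f]]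
    proof
      fix w assume w: "w \<in> Field (und W)"
      have "(fn u w, fn v w) \<in> Q" using r_uv[OF w] by (simp add: Qr r_into_rtrancl)
      then show "(fn (f \<odot> u) w, fn (f \<odot> v) w) \<in> und Y"
        using ord' fn_closed[OF u w] fn_closed[OF v w] by (simp add: fn_comp[OF u f w] fn_comp[OF v f w])
    qed
  next
    fix Z g assume g: "g \<in> arrows K X Z" and le: "(g \<odot> u, g \<odot> v) \<in> Hom K W Z"
    have Z: "Z \<in> Obj K" using arrows_Obj[OF g] by simp
    have guv: "(fn g (fn u w), fn g (fn v w)) \<in> und Z" if w: "w \<in> Field (und W)" for w
      using le w by (simp add: Hom_iff[OF comp_arrow[OF u g] comp_arrow[OF v g]] fn_comp[OF u g] fn_comp[OF v g])
    have gQ: "(fn g x, fn g y) \<in> und Z" if "(x, y) \<in> Q" "x \<in> Field (und X)" for x y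
    proof (rule rtrancl_map_mono[OF that(1)[unfolded Q_def] that(2)])
      show "und X \<union> {(fn u w, fn v w) | w. w \<in> Field (und W)} \<subseteq> Field (und X) \<times> Field (und X)"
        using fn_closed[OF u] fn_closed[OF v] by (auto intro: FieldI1 FieldI2)
      show "(fn g a, fn g a) \<in> und Z" if "a \<in> Field (und X)" for a
        using Partial_orderD(1)[OF und_order[OF Z] fn_closed[OF g that]] .
      show "trans (und Z)" using Partial_orderD(2)[OF und_order[OF Z]] by (rule transI)
      show "(fn g a, fn g b) \<in> und Z" if "(a, b) \<in> und X \<union> {(fn u w, fn v w) | w. w \<in> Field (und W)}" for a b
        using that fn_mono[OF g] guv by blast
    qed
    have "\<exists>k \<in> arrows K Y Z. \<forall>x \<in> Field (und X). fn k (q x) = fn g x"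
      by (rule quotient_arrow[OF q Z]) (use fn_closed[OF g] gQ fn_opr[OF g] in auto)
    then obtain k where k: "k \<in> arrows K Y Z" "\<And>x. x \<in> Field (und X) \<Longrightarrow> fn k (q x) = fn g x" by blast
    have "g = k \<odot> f"
      by (rule arrow_eqI[OF g comp_arrow[OF f k(1)]]) (simp add: fn_comp[OF f k(1)] fq k(2))
    then show "\<exists>k \<in> arrows K Y Z. g = k \<odot> f" using k(1) by blast
  next
    fix Z g g' assume g: "g \<in> arrows K Y Z" and g': "g' \<in> arrows K Y Z" and le: "(g \<odot> f, g' \<odot> f) \<in> Hom K X Z"
    show "(g, g') \<in> Hom K Y Z"
      unfolding Hom_iff[OF g g'] surj'[symmetric]
      using le by (auto simp: Hom_iff[OF comp_arrow[OF f g] comp_arrow[OF f g']] fn_comp[OF f g] fn_comp[OF f g'])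
  qed
  then show ?thesis using surj' ord' unfolding Q_def by blast
qed

lemma alg_reflexive_coinserters: "has_reflexive_coinserters K"
  unfolding has_reflexive_coinserters_def using reflexive_coinserter_exists by blast

text \<open>Coinserters are unique up to isomorphism, so the given one is compared with the one
  whose underlying map is known. The identity \<open>k \<odot> g = Idt K Y\<close> transfers
  surjectivity to \<open>Y\<close>, and monotonicity of \<open>g\<close> transfers the description
  of the order.\<close>

lemma alg_preserves_reflexive_coinserters: "preserves_reflexive_coinserters K Pos U"
  unfolding preserves_reflexive_coinserters_def
proof (intro allI impI, elim conjE)
  fix W X u v Y f assume rp: "reflexive_pair K W X u v" and co: "is_coinserter K W X u v Y f"
  have u: "u \<in> arrows K W X" and v: "v \<in> arrows K W X" using rp by (auto simp: reflexive_pair_def)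
  have f: "f \<in> arrows K X Y" and fuv: "(f \<odot> u, f \<odot> v) \<in> Hom K W Y" using co by (auto simp: is_coinserter_def)
  have X: "X \<in> Obj K" and W: "W \<in> Obj K" and Y: "Y \<in> Obj K" using arrows_Obj[OF u] arrows_Obj[OF f] by auto
  obtain Z h where co': "is_coinserter K W X u v Z h" and surj: "fn h ` Field (und X) = Field (und Z)"
    and ord: "\<forall>x \<in> Field (und X). \<forall>y \<in> Field (und X). (fn h x, fn h y) \<in> und Z \<longrightarrow>
      (x, y) \<in> coinserter_rel (und W) (und X) (fn u) (fn v)"
    using reflexive_coinserter_exists[OF rp] by (elim exE conjE)
  have h: "h \<in> arrows K X Z" and huv: "(h \<odot> u, h \<odot> v) \<in> Hom K W Z" using co' by (auto simp: is_coinserter_def)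
  obtain g where g: "g \<in> arrows K Y Z" "h = g \<odot> f" using co h huv unfolding is_coinserter_def by blast
  obtain k where k: "k \<in> arrows K Z Y" "f = k \<odot> h" using co' f fuv unfolding is_coinserter_def by blast
  have kgf: "(k \<odot> g) \<odot> f = Idt K Y \<odot> f"
    unfolding comp_assoc[OF f g(1) k(1)] g(2)[symmetric] k(2)[symmetric] id_comp[OF f] ..
  have canc: "(a, b) \<in> Hom K Y Y" if "a \<in> arrows K Y Y" "b \<in> arrows K Y Y" "(a \<odot> f, b \<odot> f) \<in> Hom K X Y" for a b
    using co that unfolding is_coinserter_def by blast
  have "(k \<odot> g, Idt K Y) \<in> Hom K Y Y" "(Idt K Y, k \<odot> g) \<in> Hom K Y Y"
    by (rule canc, (simp_all only: kgf comp_arrow[OF g(1) k(1)] id_arrow[OF Y] arrow_refl[OF comp_arrow[OF f id_arrow[OF Y]]]))+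
  then have kg: "k \<odot> g = Idt K Y" using Partial_orderD(3)[OF hom_poset[OF Y Y]] by blast
  have "fn f ` Field (und X) = Field (und Y)"
  proof (intro equalityI subsetI)
    fix y assume y: "y \<in> Field (und Y)"
    have "fn g y \<in> fn h ` Field (und X)" unfolding surj by (rule fn_closed[OF g(1) y])
    then obtain x where x: "x \<in> Field (und X)" "fn g y = fn h x" by blast
    have "y = fn k (fn g y)" using fn_comp[OF g(1) k(1) y] kg fn_id[OF Y y] by simp
    also have "\<dots> = fn f x" using x fn_comp[OF h k(1) x(1)] k(2) by simp
    finally show "y \<in> fn f ` Field (und X)" using x(1) by blast
  qed (use fn_closed[OF f] in blast)
  moreover have "(x, y) \<in> coinserter_rel (und W) (und X) (fn u) (fn v)"
    if "x \<in> Field (und X)" "y \<in> Field (und X)" "(fn f x, fn f y) \<in> und Y" for x y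
  proof (rule ord[rule_format, OF that(1,2)])
    show "(fn h x, fn h y) \<in> und Z"
      using fn_mono[OF g(1) that(3)] fn_comp[OF f g(1) that(1)] fn_comp[OF f g(1) that(2)] g(2) by simp
  qed
  moreover have "(fn f (fn u w), fn f (fn v w)) \<in> und Y" if w: "w \<in> Field (und W)" for w
    using fuv w by (simp add: Hom_iff[OF comp_arrow[OF u f] comp_arrow[OF v f]] fn_comp[OF u f] fn_comp[OF v f])
  ultimately show "is_coinserter Pos (und W) (und X) (ar U u) (ar U v) (und Y) (ar U f)"
    unfolding ar_U(1)[OF u] ar_U(1)[OF v] ar_U(1)[OF f]
    by (intro pos_coinserterI und_Obj W X Y ar_U(2)[OF u] ar_U(2)[OF v] ar_U(2)[OF f])
qed

text \<open>Elements of the algebra of stages are pairs of an index and an element of that stage,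
  compared at late enough stages; an operation is computed at a common bound of its finitely many
  arguments. The quotient \<open>Q\<close> receives an arrow from the given colimit \<open>C\<close>
  by the universal property, and \<open>C\<close> turns out to be a retract of \<open>Q\<close>.
  This suffices to describe \<open>C\<close> by stages.\<close>

lemma alg_finitary: "finitary (TYPE('u)) K Pos U"
  unfolding finitary_def
proof (intro allI impI, elim conjE)
  fix I :: "'u rel" and D d C c
  assume dir: "directed_poset I" and smI: "small (Field I)" and dia: "is_diagram K I D d" and col: "is_colimit K I D d C c"
  have DO: "D i \<in> Obj K" and dId: "d i i = Idt K (D i)" if "i \<in> Field I" for i
    using dia that by (auto simp: is_diagram_def)
  have dA: "d i j \<in> arrows K (D i) (D j)" if "(i, j) \<in> I" for i j
    using dia that by (auto simp: is_diagram_def)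
  have dC: "d i k = d j k \<odot> d i j" if "(i, j) \<in> I" "(j, k) \<in> I" for i j k
    using dia that unfolding is_diagram_def by blast
  have cc: "is_cocone K I D d C c" using col by (simp add: is_colimit_def)
  have C: "C \<in> Obj K" using cc by (simp add: is_cocone_def)
  have cA: "c i \<in> arrows K (D i) C" if "i \<in> Field I" for i using cc that by (auto simp: is_cocone_def)
  have cd: "c j \<odot> d i j = c i" if "(i, j) \<in> I" for i j using cc that by (auto simp: is_cocone_def)
  have PI: "Partial_order I" and Ine: "Field I \<noteq> {}" using dir by (auto simp: directed_poset_def)
  note I_trans = Partial_orderD(2)[OF PI] and I_refl = Partial_orderD(1)[OF PI]
  have ub: "\<exists>k \<in> Field I. \<forall>i \<in> A. (i, k) \<in> I" if "finite A" "A \<subseteq> Field I" for A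
    using that
  proof (induction rule: finite_induct)
    case empty
    then show ?case using Ine by blast
  next
    case (insert i A)
    then obtain k where k: "k \<in> Field I" "\<forall>j \<in> A. (j, k) \<in> I" by auto
    obtain l where "(i, l) \<in> I" "(k, l) \<in> I" using dir insert.prems k(1) unfolding directed_poset_def by blast
    then show ?case using k I_trans by (intro bexI[of _ l]) (auto intro: FieldI2)
  qed
  have ub2: "\<exists>k \<in> Field I. (i, k) \<in> I \<and> (j, k) \<in> I" if "i \<in> Field I" "j \<in> Field I" for i j
    using ub[of "{i, j}"] that by auto
  define M where "M = Sigma (Field I) (\<lambda>i. Field (und (D i)))"
  define tr where "tr k a = fn (d (fst a) k) (snd a)" for k and a :: "'u \<times> 'u"
  define le where "le a b \<longleftrightarrow> (\<exists>k. (fst a, k) \<in> I \<and> (fst b, k) \<in> I \<and> (tr k a, tr k b) \<in> und (D k))" for a b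
  \<comment> \<open>A bound for the stages of the entries; by \<open>tr_p\<close> another bound
    would give the same result up to \<open>le\<close>. For the empty list it is an arbitrary index,
    which exists because directed posets are nonempty.\<close>
  define bd where "bd as = (SOME k. k \<in> Field I \<and> (\<forall>a \<in> set as. (fst a, k) \<in> I))" for as :: "('u \<times> 'u) list"
  define p where "p \<sigma> as = (bd as, opr (D (bd as)) \<sigma> (map (tr (bd as)) as))" for \<sigma> as
  have M_fst: "fst a \<in> Field I" "snd a \<in> Field (und (D (fst a)))" if "a \<in> M" for a using that by (auto simp: M_def)
  have bd: "bd as \<in> Field I" "a \<in> set as \<Longrightarrow> (fst a, bd as) \<in> I" if "set as \<subseteq> M" for as a
  proof -
    have "fst ` set as \<subseteq> Field I" using that M_fst(1) by blast
    from ub[OF _ this] have "\<exists>k. k \<in> Field I \<and> (\<forall>a \<in> set as. (fst a, k) \<in> I)" by auto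
    from someI_ex[OF this] show "bd as \<in> Field I" "a \<in> set as \<Longrightarrow> (fst a, bd as) \<in> I" by (auto simp: bd_def)
  qed
  have trc: "tr k a \<in> Field (und (D k))" if "a \<in> M" "(fst a, k) \<in> I" for a k
    using fn_closed[OF dA[OF that(2)] M_fst(2)[OF that(1)]] by (simp add: tr_def)
  have trtr: "fn (d k l) (tr k a) = tr l a" if "a \<in> M" "(fst a, k) \<in> I" "(k, l) \<in> I" for a k l
    using fn_comp[OF dA[OF that(2)] dA[OF that(3)] M_fst(2)[OF that(1)]] dC[OF that(2,3)] by (simp add: tr_def)
  have up: "(tr l a, tr l b) \<in> und (D l)"
    if "a \<in> M" "b \<in> M" "(fst a, k) \<in> I" "(fst b, k) \<in> I" "(tr k a, tr k b) \<in> und (D k)" "(k, l) \<in> I" for a b k l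
    using fn_mono[OF dA[OF that(6)] that(5)] trtr[OF that(1,3,6)] trtr[OF that(2,4,6)] by simp
  have le_eq: "le a b" if "a \<in> M" "b \<in> M" "(fst a, k) \<in> I" "(fst b, k) \<in> I" "tr k a = tr k b" for a b k
    using that trc[OF that(2,4)] Partial_orderD(1)[OF und_order[OF DO[OF FieldI2[OF that(3)]]]]
    unfolding le_def by (intro exI[of _ k]) simp
  have pM: "p \<sigma> as \<in> M" if "\<sigma> \<in> S (length as)" "set as \<subseteq> M" for \<sigma> as
  proof -
    have "set (map (tr (bd as)) as) \<subseteq> Field (und (D (bd as)))"
      using trc bd(2)[OF that(2)] that(2) by auto
    then show ?thesis using opr_closed[OF DO[OF bd(1)[OF that(2)]], of \<sigma>] bd(1)[OF that(2)] that(1)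
      by (simp add: p_def M_def)
  qed
  have tr_p: "tr l (p \<sigma> as) = opr (D l) \<sigma> (map (tr l) as)"
    if \<sigma>: "\<sigma> \<in> S (length as)" and as: "set as \<subseteq> M" and l: "(bd as, l) \<in> I" for \<sigma> as l
  proof -
    have "set (map (tr (bd as)) as) \<subseteq> Field (und (D (bd as)))"
      using trc bd(2)[OF as] as by auto
    then have "tr l (p \<sigma> as) = opr (D l) \<sigma> (map (fn (d (bd as) l)) (map (tr (bd as)) as))"
      using fn_opr[OF dA[OF l], of \<sigma> "map (tr (bd as)) as"] \<sigma> by (simp add: tr_def p_def)
    also have "map (fn (d (bd as) l)) (map (tr (bd as)) as) = map (tr l) as"
      using trtr[OF _ _ l] bd(2)[OF as] as by auto
    finally show ?thesis .
  qed
  have pa: "preordered_algebra univ S M le p"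
  proof unfold_locales
    show "sm M" unfolding M_def
      by (rule sm_Sigma) (use smI und_Obj[OF DO] in \<open>auto simp: small_iff_sm Obj_Pos\<close>)
    show "le a a" if "a \<in> M" for a using le_eq[OF that that] I_refl[OF M_fst(1)[OF that]] by blast
    show "le a b" if a: "a \<in> M" and e: "e \<in> M" and b: "b \<in> M" and ae: "le a e" and eb: "le e b" for a e b
    proof -
      obtain k where k: "(fst a, k) \<in> I" "(fst e, k) \<in> I" "(tr k a, tr k e) \<in> und (D k)" using ae by (auto simp: le_def)
      obtain k' where k': "(fst e, k') \<in> I" "(fst b, k') \<in> I" "(tr k' e, tr k' b) \<in> und (D k')" using eb by (auto simp: le_def)
      obtain l where l: "(k, l) \<in> I" "(k', l) \<in> I" using ub2 k(1) k'(1) FieldI2 by metis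
      have "(tr l a, tr l b) \<in> und (D l)"
        using up[OF a e k l(1)] up[OF e b k' l(2)] Partial_orderD(2)[OF und_order[OF DO[OF FieldI2[OF l(1)]]]] by blast
      then show ?thesis using I_trans[OF k(1) l(1)] I_trans[OF k'(2) l(2)] by (auto simp: le_def)
    qed
    show "p \<sigma> as \<in> M" if "\<sigma> \<in> S (length as)" "set as \<subseteq> M" for \<sigma> as using pM that .
    show "le (p \<sigma> as) (p \<sigma> bs)"
      if \<sigma>: "\<sigma> \<in> S (length as)" and as: "set as \<subseteq> M" and bs: "set bs \<subseteq> M" and ab: "list_all2 le as bs" for \<sigma> as bs
    proof -
      \<comment> \<open>Asking for the comparison at all later stages lets the induction combine the
        bounds of head and tail.\<close>
      have "\<exists>k \<in> Field I. \<forall>l. (k, l) \<in> I \<longrightarrow> list_all2 (\<lambda>a b. (tr l a, tr l b) \<in> und (D l)) as bs"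
        using ab as bs
      proof (induction rule: list_all2_induct)
        case Nil
        then show ?case using Ine by auto
      next
        case (Cons a as b bs)
        obtain k where k: "k \<in> Field I" "\<And>l. (k, l) \<in> I \<Longrightarrow> list_all2 (\<lambda>a b. (tr l a, tr l b) \<in> und (D l)) as bs"
          using Cons by auto
        obtain k' where k': "(fst a, k') \<in> I" "(fst b, k') \<in> I" "(tr k' a, tr k' b) \<in> und (D k')"
          using Cons.hyps(1) by (auto simp: le_def)
        obtain m where m: "m \<in> Field I" "(k, m) \<in> I" "(k', m) \<in> I" using ub2 k(1) k'(1) FieldI2 by metis
        have "list_all2 (\<lambda>a b. (tr l a, tr l b) \<in> und (D l)) (a # as) (b # bs)" if "(m, l) \<in> I" for l
          using k(2)[OF I_trans[OF m(2) that]] up[OF _ _ k' I_trans[OF m(3) that]] Cons.prems by simp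
        then show ?case using m(1) by blast
      qed
      then obtain k where k: "k \<in> Field I" "\<And>l. (k, l) \<in> I \<Longrightarrow> list_all2 (\<lambda>a b. (tr l a, tr l b) \<in> und (D l)) as bs" by blast
      obtain l where l: "(k, l) \<in> I" "(bd as, l) \<in> I" "(bd bs, l) \<in> I" and lI: "l \<in> Field I"
        using ub[of "{k, bd as, bd bs}"] k(1) bd(1)[OF as] bd(1)[OF bs] by auto
      have len: "length as = length bs" using ab by (rule list_all2_lengthD)
      have "(opr (D l) \<sigma> (map (tr l) as), opr (D l) \<sigma> (map (tr l) bs)) \<in> und (D l)"
        using opr_mono[OF DO[OF lI], of \<sigma> "map (tr l) as"] k(2)[OF l(1)] \<sigma> by (simp add: list_all2_map1 list_all2_map2)
      then have "(tr l (p \<sigma> as), tr l (p \<sigma> bs)) \<in> und (D l)"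
        using tr_p[OF \<sigma> as l(2)] tr_p[OF _ bs l(3), of \<sigma>] \<sigma> len by simp
      then show ?thesis unfolding le_def using l by (intro exI[of _ l]) (simp add: p_def)
    qed
  qed
  have "\<exists>T q. is_quotient M le p T q"
  proof (rule quotient_exists[OF pa])
    fix s t and v :: "nat \<Rightarrow> 'u \<times> 'u" assume st: "(s, t) \<in> \<Gamma>" and v: "range v \<subseteq> M"
    have vM: "v n \<in> M" for n using v by blast
    \<comment> \<open>The valuation concerns infinitely many variables, whose stages need not have a
      common bound. At stage \<open>k\<close>, variables that are not yet available get the image of
      \<open>v 0\<close> as default. Only finitely many variables occur in a term, so late enough
      stages give it its genuine value.\<close>
    define w where "w k n = (if (fst (v n), k) \<in> I then tr k (v n) else tr k (v 0))" for k n
    have tM: "teval p v r \<in> M" if "is_term S r" for r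
      using preordered_algebra.teval_closed[OF pa that v] .
    have ev: "\<exists>k0 \<in> Field I. \<forall>k. (k0, k) \<in> I \<longrightarrow> (fst (teval p v r), k) \<in> I \<and> tr k (teval p v r) = teval (opr (D k)) (w k) r"
      if "is_term S r" for r
      using that
    proof (induction r)
      case (Var n)
      then show ?case using M_fst(1)[OF vM[of n]] by (intro bexI[of _ "fst (v n)"]) (auto simp: w_def)
    next
      case (App \<sigma> ts)
      let ?as = "map (teval p v) ts"
      have as: "set ?as \<subseteq> M" using App.prems tM by auto
      have "\<forall>t \<in> set ts. \<exists>k0 \<in> Field I. \<forall>k. (k0, k) \<in> I \<longrightarrow> (fst (teval p v t), k) \<in> I \<and> tr k (teval p v t) = teval (opr (D k)) (w k) t"
        using App by auto
      then obtain \<kappa> where \<kappa>: "\<And>t. t \<in> set ts \<Longrightarrow> \<kappa> t \<in> Field I"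
        "\<And>t k. t \<in> set ts \<Longrightarrow> (\<kappa> t, k) \<in> I \<Longrightarrow> tr k (teval p v t) = teval (opr (D k)) (w k) t"
        by metis
      obtain k0 where k0: "k0 \<in> Field I" "(bd ?as, k0) \<in> I" "\<And>t. t \<in> set ts \<Longrightarrow> (\<kappa> t, k0) \<in> I"
        using ub[of "insert (bd ?as) (\<kappa> ` set ts)"] \<kappa>(1) bd(1)[OF as] by auto
      have "(fst (teval p v (App \<sigma> ts)), k) \<in> I \<and> tr k (teval p v (App \<sigma> ts)) = teval (opr (D k)) (w k) (App \<sigma> ts)"
        if k: "(k0, k) \<in> I" for k
      proof
        have bk: "(bd ?as, k) \<in> I" by (rule I_trans[OF k0(2) k])
        then show "(fst (teval p v (App \<sigma> ts)), k) \<in> I" by (simp add: p_def)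
        have eq: "map (tr k) ?as = map (teval (opr (D k)) (w k)) ts"
          using \<kappa>(2) I_trans[OF k0(3) k] by auto
        show "tr k (teval p v (App \<sigma> ts)) = teval (opr (D k)) (w k) (App \<sigma> ts)"
          unfolding teval.simps eq[symmetric] by (rule tr_p[OF _ as bk]) (use App.prems in simp)
      qed
      then show ?case using k0(1) by blast
    qed
    obtain ks where ks: "ks \<in> Field I" "\<And>k. (ks, k) \<in> I \<Longrightarrow> (fst (teval p v s), k) \<in> I \<and> tr k (teval p v s) = teval (opr (D k)) (w k) s"
      using ev ineq_terms[OF st] by blast
    obtain kt where kt: "kt \<in> Field I" "\<And>k. (kt, k) \<in> I \<Longrightarrow> (fst (teval p v t), k) \<in> I \<and> tr k (teval p v t) = teval (opr (D k)) (w k) t"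
      using ev ineq_terms[OF st] by blast
    \<comment> \<open>The bound includes the stage of \<open>v 0\<close>, so that the default is an
      element of stage \<open>k\<close>.\<close>
    obtain k where k: "k \<in> Field I" "(ks, k) \<in> I" "(kt, k) \<in> I" "(fst (v 0), k) \<in> I"
      using ub[of "{ks, kt, fst (v 0)}"] ks(1) kt(1) M_fst(1)[OF vM] by auto
    have "range (w k) \<subseteq> Field (und (D k))" using trc[OF vM] k(4) by (auto simp: w_def)
    then have "(teval (opr (D k)) (w k) s, teval (opr (D k)) (w k) t) \<in> und (D k)" by (rule opr_sat[OF DO[OF k(1)] st])
    then show "le (teval p v s) (teval p v t)"
      unfolding le_def using ks(2)[OF k(2)] kt(2)[OF k(3)] by (intro exI[of _ k]) simp
  qed
  then obtain Q q where q: "is_quotient M le p Q q" by blast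
  then have Q: "Q \<in> Obj K" and surj: "q ` M = Field (und Q)"
    and ord: "\<And>x y. x \<in> M \<Longrightarrow> y \<in> M \<Longrightarrow> (q x, q y) \<in> und Q \<longleftrightarrow> le x y"
    and ops: "\<And>f xs. f \<in> S (length xs) \<Longrightarrow> set xs \<subseteq> M \<Longrightarrow> q (p f xs) = opr Q f (map q xs)"
    unfolding is_quotient_def by auto
  have q_eq: "q a = q b" if "a \<in> M" "b \<in> M" "(fst a, k) \<in> I" "(fst b, k) \<in> I" "tr k a = tr k b" for a b k
    using le_eq[OF that] le_eq[OF that(2,1,4,3) that(5)[symmetric]] ord that(1,2) Partial_orderD(3)[OF und_order[OF Q]] by blast
  have inM: "(i, x) \<in> M" if "i \<in> Field I" "x \<in> Field (und (D i))" for i x using that by (simp add: M_def)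
  have tr_self: "tr i (i, x) = x" if "i \<in> Field I" "x \<in> Field (und (D i))" for i x
    using that by (simp add: tr_def dId fn_id[OF DO])
  have "\<exists>e \<in> arrows K (D i) Q. \<forall>x \<in> Field (und (D i)). fn e x = q (i, x)" if i: "i \<in> Field I" for i
  proof (rule arrowI[OF DO[OF i] Q])
    show "(q (i, x), q (i, y)) \<in> und Q" if xy: "(x, y) \<in> und (D i)" for x y
    proof -
      have F: "x \<in> Field (und (D i))" "y \<in> Field (und (D i))" using xy by (auto intro: FieldI1 FieldI2)
      have "le (i, x) (i, y)"
        unfolding le_def using I_refl[OF i] tr_self[OF i F(1)] tr_self[OF i F(2)] xy by (intro exI[of _ i]) simp
      then show ?thesis using ord inM[OF i] F by simp
    qed
    fix \<sigma> xs assume \<sigma>: "\<sigma> \<in> S (length xs)" and xs: "set xs \<subseteq> Field (und (D i))"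
    let ?as = "map (Pair i) xs"
    have as: "set ?as \<subseteq> M" using xs inM[OF i] by auto
    have \<sigma>': "\<sigma> \<in> S (length ?as)" using \<sigma> by simp
    obtain l where l: "(i, l) \<in> I" "(bd ?as, l) \<in> I" using ub2[OF i bd(1)[OF as]] by blast
    have "tr l (i, opr (D i) \<sigma> xs) = opr (D l) \<sigma> (map (fn (d i l)) xs)"
      using fn_opr[OF dA[OF l(1)] \<sigma> xs] by (simp add: tr_def)
    also have "map (fn (d i l)) xs = map (tr l) ?as" by (simp add: tr_def)
    also have "opr (D l) \<sigma> (map (tr l) ?as) = tr l (p \<sigma> ?as)" by (rule tr_p[OF \<sigma>' as l(2), symmetric])
    finally have eq: "tr l (i, opr (D i) \<sigma> xs) = tr l (p \<sigma> ?as)" .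
    have "q (i, opr (D i) \<sigma> xs) = q (p \<sigma> ?as)"
      by (rule q_eq[OF inM[OF i opr_closed[OF DO[OF i] \<sigma> xs]] pM[OF \<sigma>' as] _ _ eq]) (use l in \<open>simp_all add: p_def\<close>)
    then show "q (i, opr (D i) \<sigma> xs) = opr Q \<sigma> (map (\<lambda>x. q (i, x)) xs)"
      using ops[OF \<sigma>' as] by (simp add: comp_def)
  qed
  then obtain e where e: "\<And>i. i \<in> Field I \<Longrightarrow> e i \<in> arrows K (D i) Q"
    "\<And>i x. i \<in> Field I \<Longrightarrow> x \<in> Field (und (D i)) \<Longrightarrow> fn (e i) x = q (i, x)" by metis
  have "e j \<odot> d i j = e i" if ij: "(i, j) \<in> I" for i j
  proof -
    have F: "i \<in> Field I" "j \<in> Field I" using ij by (auto intro: FieldI1 FieldI2)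
    show ?thesis
    proof (rule arrow_eqI[OF comp_arrow[OF dA[OF ij] e(1)[OF F(2)]] e(1)[OF F(1)]])
      fix x assume x: "x \<in> Field (und (D i))"
      have dx: "fn (d i j) x \<in> Field (und (D j))" by (rule fn_closed[OF dA[OF ij] x])
      have "q (j, fn (d i j) x) = q (i, x)"
        by (rule q_eq[OF inM[OF F(2) dx] inM[OF F(1) x], of j])
          (use I_refl[OF F(2)] ij tr_self[OF F(2) dx] in \<open>simp_all add: tr_def[of j "(i, x)"]\<close>)
      then show "fn (e j \<odot> d i j) x = fn (e i) x"
        using e(2)[OF F(1) x] e(2)[OF F(2) dx] fn_comp[OF dA[OF ij] e(1)[OF F(2)] x] by simp
    qed
  qed
  then have "is_cocone K I D d Q e" unfolding is_cocone_def using Q e(1) by auto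
  then obtain g where g: "g \<in> arrows K C Q" "\<And>i. i \<in> Field I \<Longrightarrow> g \<odot> c i = e i"
    using col unfolding is_colimit_def by blast
  have gc: "fn g (fn (c i) x) = q (i, x)" if "i \<in> Field I" "x \<in> Field (und (D i))" for i x
    using fn_comp[OF cA[OF that(1)] g(1) that(2)] g(2)[OF that(1)] e(2)[OF that] by simp
  have c_tr: "fn (c k) (tr k a) = fn (c (fst a)) (snd a)" if "a \<in> M" "(fst a, k) \<in> I" for a k
    using fn_comp[OF dA[OF that(2)] cA[OF FieldI2[OF that(2)]] M_fst(2)[OF that(1)]] cd[OF that(2)] by (simp add: tr_def)
  have "\<exists>r \<in> arrows K Q C. \<forall>a \<in> M. fn r (q a) = fn (c (fst a)) (snd a)"
  proof (rule quotient_arrow[OF q C])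
    show "fn (c (fst a)) (snd a) \<in> Field (und C)" if "a \<in> M" for a
      using fn_closed[OF cA[OF M_fst(1)[OF that]] M_fst(2)[OF that]] .
    show "(fn (c (fst a)) (snd a), fn (c (fst b)) (snd b)) \<in> und C" if ab: "a \<in> M" "b \<in> M" "le a b" for a b
    proof -
      obtain k where k: "(fst a, k) \<in> I" "(fst b, k) \<in> I" "(tr k a, tr k b) \<in> und (D k)" using ab(3) by (auto simp: le_def)
      show ?thesis using fn_mono[OF cA[OF FieldI2[OF k(1)]] k(3)] c_tr[OF ab(1) k(1)] c_tr[OF ab(2) k(2)] by simp
    qed
    fix \<sigma> as assume \<sigma>: "\<sigma> \<in> S (length as)" and as: "set as \<subseteq> M"
    let ?k = "bd as"
    have 1: "set (map (tr ?k) as) \<subseteq> Field (und (D ?k))" using trc bd(2)[OF as] as by auto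
    have eq: "map (fn (c ?k)) (map (tr ?k) as) = map (\<lambda>a. fn (c (fst a)) (snd a)) as"
      using c_tr bd(2)[OF as] as by auto
    show "fn (c (fst (p \<sigma> as))) (snd (p \<sigma> as)) = opr C \<sigma> (map (\<lambda>a. fn (c (fst a)) (snd a)) as)"
      using fn_opr[OF cA[OF bd(1)[OF as]] _ 1, of \<sigma>] \<sigma> unfolding eq by (simp add: p_def)
  qed
  then obtain r where r: "r \<in> arrows K Q C" "\<And>a. a \<in> M \<Longrightarrow> fn r (q a) = fn (c (fst a)) (snd a)" by blast
  have rg: "r \<odot> g \<in> arrows K C C" by (rule comp_arrow[OF g(1) r(1)])
  have rgc: "(r \<odot> g) \<odot> c i = Idt K C \<odot> c i" if i: "i \<in> Field I" for i
  proof (rule arrow_eqI[OF comp_arrow[OF cA[OF i] rg] comp_arrow[OF cA[OF i] id_arrow[OF C]]])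
    fix x assume x: "x \<in> Field (und (D i))"
    have cx: "fn (c i) x \<in> Field (und C)" by (rule fn_closed[OF cA[OF i] x])
    show "fn ((r \<odot> g) \<odot> c i) x = fn (Idt K C \<odot> c i) x"
      using fn_comp[OF cA[OF i] rg x] fn_comp[OF cA[OF i] id_arrow[OF C] x] fn_comp[OF g(1) r(1) cx]
        fn_id[OF C cx] gc[OF i x] r(2)[OF inM[OF i x]] by simp
  qed
  have canc: "(a, b) \<in> Hom K C C"
    if "a \<in> arrows K C C" "b \<in> arrows K C C" "\<And>i. i \<in> Field I \<Longrightarrow> a \<odot> c i = b \<odot> c i" for a b
  proof -
    have "(a \<odot> c i, b \<odot> c i) \<in> Hom K (D i) C" if i: "i \<in> Field I" for i
      using arrow_refl[OF comp_arrow[OF cA[OF i] \<open>b \<in> arrows K C C\<close>]] \<open>\<And>i. i \<in> Field I \<Longrightarrow> a \<odot> c i = b \<odot> c i\<close>[OF i] by simp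
    then show ?thesis using col that(1,2) unfolding is_colimit_def by blast
  qed
  have rg_id: "r \<odot> g = Idt K C"
    using canc[OF rg id_arrow[OF C] rgc] canc[OF id_arrow[OF C] rg rgc[symmetric]] Partial_orderD(3)[OF hom_poset[OF C C]] by blast
  show "is_colimit Pos I (\<lambda>i. und (D i)) (\<lambda>i j. ar U (d i j)) (und C) (\<lambda>i. ar U (c i))"
  proof (rule pos_colimitI[OF dir])
    show "is_cocone Pos I (\<lambda>i. und (D i)) (\<lambda>i j. ar U (d i j)) (und C) (\<lambda>i. ar U (c i))"
      unfolding is_cocone_def
    proof (intro conjI ballI und_Obj[OF C])
      show "ar U (c i) \<in> arrows Pos (und (D i)) (und C)" if "i \<in> Field I" for i
        using ar_U[OF cA[OF that]] und_Obj[OF C] und_Obj[OF DO[OF that]] by (auto simp: arrows_Pos)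
      have "ar U (c j) \<odot>\<^bsub>Pos\<^esub> ar U (d i j) = ar U (c i)" if "(i, j) \<in> I" for i j
        using functor_U dA[OF that] cA[OF FieldI2[OF that]] cd[OF that] unfolding enriched_functor_def by metis
      then show "case z of (i, j) \<Rightarrow> ar U (c j) \<odot>\<^bsub>Pos\<^esub> ar U (d i j) = ar U (c i)" if "z \<in> I" for z
        using that by auto
    qed
    show "ar U (d i j) \<in> arrows Pos (und (D i)) (und (D j))" if "(i, j) \<in> I" for i j
      using ar_U[OF dA[OF that]] und_Obj arrows_Obj[OF dA[OF that]] by (auto simp: arrows_Pos)
    show "\<exists>i \<in> Field I. \<exists>x \<in> Field (und (D i)). z = fst (snd (ar U (c i))) x" if z: "z \<in> Field (und C)" for z
    proof -
      obtain a where a: "a \<in> M" "fn g z = q a" using fn_closed[OF g(1) z] surj by blast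
      have "z = fn r (fn g z)" using fn_comp[OF g(1) r(1) z] rg_id fn_id[OF C z] by simp
      also have "\<dots> = fn (c (fst a)) (snd a)" using a r(2) by simp
      finally show ?thesis using M_fst[OF a(1)] unfolding fn_def by blast
    qed
    fix i x j y assume i: "i \<in> Field I" and x: "x \<in> Field (und (D i))" and j: "j \<in> Field I" and y: "y \<in> Field (und (D j))"
      and "(fst (snd (ar U (c i))) x, fst (snd (ar U (c j))) y) \<in> und C"
    then have "(fn g (fn (c i) x), fn g (fn (c j) y)) \<in> und Q" using fn_mono[OF g(1)] by (simp add: fn_def)
    then have "le (i, x) (j, y)" using gc[OF i x] gc[OF j y] ord[OF inM[OF i x] inM[OF j y]] by simp
    then show "\<exists>k. (i, k) \<in> I \<and> (j, k) \<in> I \<and> (fst (snd (ar U (d i k))) x, fst (snd (ar U (d j k))) y) \<in> und (D k)"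
      by (simp add: le_def tr_def fn_def)
  qed
qed

end

section \<open>Equivalences of categories\<close>

lemma enriched_functorD:
  assumes "enriched_functor K L F"
  shows "X \<in> Obj K \<Longrightarrow> ob F X \<in> Obj L" "X \<in> Obj K \<Longrightarrow> ar F (Idt K X) = Idt L (ob F X)"
    and "X \<in> Obj K \<Longrightarrow> Y \<in> Obj K \<Longrightarrow> (f, g) \<in> Hom K X Y \<Longrightarrow> (ar F f, ar F g) \<in> Hom L (ob F X) (ob F Y)"
    and "f \<in> arrows K X Y \<Longrightarrow> g \<in> arrows K Y Z \<Longrightarrow> ar F (g \<odot>\<^bsub>K\<^esub> f) = ar F g \<odot>\<^bsub>L\<^esub> ar F f"
  using assms unfolding enriched_functor_def by (blast, blast, fast, blast)

lemma functor_arrow: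
  assumes "pos_category K" "enriched_functor K L F" "f \<in> arrows K X Y"
  shows "ar F f \<in> arrows L (ob F X) (ob F Y)"
  using enriched_functorD(1)[OF assms(2)] arrows_Obj[OF assms(3)]
    FieldI1[OF enriched_functorD(3)[OF assms(2) arrows_Obj[OF assms(3)] pos_category.arrow_refl[OF assms(1,3)]]]
  by (simp add: arrows_def)

lemma is_isoE:
  assumes "is_iso K X Y f"
  obtains g where "f \<in> arrows K X Y" "g \<in> arrows K Y X" "g \<odot>\<^bsub>K\<^esub> f = Idt K X" "f \<odot>\<^bsub>K\<^esub> g = Idt K Y"
  using assms unfolding is_iso_def by blast

lemma (in pos_category) iso_cancel_right:
  assumes "is_iso K X Y i" "f \<in> arrows K Y Z" "g \<in> arrows K Y Z" "f \<odot> i = g \<odot> i"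
  shows "f = g"
proof -
  obtain j where i: "i \<in> arrows K X Y" and j: "j \<in> arrows K Y X" "i \<odot> j = Idt K Y"
    using assms(1) by (rule is_isoE)
  have "f = (f \<odot> i) \<odot> j" using comp_assoc[OF j(1) i assms(2)] j(2) comp_id[OF assms(2)] by simp
  also have "\<dots> = (g \<odot> i) \<odot> j" by (simp only: assms(4))
  also have "\<dots> = g" using comp_assoc[OF j(1) i assms(3)] j(2) comp_id[OF assms(3)] by simp
  finally show ?thesis .
qed

text \<open>The preimage is \<open>G h\<close> conjugated by the isomorphisms
  \<open>\<alpha>\<close>, which forces \<open>G E f = G h\<close>. Naturality of
  \<open>\<beta>\<close> then cancels \<open>G\<close>.\<close>

lemma equivalence_full:
  assumes K: "pos_category K" and L: "pos_category L" and E: "equivalence K L E"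
    and X: "X \<in> Obj K" and Y: "Y \<in> Obj K" and h: "h \<in> arrows L (ob E X) (ob E Y)"
  shows "\<exists>f \<in> arrows K X Y. ar E f = h"
proof -
  interpret K: pos_category K by (rule K)
  interpret L: pos_category L by (rule L)
  obtain G where EF: "enriched_functor K L E" and GF: "enriched_functor L K G"
    and n1: "naturally_isomorphic K K id_functor (comp_functor G E)"
    and n2: "naturally_isomorphic L L (comp_functor E G) id_functor"
    using E unfolding equivalence_def by blast
  obtain \<alpha> where a: "\<forall>X \<in> Obj K. is_iso K X (ob G (ob E X)) (\<alpha> X)"
    "\<forall>X Y. \<forall>f \<in> arrows K X Y. \<alpha> Y \<odot>\<^bsub>K\<^esub> f = ar G (ar E f) \<odot>\<^bsub>K\<^esub> \<alpha> X"
    using n1 unfolding naturally_isomorphic_def id_functor_def comp_functor_def pfunctor.simps id_apply comp_apply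
    by (elim exE conjE)
  have \<alpha>: "is_iso K X (ob G (ob E X)) (\<alpha> X)" if "X \<in> Obj K" for X using a(1) that by blast
  have \<alpha>n: "\<alpha> Y \<odot>\<^bsub>K\<^esub> f = ar G (ar E f) \<odot>\<^bsub>K\<^esub> \<alpha> X" if "f \<in> arrows K X Y" for X Y f
    using a(2) that by blast
  obtain \<beta> where b: "\<forall>A \<in> Obj L. is_iso L (ob E (ob G A)) A (\<beta> A)"
    "\<forall>A B. \<forall>m \<in> arrows L A B. \<beta> B \<odot>\<^bsub>L\<^esub> ar E (ar G m) = m \<odot>\<^bsub>L\<^esub> \<beta> A"
    using n2 unfolding naturally_isomorphic_def id_functor_def comp_functor_def pfunctor.simps id_apply comp_apply
    by (elim exE conjE)
  have \<beta>: "is_iso L (ob E (ob G A)) A (\<beta> A)" if "A \<in> Obj L" for A using b(1) that by blast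
  have \<beta>n: "\<beta> B \<odot>\<^bsub>L\<^esub> ar E (ar G m) = m \<odot>\<^bsub>L\<^esub> \<beta> A" if "m \<in> arrows L A B" for A B m
    using b(2) that by blast
  obtain b where aY: "\<alpha> Y \<in> arrows K Y (ob G (ob E Y))" and b: "b \<in> arrows K (ob G (ob E Y)) Y"
    "\<alpha> Y \<odot>\<^bsub>K\<^esub> b = Idt K (ob G (ob E Y))"
    using \<alpha>[OF Y] by (rule is_isoE)
  have aX: "\<alpha> X \<in> arrows K X (ob G (ob E X))" using \<alpha>[OF X] by (rule is_isoE)
  have Gh: "ar G h \<in> arrows K (ob G (ob E X)) (ob G (ob E Y))" by (rule functor_arrow[OF L GF h])
  define f where "f = b \<odot>\<^bsub>K\<^esub> (ar G h \<odot>\<^bsub>K\<^esub> \<alpha> X)"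
  have f: "f \<in> arrows K X Y" unfolding f_def by (intro K.comp_arrow[OF _ b(1)] K.comp_arrow[OF aX Gh])
  have Ef: "ar E f \<in> arrows L (ob E X) (ob E Y)" by (rule functor_arrow[OF K EF f])
  have "ar G (ar E f) \<odot>\<^bsub>K\<^esub> \<alpha> X = \<alpha> Y \<odot>\<^bsub>K\<^esub> f" using \<alpha>n[OF f] by simp
  also have "\<dots> = (\<alpha> Y \<odot>\<^bsub>K\<^esub> b) \<odot>\<^bsub>K\<^esub> (ar G h \<odot>\<^bsub>K\<^esub> \<alpha> X)"
    unfolding f_def by (rule K.comp_assoc[OF K.comp_arrow[OF aX Gh] b(1) aY, symmetric])
  also have "\<dots> = ar G h \<odot>\<^bsub>K\<^esub> \<alpha> X" by (simp add: b(2) K.id_comp[OF K.comp_arrow[OF aX Gh]])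
  finally have "ar G (ar E f) = ar G h"
    using K.iso_cancel_right[OF \<alpha>[OF X] functor_arrow[OF L GF Ef] Gh] by blast
  then have "ar E f \<odot>\<^bsub>L\<^esub> \<beta> (ob E X) = h \<odot>\<^bsub>L\<^esub> \<beta> (ob E X)" using \<beta>n[OF Ef] \<beta>n[OF h] by simp
  then have "ar E f = h"
    using L.iso_cancel_right[OF \<beta>[OF enriched_functorD(1)[OF EF X]] Ef h] by blast
  then show ?thesis using f by blast
qed

lemma equivalence_ess_surj:
  assumes "equivalence K L E" "A \<in> Obj L"
  shows "\<exists>X \<in> Obj K. \<exists>j. is_iso L (ob E X) A j"
proof -
  obtain G where G: "enriched_functor L K G" and n: "naturally_isomorphic L L (comp_functor E G) id_functor"
    using assms(1) unfolding equivalence_def by blast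
  obtain \<beta> where "is_iso L (ob E (ob G A)) A (\<beta> A)"
    using n assms(2) unfolding naturally_isomorphic_def id_functor_def comp_functor_def pfunctor.simps id_apply comp_apply
    by blast
  then show ?thesis using enriched_functorD(1)[OF G assms(2)] by blast
qed

text \<open>The inverse functor picks for \<open>A\<close> an object \<open>g A\<close> with an
  isomorphism \<open>j A\<close> from its image to \<open>A\<close>, and lifts along
  \<open>E\<close> the conjugates of arrows by these isomorphisms. Reflection of the order makes the
  lifts unique and monotone.\<close>

lemma equivalenceI:
  assumes K: "pos_category K" and L: "pos_category L" and EF: "enriched_functor K L E"
    and full: "\<And>X Y h. X \<in> Obj K \<Longrightarrow> Y \<in> Obj K \<Longrightarrow> h \<in> arrows L (ob E X) (ob E Y) \<Longrightarrow> \<exists>f \<in> arrows K X Y. ar E f = h"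
    and refl: "\<And>X Y f g. f \<in> arrows K X Y \<Longrightarrow> g \<in> arrows K X Y \<Longrightarrow> (ar E f, ar E g) \<in> Hom L (ob E X) (ob E Y) \<Longrightarrow> (f, g) \<in> Hom K X Y"
    and ess: "\<And>A. A \<in> Obj L \<Longrightarrow> \<exists>X \<in> Obj K. \<exists>j. is_iso L (ob E X) A j"
  shows "equivalence K L E"
proof -
  interpret K: pos_category K by (rule K)
  interpret L: pos_category L by (rule L)
  note EA = functor_arrow[OF K EF] and EO = enriched_functorD(1)[OF EF] and EC = enriched_functorD(4)[OF EF]
  have inj: "f = g" if f: "f \<in> arrows K X Y" and g: "g \<in> arrows K X Y" and eq: "ar E f = ar E g" for X Y f g
    using refl[OF f g] refl[OF g f] L.arrow_refl[OF EA[OF f]] eq K.arrow_antisym[OF f] by simp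
  have "\<exists>X j j'. X \<in> Obj K \<and> j \<in> arrows L (ob E X) A \<and> j' \<in> arrows L A (ob E X) \<and>
      j' \<odot>\<^bsub>L\<^esub> j = Idt L (ob E X) \<and> j \<odot>\<^bsub>L\<^esub> j' = Idt L A" if "A \<in> Obj L" for A
    using ess[OF that] unfolding is_iso_def by blast
  then obtain g j j' where g: "\<And>A. A \<in> Obj L \<Longrightarrow> g A \<in> Obj K"
    and j: "\<And>A. A \<in> Obj L \<Longrightarrow> j A \<in> arrows L (ob E (g A)) A"
    and j': "\<And>A. A \<in> Obj L \<Longrightarrow> j' A \<in> arrows L A (ob E (g A))"
    and j'j: "\<And>A. A \<in> Obj L \<Longrightarrow> j' A \<odot>\<^bsub>L\<^esub> j A = Idt L (ob E (g A))"
    and jj': "\<And>A. A \<in> Obj L \<Longrightarrow> j A \<odot>\<^bsub>L\<^esub> j' A = Idt L A"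
    by metis
  define conj where "conj A B m = j' B \<odot>\<^bsub>L\<^esub> (m \<odot>\<^bsub>L\<^esub> j A)" for A B m
  have conj: "conj A B m \<in> arrows L (ob E (g A)) (ob E (g B))" if "m \<in> arrows L A B" for A B m
    unfolding conj_def using L.comp_arrow[OF L.comp_arrow[OF j that] j'] arrows_Obj[OF that] by blast
  have jconj: "j B \<odot>\<^bsub>L\<^esub> conj A B m = m \<odot>\<^bsub>L\<^esub> j A" if m: "m \<in> arrows L A B" for A B m
  proof -
    have A: "A \<in> Obj L" and B: "B \<in> Obj L" using arrows_Obj[OF m] by auto
    have mj: "m \<odot>\<^bsub>L\<^esub> j A \<in> arrows L (ob E (g A)) B" by (rule L.comp_arrow[OF j[OF A] m])
    show ?thesis
      unfolding conj_def L.comp_assoc[OF mj j'[OF B] j[OF B], symmetric] jj'[OF B] by (rule L.id_comp[OF mj])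
  qed
  \<comment> \<open>The arrow part of a functor is given \<open>m\<close> alone, so domain and
    codomain belong to the choice; \<open>hom_disjoint\<close> shows that they are the right
    ones.\<close>
  define ga where "ga m = (SOME f. \<exists>A B. m \<in> arrows L A B \<and> f \<in> arrows K (g A) (g B) \<and> ar E f = conj A B m)" for m
  have ga: "ga m \<in> arrows K (g A) (g B) \<and> ar E (ga m) = conj A B m" if m: "m \<in> arrows L A B" for A B m
  proof -
    have "\<exists>f. \<exists>A B. m \<in> arrows L A B \<and> f \<in> arrows K (g A) (g B) \<and> ar E f = conj A B m"
      using full[OF g g conj[OF m]] arrows_Obj[OF m] m by blast
    from someI_ex[OF this] obtain A' B' where
      *: "m \<in> arrows L A' B'" "ga m \<in> arrows K (g A') (g B')" "ar E (ga m) = conj A' B' m"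
      unfolding ga_def by blast
    then show ?thesis using L.hom_disjoint[OF m *(1)] by simp
  qed
  let ?G = "\<lparr>ob = g, ar = ga\<rparr>"
  have GF: "enriched_functor L K ?G"
    unfolding enriched_functor_def
  proof (intro conjI ballI allI, goal_cases)
    case (1 A)
    then show ?case using g by simp
  next
    case (2 A)
    note i = L.id_arrow[OF 2]
    have "ar E (ga (Idt L A)) = ar E (Idt K (g A))"
      using ga[OF i] enriched_functorD(2)[OF EF g[OF 2]] L.id_comp[OF j[OF 2]] j'j[OF 2] by (simp add: conj_def)
    then have "ga (Idt L A) = Idt K (g A)" using inj ga[OF i] K.id_arrow[OF g[OF 2]] by blast
    then show ?case by simp
  next
    case (3 A B z)
    obtain m n where z: "z = (m, n)" by force
    then have mn: "(m, n) \<in> Hom L A B" using 3 by simp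
    have m: "m \<in> arrows L A B" and n: "n \<in> arrows L A B"
      using mn 3 by (auto simp: arrows_def intro: FieldI1 FieldI2)
    have "(conj A B m, conj A B n) \<in> Hom L (ob E (g A)) (ob E (g B))"
      unfolding conj_def
      by (rule L.comp_mono[OF EO[OF g[OF 3(1)]] 3(2) EO[OF g[OF 3(2)]] L.comp_mono[OF EO[OF g[OF 3(1)]] 3(1,2) L.arrow_refl[OF j[OF 3(1)]] mn]
        L.arrow_refl[OF j'[OF 3(2)]]])
    then have "(ga m, ga n) \<in> Hom K (g A) (g B)" using refl ga[OF m] ga[OF n] by simp
    then show ?case by (simp add: z)
  next
    case (4 A B C m n)
    have m: "m \<in> arrows L A B" and n: "n \<in> arrows L B C" using 4 .
    note nm = L.comp_arrow[OF m n]
    have A: "A \<in> Obj L" and B: "B \<in> Obj L" and C: "C \<in> Obj L" using arrows_Obj[OF m] arrows_Obj[OF n] by auto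
    have "ar E (ga n \<odot>\<^bsub>K\<^esub> ga m) = conj B C n \<odot>\<^bsub>L\<^esub> conj A B m"
      using EC ga[OF m] ga[OF n] by metis
    also have "\<dots> = j' C \<odot>\<^bsub>L\<^esub> ((n \<odot>\<^bsub>L\<^esub> j B) \<odot>\<^bsub>L\<^esub> conj A B m)"
      unfolding conj_def[of B C] by (rule L.comp_assoc[OF conj[OF m] L.comp_arrow[OF j[OF B] n] j'[OF C]])
    also have "(n \<odot>\<^bsub>L\<^esub> j B) \<odot>\<^bsub>L\<^esub> conj A B m = (n \<odot>\<^bsub>L\<^esub> m) \<odot>\<^bsub>L\<^esub> j A"
      unfolding L.comp_assoc[OF conj[OF m] j[OF B] n] jconj[OF m] L.comp_assoc[OF j[OF A] m n] ..
    finally have "ar E (ga n \<odot>\<^bsub>K\<^esub> ga m) = ar E (ga (n \<odot>\<^bsub>L\<^esub> m))" using ga[OF nm] by (simp add: conj_def)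
    moreover have "ga n \<odot>\<^bsub>K\<^esub> ga m \<in> arrows K (g A) (g C)" using K.comp_arrow ga[OF m] ga[OF n] by blast
    ultimately show ?case using inj[OF conjunct1[OF ga[OF nm]]] by simp
  qed
  have "\<exists>a. a \<in> arrows K X (g (ob E X)) \<and> ar E a = j' (ob E X)" if X: "X \<in> Obj K" for X
    using full[OF X g[OF EO[OF X]] j'[OF EO[OF X]]] by blast
  then obtain \<alpha> where \<alpha>: "\<And>X. X \<in> Obj K \<Longrightarrow> \<alpha> X \<in> arrows K X (g (ob E X))"
    "\<And>X. X \<in> Obj K \<Longrightarrow> ar E (\<alpha> X) = j' (ob E X)" by metis
  have \<alpha>_iso: "is_iso K X (g (ob E X)) (\<alpha> X)" if X: "X \<in> Obj K" for X
  proof -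
    note EX = EO[OF X]
    obtain b where b: "b \<in> arrows K (g (ob E X)) X" "ar E b = j (ob E X)" using full[OF g[OF EX] X j[OF EX]] by blast
    have "ar E (b \<odot>\<^bsub>K\<^esub> \<alpha> X) = ar E (Idt K X)"
      using EC[OF \<alpha>(1)[OF X] b(1)] \<alpha>(2)[OF X] b(2) jj'[OF EX] enriched_functorD(2)[OF EF X] by simp
    then have 1: "b \<odot>\<^bsub>K\<^esub> \<alpha> X = Idt K X" by (rule inj[OF K.comp_arrow[OF \<alpha>(1)[OF X] b(1)] K.id_arrow[OF X]])
    have "ar E (\<alpha> X \<odot>\<^bsub>K\<^esub> b) = ar E (Idt K (g (ob E X)))"
      using EC[OF b(1) \<alpha>(1)[OF X]] \<alpha>(2)[OF X] b(2) j'j[OF EX] enriched_functorD(2)[OF EF g[OF EX]] by simp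
    then have 2: "\<alpha> X \<odot>\<^bsub>K\<^esub> b = Idt K (g (ob E X))"
      by (rule inj[OF K.comp_arrow[OF b(1) \<alpha>(1)[OF X]] K.id_arrow[OF g[OF EX]]])
    show ?thesis unfolding is_iso_def using 1 2 b(1) \<alpha>(1)[OF X] by blast
  qed
  have \<alpha>_nat: "\<alpha> Y \<odot>\<^bsub>K\<^esub> f = ga (ar E f) \<odot>\<^bsub>K\<^esub> \<alpha> X" if f: "f \<in> arrows K X Y" for X Y f
  proof -
    have X: "X \<in> Obj K" and Y: "Y \<in> Obj K" using arrows_Obj[OF f] by auto
    note Ef = EA[OF f] and EX = EO[OF X] and EY = EO[OF Y]
    have G: "ga (ar E f) \<in> arrows K (g (ob E X)) (g (ob E Y))" using ga[OF Ef] by blast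
    have "ar E (ga (ar E f) \<odot>\<^bsub>K\<^esub> \<alpha> X) = conj (ob E X) (ob E Y) (ar E f) \<odot>\<^bsub>L\<^esub> j' (ob E X)"
      using EC[OF \<alpha>(1)[OF X] G] ga[OF Ef] \<alpha>(2)[OF X] by simp
    also have "\<dots> = j' (ob E Y) \<odot>\<^bsub>L\<^esub> ((ar E f \<odot>\<^bsub>L\<^esub> j (ob E X)) \<odot>\<^bsub>L\<^esub> j' (ob E X))"
      unfolding conj_def by (rule L.comp_assoc[OF j'[OF EX] L.comp_arrow[OF j[OF EX] Ef] j'[OF EY]])
    also have "(ar E f \<odot>\<^bsub>L\<^esub> j (ob E X)) \<odot>\<^bsub>L\<^esub> j' (ob E X) = ar E f"
      unfolding L.comp_assoc[OF j'[OF EX] j[OF EX] Ef] jj'[OF EX] by (rule L.comp_id[OF Ef])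
    finally have "ar E (\<alpha> Y \<odot>\<^bsub>K\<^esub> f) = ar E (ga (ar E f) \<odot>\<^bsub>K\<^esub> \<alpha> X)"
      using EC[OF f \<alpha>(1)[OF Y]] \<alpha>(2)[OF Y] by simp
    then show ?thesis by (rule inj[OF K.comp_arrow[OF f \<alpha>(1)[OF Y]] K.comp_arrow[OF \<alpha>(1)[OF X] G]])
  qed
  have "naturally_isomorphic K K id_functor (comp_functor ?G E)"
    unfolding naturally_isomorphic_def
    by (intro exI[of _ \<alpha>]) (simp add: id_functor_def comp_functor_def \<alpha>_iso \<alpha>_nat)
  moreover have "naturally_isomorphic L L (comp_functor E ?G) id_functor"
  proof -
    have "is_iso L (ob E (g A)) A (j A)" if "A \<in> Obj L" for A
      unfolding is_iso_def using j[OF that] j'[OF that] j'j[OF that] jj'[OF that] by blast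
    moreover have "j B \<odot>\<^bsub>L\<^esub> ar E (ga m) = m \<odot>\<^bsub>L\<^esub> j A" if "m \<in> arrows L A B" for A B m
      using ga[OF that] jconj[OF that] by simp
    ultimately show ?thesis
      unfolding naturally_isomorphic_def by (intro exI[of _ j]) (simp add: id_functor_def comp_functor_def)
  qed
  ultimately show ?thesis unfolding equivalence_def using EF GF by blast
qed

section \<open>The category of algebras\<close>

lemma monotone_homsD:
  assumes "h \<in> monotone_homs S A B"
  shows "h \<in> monotone_maps (under A) (under B)"
    and "f \<in> S (length xs) \<Longrightarrow> set xs \<subseteq> Field (under A) \<Longrightarrow> h (oper A f xs) = oper B f (map h xs)"
  using assms by (auto simp: monotone_homs_def)

lemma monotone_homsI:
  assumes "h \<in> monotone_maps (under A) (under B)"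
    and "\<And>f xs. f \<in> S (length xs) \<Longrightarrow> set xs \<subseteq> Field (under A) \<Longrightarrow> h (oper A f xs) = oper B f (map h xs)"
  shows "h \<in> monotone_homs S A B"
  using assms by (simp add: monotone_homs_def)

lemma Hom_Variety: "(m, n) \<in> Hom (Variety S \<Gamma>) A B \<longleftrightarrow> (\<exists>f g. m = (A, f, B) \<and> n = (A, g, B) \<and>
    f \<in> monotone_homs S A B \<and> g \<in> monotone_homs S A B \<and> (\<forall>x \<in> Field (under A). (f x, g x) \<in> under B))"
  by (auto simp: Variety_def map_poset_def monotone_homs_def)

lemma Obj_Variety_order: "A \<in> Obj (Variety S \<Gamma>) \<Longrightarrow> Partial_order (under A)"
  by (auto simp: Obj_Variety dest: ordered_algebraD(2))

lemma arrows_Variety: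
  "m \<in> arrows (Variety S \<Gamma>) A B \<longleftrightarrow>
    A \<in> Obj (Variety S \<Gamma>) \<and> B \<in> Obj (Variety S \<Gamma>) \<and> (\<exists>f \<in> monotone_homs S A B. m = (A, f, B))"
proof -
  have "((A, f, B), (A, f, B)) \<in> Hom (Variety S \<Gamma>) A B" if "B \<in> Obj (Variety S \<Gamma>)" "f \<in> monotone_homs S A B" for f
    unfolding Hom_Variety
    using Partial_orderD(1)[OF Obj_Variety_order[OF that(1)]] monotone_mapsD(1)[OF monotone_homsD(1)[OF that(2)]] that(2) by simp
  then show ?thesis
    unfolding arrows_def by (auto simp: Field_def) (auto simp: Hom_Variety)
qed

lemma Cmp_Variety: "(B', g, C) \<odot>\<^bsub>Variety S \<Gamma>\<^esub> (A, f, B) = (A, compose (Field (under A)) g f, C)"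
  by (simp add: Variety_def)

lemma Idt_Variety: "Idt (Variety S \<Gamma>) A = (A, \<lambda>x \<in> Field (under A). x, A)"
  by (simp add: Variety_def)

lemma compose_homs:
  assumes A: "ordered_algebra S A" and f: "f \<in> monotone_homs S A B" and g: "g \<in> monotone_homs S B C"
  shows "compose (Field (under A)) g f \<in> monotone_homs S A C"
proof (rule monotone_homsI)
  show "compose (Field (under A)) g f \<in> monotone_maps (under A) (under C)"
    by (rule compose_monotone[OF monotone_homsD(1)[OF f] monotone_homsD(1)[OF g]])
  fix \<sigma> xs assume \<sigma>: "\<sigma> \<in> S (length xs)" and xs: "set xs \<subseteq> Field (under A)"
  have 1: "set (map f xs) \<subseteq> Field (under B)" "\<sigma> \<in> S (length (map f xs))"
    using xs monotone_mapsD(1)[OF monotone_homsD(1)[OF f]] \<sigma> by auto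
  have eq: "map (compose (Field (under A)) g f) xs = map g (map f xs)"
    using xs by (auto simp: compose_eq)
  show "compose (Field (under A)) g f (oper A \<sigma> xs) = oper C \<sigma> (map (compose (Field (under A)) g f) xs)"
    unfolding eq using ordered_algebraD(3)[OF A \<sigma> xs] monotone_homsD(2)[OF f \<sigma> xs] monotone_homsD(2)[OF g 1(2,1)]
    by (simp add: compose_eq)
qed

lemma id_hom:
  assumes "ordered_algebra S A" shows "(\<lambda>x \<in> Field (under A). x) \<in> monotone_homs S A A"
proof (rule monotone_homsI[OF id_monotone])
  fix \<sigma> xs assume \<sigma>: "\<sigma> \<in> S (length xs)" and xs: "set xs \<subseteq> Field (under A)"
  have eq: "map (\<lambda>x \<in> Field (under A). x) xs = xs" using xs by (induction xs) auto
  show "(\<lambda>x \<in> Field (under A). x) (oper A \<sigma> xs) = oper A \<sigma> (map (\<lambda>x \<in> Field (under A). x) xs)"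
    unfolding eq using ordered_algebraD(3)[OF assms \<sigma> xs] by simp
qed

lemma pos_category_Variety: "pos_category (Variety S \<Gamma>)"
proof (unfold_locales, goal_cases)
  case (1 A B)
  note oB = Partial_orderD[OF Obj_Variety_order[OF 1(2)]]
  show ?case
  proof (rule Partial_orderI)
    show "(m, m) \<in> Hom (Variety S \<Gamma>) A B" if "m \<in> Field (Hom (Variety S \<Gamma>) A B)" for m
    proof -
      have "m \<in> arrows (Variety S \<Gamma>) A B" using that 1 by (simp add: arrows_def)
      then obtain f where f: "m = (A, f, B)" "f \<in> monotone_homs S A B" by (auto simp: arrows_Variety)
      then show ?thesis
        using oB(1) monotone_mapsD(1)[OF monotone_homsD(1)[OF f(2)]] unfolding Hom_Variety by simp
    qed
    show "(m, k) \<in> Hom (Variety S \<Gamma>) A B" if "(m, n) \<in> Hom (Variety S \<Gamma>) A B" "(n, k) \<in> Hom (Variety S \<Gamma>) A B" for m n k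
      using that oB(2) unfolding Hom_Variety by (elim exE conjE) (simp, blast)
    show "m = n" if mn: "(m, n) \<in> Hom (Variety S \<Gamma>) A B" and nm: "(n, m) \<in> Hom (Variety S \<Gamma>) A B" for m n
    proof -
      obtain f g where fg: "m = (A, f, B)" "n = (A, g, B)" "f \<in> monotone_homs S A B" "g \<in> monotone_homs S A B"
        "\<And>x. x \<in> Field (under A) \<Longrightarrow> (f x, g x) \<in> under B" using mn by (auto simp: Hom_Variety)
      have "\<And>x. x \<in> Field (under A) \<Longrightarrow> (g x, f x) \<in> under B" using nm fg(1,2) by (auto simp: Hom_Variety)
      then have "f = g"
        using fg(5) oB(3)
        by (intro monotone_maps_ext[OF monotone_homsD(1)[OF fg(3)] monotone_homsD(1)[OF fg(4)]]) blast
      then show ?thesis using fg by simp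
    qed
  qed
next
  case (2 f A B A' B')
  then show ?case by (auto simp: arrows_Variety)
next
  case (3 A)
  then show ?case using id_hom by (auto simp: arrows_Variety Idt_Variety Obj_Variety)
next
  case (4 m A B n C)
  then show ?case using compose_homs by (auto simp: arrows_Variety Cmp_Variety Obj_Variety)
next
  case (5 m A B)
  then obtain f where f: "m = (A, f, B)" "f \<in> monotone_homs S A B" by (auto simp: arrows_Variety)
  have "compose (Field (under A)) f (\<lambda>x \<in> Field (under A). x) = f"
    by (rule monotone_maps_ext[OF compose_monotone[OF id_monotone monotone_homsD(1)[OF f(2)]] monotone_homsD(1)[OF f(2)]])
      (simp add: compose_eq)
  then show ?case by (simp add: f Idt_Variety Cmp_Variety)
next
  case (6 m A B)
  then obtain f where f: "m = (A, f, B)" "f \<in> monotone_homs S A B" by (auto simp: arrows_Variety)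
  have "compose (Field (under A)) (\<lambda>x \<in> Field (under B). x) f = f"
    by (rule monotone_maps_ext[OF compose_monotone[OF monotone_homsD(1)[OF f(2)] id_monotone] monotone_homsD(1)[OF f(2)]])
      (simp add: compose_eq monotone_mapsD(1)[OF monotone_homsD(1)[OF f(2)]])
  then show ?case by (simp add: f Idt_Variety Cmp_Variety)
next
  case (7 m A B n C k D)
  then obtain f g h where f: "m = (A, f, B)" "f \<in> monotone_homs S A B" and g: "n = (B, g, C)" and h: "k = (C, h, D)"
    by (auto simp: arrows_Variety)
  have "compose (Field (under A)) (compose (Field (under B)) h g) f = compose (Field (under A)) h (compose (Field (under A)) g f)"
    using monotone_mapsD(1)[OF monotone_homsD(1)[OF f(2)]] by (auto simp: compose_def)
  then show ?case by (simp add: f g h Cmp_Variety)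
next
  case (8 A B C m m' n n')
  obtain f f' where f: "m = (A, f, B)" "m' = (A, f', B)" "f \<in> monotone_homs S A B" "f' \<in> monotone_homs S A B"
    "\<And>x. x \<in> Field (under A) \<Longrightarrow> (f x, f' x) \<in> under B" using 8(4) by (auto simp: Hom_Variety)
  obtain g g' where g: "n = (B, g, C)" "n' = (B, g', C)" "g \<in> monotone_homs S B C" "g' \<in> monotone_homs S B C"
    "\<And>x. x \<in> Field (under B) \<Longrightarrow> (g x, g' x) \<in> under C" using 8(5) by (auto simp: Hom_Variety)
  have A: "ordered_algebra S A" using 8(1) by (simp add: Obj_Variety)
  have "(g (f x), g' (f' x)) \<in> under C" if x: "x \<in> Field (under A)" for x
  proof -
    have "(g (f x), g (f' x)) \<in> under C" by (rule monotone_mapsD(2)[OF monotone_homsD(1)[OF g(3)] f(5)[OF x]])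
    moreover have "(g (f' x), g' (f' x)) \<in> under C"
      by (rule g(5)[OF monotone_mapsD(1)[OF monotone_homsD(1)[OF f(4)] x]])
    ultimately show ?thesis using Partial_orderD(2)[OF Obj_Variety_order[OF 8(3)]] by blast
  qed
  then show ?case
    using compose_homs[OF A f(3) g(3)] compose_homs[OF A f(4) g(4)]
    by (simp add: f g Cmp_Variety Hom_Variety compose_eq)
qed

text \<open>As \<open>U\<close> equals \<open>Underlying\<close> after \<open>E\<close> strictly,
  \<open>ob E X\<close> has the underlying poset of \<open>X\<close> itself, and
  \<open>ar E f\<close> has the underlying function of \<open>f\<close>. So \<open>ob E\<close>
  serves as the algebra structure on objects of \<open>K\<close>.\<close>

lemma algebraic_of_equivalent:
  fixes K :: "('o, 'm) pcat" and U :: "('o, 'm, 'u rel, 'u pos_arrow) pfunctor"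
  assumes univ: "universe (UNIV :: 'u set)" and conc: "concrete_category K U"
    and S: "is_signature (S :: 'u signature)" and \<Gamma>: "are_inequations S \<Gamma>"
    and eqv: "concretely_equivalent K U (Variety S \<Gamma>) Underlying"
  shows "\<exists>alg. algebraic K U UNIV S \<Gamma> alg"
proof -
  obtain E where E: "equivalence K (Variety S \<Gamma>) E" and UE: "functor_eq K U (comp_functor Underlying E)"
    using eqv unfolding concretely_equivalent_def by blast
  interpret concrete K U by (rule concreteI[OF conc])
  note K = pos_category_axioms and V = pos_category_Variety[of S \<Gamma>]
  have EF: "enriched_functor K (Variety S \<Gamma>) E" using E by (simp add: equivalence_def)
  have EO: "ob E X \<in> Obj (Variety S \<Gamma>)" if "X \<in> Obj K" for X using enriched_functorD(1)[OF EF that] .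
  have und: "under (ob E X) = und X" if "X \<in> Obj K" for X
    using UE that by (simp add: functor_eq_def comp_functor_def Underlying_def)
  have ar_E: "ar E f = (ob E X, fn f, ob E Y) \<and> fn f \<in> monotone_homs S (ob E X) (ob E Y)"
    if f: "f \<in> arrows K X Y" for f X Y
  proof -
    obtain h where h: "ar E f = (ob E X, h, ob E Y)" "h \<in> monotone_homs S (ob E X) (ob E Y)"
      using functor_arrow[OF K EF f] by (auto simp: arrows_Variety)
    have "ar U f = ar Underlying (ar E f)"
      using UE f unfolding functor_eq_def comp_functor_def by simp
    then have "fn f = h" by (simp add: h fn_def Underlying_def)
    then show ?thesis using h by simp
  qed
  have "algebraic K U UNIV S \<Gamma> (ob E)"
    unfolding algebraic_def algebraic_axioms_def
  proof (intro conjI allI impI)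
    show "concrete K U" by (rule concrete_axioms)
    show "universe (UNIV :: 'u set)" by (rule univ)
    show "is_signature S" "are_inequations S \<Gamma>" by (rule S \<Gamma>)+
    show "X \<in> Obj K \<Longrightarrow> ob E X \<in> Obj (Variety S \<Gamma>)" for X by (rule EO)
    show "X \<in> Obj K \<Longrightarrow> under (ob E X) = und X" for X by (rule und)
    show "f \<in> arrows K X Y \<Longrightarrow> fn f \<in> monotone_homs S (ob E X) (ob E Y)" for f X Y using ar_E by blast
  next
    fix X Y h assume X: "X \<in> Obj K" and Y: "Y \<in> Obj K" and h: "h \<in> monotone_homs S (ob E X) (ob E Y)"
    have "(ob E X, h, ob E Y) \<in> arrows (Variety S \<Gamma>) (ob E X) (ob E Y)"
      using EO[OF X] EO[OF Y] h by (auto simp: arrows_Variety)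
    then obtain f where f: "f \<in> arrows K X Y" "ar E f = (ob E X, h, ob E Y)"
      using equivalence_full[OF K V E X Y] by blast
    then show "\<exists>f \<in> arrows K X Y. fn f = h" using ar_E[OF f(1)] by auto
  next
    fix A assume A: "A \<in> Obj (Variety S \<Gamma>)"
    obtain X j where X: "X \<in> Obj K" and "is_iso (Variety S \<Gamma>) (ob E X) A j"
      using equivalence_ess_surj[OF E A] by blast
    then obtain i where ji: "j \<in> arrows (Variety S \<Gamma>) (ob E X) A" "i \<in> arrows (Variety S \<Gamma>) A (ob E X)"
      "i \<odot>\<^bsub>Variety S \<Gamma>\<^esub> j = Idt (Variety S \<Gamma>) (ob E X)" "j \<odot>\<^bsub>Variety S \<Gamma>\<^esub> i = Idt (Variety S \<Gamma>) A"
      using is_isoE by metis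
    obtain f where f: "j = (ob E X, f, A)" "f \<in> monotone_homs S (ob E X) A" using ji(1) by (auto simp: arrows_Variety)
    obtain g where g: "i = (A, g, ob E X)" "g \<in> monotone_homs S A (ob E X)" using ji(2) by (auto simp: arrows_Variety)
    note fm = monotone_homsD(1)[OF f(2)] and gm = monotone_homsD(1)[OF g(2)]
    have "compose (Field (und X)) g f = (\<lambda>x \<in> Field (und X). x)" "compose (Field (under A)) f g = (\<lambda>x \<in> Field (under A). x)"
      using ji(3,4) by (simp_all add: f g Cmp_Variety Idt_Variety und[OF X])
    from fun_cong[OF this(1)] fun_cong[OF this(2)]
    have gf: "x \<in> Field (und X) \<Longrightarrow> g (f x) = x" and fg: "y \<in> Field (under A) \<Longrightarrow> f (g y) = y" for x y
      unfolding compose_def restrict_def by metis+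
    show "\<exists>X \<in> Obj K. \<exists>j \<in> monotone_homs S A (ob E X). j ` Field (under A) = Field (und X) \<and>
      (\<forall>x \<in> Field (under A). \<forall>y \<in> Field (under A). (j x, j y) \<in> und X \<longrightarrow> (x, y) \<in> under A)"
    proof (intro bexI[OF _ X] bexI[OF _ g(2)] conjI ballI impI)
      show "g ` Field (under A) = Field (und X)"
      proof (intro equalityI subsetI)
        fix x assume x: "x \<in> Field (und X)"
        then have "f x \<in> Field (under A)" using monotone_mapsD(1)[OF fm] und[OF X] by simp
        then show "x \<in> g ` Field (under A)" using gf[OF x] by (metis imageI)
      qed (use monotone_mapsD(1)[OF gm] und[OF X] in auto)
      show "(x, y) \<in> under A" if "x \<in> Field (under A)" "y \<in> Field (under A)" "(g x, g y) \<in> und X" for x y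
        using monotone_mapsD(2)[OF fm, of "g x" "g y"] that fg und[OF X] by simp
    qed
  qed
  then show ?thesis by blast
qed

lemma (in algebraic) algebraic_properties:
  "(has_tensors (TYPE('u)) K \<and> has_subkernel_pairs K \<and> has_reflexive_coinserters K) \<and>
   (finitary (TYPE('u)) K Pos U \<and> right_adjoint K Pos U \<and> reflects_isos K Pos U \<and>
    preserves_reflexive_coinserters K Pos U)"
  using alg_tensors alg_subkernel_pairs alg_reflexive_coinserters alg_finitary
    free_right_adjoint[OF free_exists] alg_reflects_isos alg_preserves_reflexive_coinserters by blast

section \<open>From a category to a variety\<close>

lemma geval_cong: "(\<And>x. x \<in> set2_gterm t \<Longrightarrow> v x = w x) \<Longrightarrow> geval p v t = geval p w t"
proof (induction t)
  case (GApp f ts)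
  then have "map (geval p v) ts = map (geval p w) ts" by fastforce
  then show ?case by (simp only: geval.simps)
qed simp

lemma finite_gvars: "finite (set2_gterm t)"
  by (induction t) auto

lemma is_gterm_vars: "is_gterm S V t \<Longrightarrow> set2_gterm t \<subseteq> V"
  by (induction t) auto

primrec trm_of :: "('v \<Rightarrow> nat) \<Rightarrow> ('u, 'v) gterm \<Rightarrow> 'u trm" where
  "trm_of i (GVar x) = Var (i x)"
| "trm_of i (GApp f ts) = App f (map (trm_of i) ts)"

lemma is_term_trm_of: "is_gterm S V t \<Longrightarrow> is_term S (trm_of i t)"
  by (induction t) auto

lemma eval_trm_of: "eval_term A v (trm_of i t) = geval (oper A) (\<lambda>x. v (i x)) t"
  by (induction t) (auto simp: comp_def cong: map_cong)

lemma Field_Id_on [simp]: "Field (Id_on A) = A"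
  by (auto simp: Field_def)

lemma Id_on_Pos: "small A \<Longrightarrow> Id_on A \<in> Obj Pos"
proof -
  have "Partial_order (Id_on A)" by (rule Partial_orderI) auto
  then show "small A \<Longrightarrow> Id_on A \<in> Obj Pos" by (simp add: Obj_Pos)
qed

lemma variety_isoI:
  assumes A: "A \<in> Obj (Variety S \<Gamma>)" and B: "B \<in> Obj (Variety S \<Gamma>)" and j: "j \<in> monotone_homs S A B"
    and surj: "Field (under B) \<subseteq> j ` Field (under A)"
    and refl: "\<And>x y. x \<in> Field (under A) \<Longrightarrow> y \<in> Field (under A) \<Longrightarrow> (j x, j y) \<in> under B \<Longrightarrow> (x, y) \<in> under A"
  shows "is_iso (Variety S \<Gamma>) A B (A, j, B)"
proof -
  note oA = Partial_orderD[OF Obj_Variety_order[OF A]] and oB = Partial_orderD[OF Obj_Variety_order[OF B]]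
  have AA: "ordered_algebra S A" using A by (simp add: Obj_Variety)
  note jm = monotone_homsD(1)[OF j] and jh = monotone_homsD(2)[OF j]
  let ?i = "inv_into (Field (under A)) j"
  let ?m = "restrict ?i (Field (under B))"
  have i: "?i y \<in> Field (under A)" "j (?i y) = y" if "y \<in> Field (under B)" for y
    using that surj by (auto intro: inv_into_into f_inv_into_f)
  have inj: "x = y" if "x \<in> Field (under A)" "y \<in> Field (under A)" "j x = j y" for x y
    using refl[OF that(1,2)] refl[OF that(2,1)] oB(1)[OF monotone_mapsD(1)[OF jm that(1)]] that(3) oA(3) by simp
  have m: "?m \<in> monotone_homs S B A"
  proof (rule monotone_homsI)
    show "?m \<in> monotone_maps (under B) (under A)"
    proof (rule monotone_mapsI)
      fix x y assume xy: "(x, y) \<in> under B"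
      show "(?i x, ?i y) \<in> under A"
        using refl[OF i(1)[OF FieldI1[OF xy]] i(1)[OF FieldI2[OF xy]]] i(2)[OF FieldI1[OF xy]] i(2)[OF FieldI2[OF xy]] xy by simp
    qed
    fix \<sigma> ys assume \<sigma>: "\<sigma> \<in> S (length ys)" and ys: "set ys \<subseteq> Field (under B)"
    obtain xs where xs: "ys = map j xs" "set xs \<subseteq> Field (under A)"
      using ys surj by (meson order_trans set_subset_imageE)
    have ij: "?i (j x) = x" if "x \<in> Field (under A)" for x
      using inj i monotone_mapsD(1)[OF jm that] that by blast
    have \<sigma>': "\<sigma> \<in> S (length xs)" using \<sigma> xs(1) by simp
    have eq: "map ?m ys = xs"
      unfolding xs(1) using xs(2) ij monotone_mapsD(1)[OF jm] by (induction xs) auto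
    have "oper B \<sigma> ys = j (oper A \<sigma> xs)" using jh[OF \<sigma>' xs(2)] xs(1) by simp
    then show "?m (oper B \<sigma> ys) = oper A \<sigma> (map ?m ys)"
      unfolding eq using ij ordered_algebraD(3)[OF AA \<sigma>' xs(2)] monotone_mapsD(1)[OF jm] by simp
  qed
  note mm = monotone_homsD(1)[OF m]
  have "compose (Field (under A)) ?m j = (\<lambda>x \<in> Field (under A). x)"
    by (rule monotone_maps_ext[OF compose_monotone[OF jm mm] id_monotone])
      (use inj i monotone_mapsD(1)[OF jm] in \<open>simp add: compose_eq\<close>)
  moreover have "compose (Field (under B)) j ?m = (\<lambda>x \<in> Field (under B). x)"
    by (rule monotone_maps_ext[OF compose_monotone[OF mm jm] id_monotone]) (simp add: compose_eq i)
  ultimately show ?thesis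
    unfolding is_iso_def using A B j m
    by (auto simp: arrows_Variety Cmp_Variety Idt_Variety intro!: bexI[of _ "(B, ?m, A)"])
qed

locale varietal = concrete K U + universe univ
  for K :: "('o, 'm) pcat" (structure) and U :: "('o, 'm, 'u rel, 'u pos_arrow) pfunctor" and univ :: "'u set" +
  assumes rc: "has_reflexive_coinserters K" and fin: "finitary (TYPE('u)) K Pos U"
    and ra: "right_adjoint K Pos U" and ri: "reflects_isos K Pos U" and pc: "preserves_reflexive_coinserters K Pos U"
begin

section \<open>Free objects and transposes\<close>

definition F :: "'u rel \<Rightarrow> 'o" where "F P = (SOME T. \<exists>e. is_free P T e)"

definition \<eta> :: "'u rel \<Rightarrow> 'u \<Rightarrow> 'u" where "\<eta> P = (SOME e. is_free P (F P) e)"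

lemma is_free: assumes "P \<in> Obj Pos" shows "is_free P (F P) (\<eta> P)"
proof -
  have "\<exists>e. is_free P (F P) e"
    unfolding F_def by (rule someI_ex[OF right_adjoint_free[OF ra assms]])
  then show ?thesis unfolding \<eta>_def by (rule someI_ex)
qed

lemma F_Obj: "P \<in> Obj Pos \<Longrightarrow> F P \<in> Obj K"
  using is_free by (simp add: is_free_def)

lemma \<eta>_monotone: "P \<in> Obj Pos \<Longrightarrow> \<eta> P \<in> monotone_maps P (und (F P))"
  using is_free by (simp add: is_free_def)

lemmas \<eta>_closed = monotone_mapsD(1)[OF \<eta>_monotone]
lemmas \<eta>_mono = monotone_mapsD(2)[OF \<eta>_monotone]

lemma free_le:
  assumes "P \<in> Obj Pos" "f \<in> arrows K (F P) X" "g \<in> arrows K (F P) X"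
    "\<And>p. p \<in> Field P \<Longrightarrow> (fn f (\<eta> P p), fn g (\<eta> P p)) \<in> und X"
  shows "(f, g) \<in> Hom K (F P) X"
  using is_free[OF assms(1)] assms(2-4) unfolding is_free_def by blast

lemma free_eq:
  assumes P: "P \<in> Obj Pos" and f: "f \<in> arrows K (F P) X" and g: "g \<in> arrows K (F P) X"
    and eq: "\<And>p. p \<in> Field P \<Longrightarrow> fn f (\<eta> P p) = fn g (\<eta> P p)"
  shows "f = g"
proof -
  note X = arrows_Obj(2)[OF f]
  have r: "(fn g (\<eta> P p), fn g (\<eta> P p)) \<in> und X" if "p \<in> Field P" for p
    by (rule Partial_orderD(1)[OF und_order[OF X] fn_closed[OF g \<eta>_closed[OF P that]]])
  have "(f, g) \<in> Hom K (F P) X" by (rule free_le[OF P f g]) (simp add: eq r)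
  moreover have "(g, f) \<in> Hom K (F P) X" by (rule free_le[OF P g f]) (simp add: eq r)
  ultimately show ?thesis by (rule arrow_antisym[OF f])
qed

text \<open>The transpose of \<open>m\<close>. It is meaningful when \<open>m\<close> is monotone on
  \<open>P\<close>; values of \<open>m\<close> off \<open>Field P\<close> do not enter.\<close>

definition ext :: "'u rel \<Rightarrow> 'o \<Rightarrow> ('u \<Rightarrow> 'u) \<Rightarrow> 'm" where
  "ext P X m = (SOME f. f \<in> arrows K (F P) X \<and> (\<forall>p \<in> Field P. fn f (\<eta> P p) = m p))"

lemma ext:
  assumes P: "P \<in> Obj Pos" and X: "X \<in> Obj K" and m: "\<forall>p q. (p, q) \<in> P \<longrightarrow> (m p, m q) \<in> und X"
  shows "ext P X m \<in> arrows K (F P) X" "p \<in> Field P \<Longrightarrow> fn (ext P X m) (\<eta> P p) = m p"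
proof -
  have "restrict m (Field P) \<in> monotone_maps P (und X)" by (rule monotone_mapsI) (simp add: m)
  then have "\<exists>f \<in> arrows K (F P) X. \<forall>p \<in> Field P. fn f (\<eta> P p) = restrict m (Field P) p"
    using is_free[OF P] X unfolding is_free_def by blast
  then have "\<exists>f. f \<in> arrows K (F P) X \<and> (\<forall>p \<in> Field P. fn f (\<eta> P p) = m p)" by auto
  from someI_ex[OF this] show "ext P X m \<in> arrows K (F P) X" "p \<in> Field P \<Longrightarrow> fn (ext P X m) (\<eta> P p) = m p"
    by (auto simp: ext_def)
qed

lemma ext_disc:
  assumes A: "small A" and X: "X \<in> Obj K" and m: "m \<in> A \<rightarrow> Field (und X)"
  shows "ext (Id_on A) X m \<in> arrows K (F (Id_on A)) X" "a \<in> A \<Longrightarrow> fn (ext (Id_on A) X m) (\<eta> (Id_on A) a) = m a"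
proof -
  have "\<forall>p q. (p, q) \<in> Id_on A \<longrightarrow> (m p, m q) \<in> und X"
    using m Partial_orderD(1)[OF und_order[OF X]] by auto
  from ext[OF Id_on_Pos[OF A] X this]
  show "ext (Id_on A) X m \<in> arrows K (F (Id_on A)) X" "a \<in> A \<Longrightarrow> fn (ext (Id_on A) X m) (\<eta> (Id_on A) a) = m a"
    by auto
qed

text \<open>A finite arity must be a poset inside \<open>'u\<close>; it is realized as the discrete
  poset on the first \<open>n\<close> values of a fixed injection.\<close>

definition \<nu> :: "nat \<Rightarrow> 'u" where "\<nu> = (SOME f. inj f)"

lemma inj_\<nu>: "inj \<nu>"
proof -
  obtain f :: "nat \<Rightarrow> 'u" where "inj f" using infinite_countable_subset[OF infinite_univ] by blast
  then show ?thesis unfolding \<nu>_def by (rule someI[where P = inj])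
qed

abbreviation N :: "nat \<Rightarrow> 'u set" where "N n \<equiv> \<nu> ` {..<n}"

lemma small_finite: "finite A \<Longrightarrow> small (A :: 'u set)"
  by (simp add: small_iff_sm sm_countable countable_finite)

lemma small_N: "small (N n)" by (rule small_finite) simp

text \<open>By the Yoneda lemma, the elements of \<open>U F n\<close> correspond to the natural
  families of monotone maps from \<open>n\<close>-tuples in \<open>U X\<close> to
  \<open>U X\<close>, that is, to all \<open>n\<close>-ary operations preserved by every arrow of
  \<open>K\<close>.\<close>

definition \<Sigma> :: "'u signature" where "\<Sigma> n = Field (und (F (Id_on (N n))))"

definition tuple :: "'o \<Rightarrow> 'u list \<Rightarrow> 'm" where
  "tuple X xs = ext (Id_on (N (length xs))) X (\<lambda>a. xs ! inv \<nu> a)"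

lemma tuple:
  assumes X: "X \<in> Obj K" and xs: "set xs \<subseteq> Field (und X)"
  shows "tuple X xs \<in> arrows K (F (Id_on (N (length xs)))) X"
    and "i < length xs \<Longrightarrow> fn (tuple X xs) (\<eta> (Id_on (N (length xs))) (\<nu> i)) = xs ! i"
proof -
  have m: "(\<lambda>a. xs ! inv \<nu> a) \<in> N (length xs) \<rightarrow> Field (und X)"
    using xs inj_\<nu> by auto
  show "tuple X xs \<in> arrows K (F (Id_on (N (length xs)))) X"
    unfolding tuple_def by (rule ext_disc(1)[OF small_N X m])
  show "i < length xs \<Longrightarrow> fn (tuple X xs) (\<eta> (Id_on (N (length xs))) (\<nu> i)) = xs ! i"
    unfolding tuple_def using ext_disc(2)[OF small_N X m, of "\<nu> i"] inj_\<nu> by simp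
qed

lemma tuple_eqI:
  assumes X: "X \<in> Obj K" and xs: "set xs \<subseteq> Field (und X)" and g: "g \<in> arrows K (F (Id_on (N (length xs)))) X"
    and eq: "\<And>i. i < length xs \<Longrightarrow> fn g (\<eta> (Id_on (N (length xs))) (\<nu> i)) = xs ! i"
  shows "g = tuple X xs"
  by (rule free_eq[OF Id_on_Pos[OF small_N] g tuple(1)[OF X xs]]) (use eq tuple(2)[OF X xs] in auto)

section \<open>The algebra carried by an object\<close>

definition alg :: "'o \<Rightarrow> 'u ordered_alg" where
  "alg X = \<lparr>under = und X,
    oper = (\<lambda>\<sigma> xs. if \<sigma> \<in> \<Sigma> (length xs) \<and> set xs \<subseteq> Field (und X) then fn (tuple X xs) \<sigma> else undefined)\<rparr>"

lemma under_alg [simp]: "under (alg X) = und X"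
  by (simp add: alg_def)

lemma opr: "\<sigma> \<in> \<Sigma> (length xs) \<Longrightarrow> set xs \<subseteq> Field (und X) \<Longrightarrow> oper (alg X) \<sigma> xs = fn (tuple X xs) \<sigma>"
  by (simp add: alg_def)

lemma alg_ordered: assumes X: "X \<in> Obj K" shows "ordered_algebra \<Sigma> (alg X)"
  unfolding ordered_algebra_def under_alg
proof (intro conjI allI impI)
  show "und X \<in> Obj Pos" by (rule und_Obj[OF X])
  show "oper (alg X) \<sigma> xs \<in> Field (und X)" if "\<sigma> \<in> \<Sigma> (length xs) \<and> set xs \<subseteq> Field (und X)" for \<sigma> xs
    using that fn_closed[OF tuple(1)[OF X]] by (simp add: opr \<Sigma>_def)
  show "oper (alg X) \<sigma> xs = undefined" if "\<not> (\<sigma> \<in> \<Sigma> (length xs) \<and> set xs \<subseteq> Field (und X))" for \<sigma> xs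
    using that by (auto simp: alg_def)
  fix \<sigma> xs ys assume a: "\<sigma> \<in> \<Sigma> (length xs) \<and> list_all2 (\<lambda>x y. (x, y) \<in> und X) xs ys"
  then have xs: "set xs \<subseteq> Field (und X)" and ys: "set ys \<subseteq> Field (und X)" and l: "length xs = length ys"
    using list_all2_Field[of "und X" xs ys] by auto
  note ty = tuple[OF X ys, folded l]
  have "(tuple X xs, tuple X ys) \<in> Hom K (F (Id_on (N (length xs)))) X"
    by (rule free_le[OF Id_on_Pos[OF small_N] tuple(1)[OF X xs] ty(1)])
      (use a tuple(2)[OF X xs] ty(2) in \<open>auto simp: list_all2_conv_all_nth\<close>)
  then show "(oper (alg X) \<sigma> xs, oper (alg X) \<sigma> ys) \<in> und X"
    using a l opr[OF _ xs] opr[OF _ ys] unfolding Hom_iff[OF tuple(1)[OF X xs] ty(1)] by (simp add: \<Sigma>_def)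
qed

lemma opr_closed: "X \<in> Obj K \<Longrightarrow> \<sigma> \<in> \<Sigma> (length xs) \<Longrightarrow> set xs \<subseteq> Field (und X) \<Longrightarrow> oper (alg X) \<sigma> xs \<in> Field (und X)"
  using ordered_algebraD(3)[OF alg_ordered] by simp

text \<open>Composition with \<open>f\<close> sends the transpose of a tuple to the transpose of its
  image, by uniqueness of transposes; evaluated at \<open>\<sigma>\<close> this is the homomorphism
  law.\<close>

lemma fn_hom: assumes f: "f \<in> arrows K X Y" shows "fn f \<in> monotone_homs \<Sigma> (alg X) (alg Y)"
proof (rule monotone_homsI, unfold under_alg)
  show "fn f \<in> monotone_maps (und X) (und Y)" by (rule ar_U(2)[OF f])
  fix \<sigma> xs assume \<sigma>: "\<sigma> \<in> \<Sigma> (length xs)" and xs: "set xs \<subseteq> Field (und X)"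
  have X: "X \<in> Obj K" and Y: "Y \<in> Obj K" using arrows_Obj[OF f] by auto
  have ys: "set (map (fn f) xs) \<subseteq> Field (und Y)" using xs fn_closed[OF f] by auto
  note t = tuple[OF X xs]
  have "f \<odot> tuple X xs = tuple Y (map (fn f) xs)"
  proof (rule tuple_eqI[OF Y ys])
    show "f \<odot> tuple X xs \<in> arrows K (F (Id_on (N (length (map (fn f) xs))))) Y"
      using comp_arrow[OF t(1) f] by simp
    show "fn (f \<odot> tuple X xs) (\<eta> (Id_on (N (length (map (fn f) xs)))) (\<nu> i)) = map (fn f) xs ! i"
      if "i < length (map (fn f) xs)" for i
      using that fn_comp[OF t(1) f \<eta>_closed[OF Id_on_Pos[OF small_N], where x = "\<nu> i"]] t(2) by simp
  qed
  then show "fn f (oper (alg X) \<sigma> xs) = oper (alg Y) \<sigma> (map (fn f) xs)"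
    using fn_comp[OF t(1) f, of \<sigma>] \<sigma> xs ys by (simp add: opr \<Sigma>_def)
qed

section \<open>Terms, laws and generation of free objects\<close>

lemma geval_closed:
  assumes "ordered_algebra \<Sigma> A" "is_gterm \<Sigma> V t" "v \<in> V \<rightarrow> Field (under A)"
  shows "geval (oper A) v t \<in> Field (under A)"
proof -
  have v: "v ` V \<subseteq> Field (under A)" using assms(3) by auto
  show ?thesis
    by (rule conjunct1[OF geval_hom[OF assms(2) v, of "oper A" "\<lambda>x. x" "oper A"]])
      (simp_all add: ordered_algebraD(3)[OF assms(1)])
qed

lemma hom_geval:
  assumes "ordered_algebra \<Sigma> A" "h \<in> monotone_homs \<Sigma> A B" "is_gterm \<Sigma> V t" "v \<in> V \<rightarrow> Field (under A)"
  shows "h (geval (oper A) v t) = geval (oper B) (\<lambda>x. h (v x)) t"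
proof -
  have v: "v ` V \<subseteq> Field (under A)" using assms(4) by auto
  show ?thesis
    by (rule conjunct2[OF geval_hom[OF assms(3) v, of "oper A" h "oper B"]])
      (simp_all add: ordered_algebraD(3)[OF assms(1)] monotone_homsD(2)[OF assms(2)])
qed

definition \<Gamma> :: "('u trm \<times> 'u trm) set" where
  "\<Gamma> = {(s, t). is_term \<Sigma> s \<and> is_term \<Sigma> t \<and> (\<forall>X \<in> Obj K. satisfies (alg X) (s, t))}"

lemma alg_Obj: "X \<in> Obj K \<Longrightarrow> alg X \<in> Obj (Variety \<Sigma> \<Gamma>)"
  unfolding Obj_Variety using alg_ordered by (auto simp: \<Gamma>_def)

text \<open>
  An inequation between terms over \<open>A\<close> holds in the free object on the discrete poset \<open>A\<close> only
  if it holds in every \<open>X\<close>, i.e., belongs to \<open>\<Gamma>\<close> after renaming its finitely many variables.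
\<close>

lemma free_inequation:
  assumes A: "small A" and s: "is_gterm \<Sigma> A s" and t: "is_gterm \<Sigma> A t"
    and C: "C \<in> Obj (Variety \<Sigma> \<Gamma>)" and m: "m \<in> A \<rightarrow> Field (under C)"
    and le: "(geval (oper (alg (F (Id_on A)))) (\<eta> (Id_on A)) s, geval (oper (alg (F (Id_on A)))) (\<eta> (Id_on A)) t)
      \<in> und (F (Id_on A))"
  shows "(geval (oper C) m s, geval (oper C) m t) \<in> under C"
proof -
  let ?V = "set2_gterm s \<union> set2_gterm t"
  note AP = Id_on_Pos[OF A] and FA = F_Obj[OF Id_on_Pos[OF A]]
  have CC: "ordered_algebra \<Sigma> C" using C by (simp add: Obj_Variety)
  have V: "?V \<subseteq> A" using is_gterm_vars[OF s] is_gterm_vars[OF t] by simp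
  obtain i :: "'u \<Rightarrow> nat" where i: "inj_on i ?V"
    using finite_imp_inj_to_nat_seg[of ?V] finite_gvars by auto
  have "satisfies (alg X) (trm_of i s, trm_of i t)" if X: "X \<in> Obj K" for X
    unfolding satisfies_def fst_conv snd_conv eval_trm_of under_alg
  proof (intro allI impI)
    fix w :: "nat \<Rightarrow> 'u" assume "range w \<subseteq> Field (und X)"
    then have w: "(\<lambda>a. w (i a)) \<in> A \<rightarrow> Field (und X)" by auto
    let ?g = "ext (Id_on A) X (\<lambda>a. w (i a))"
    note g = ext_disc[OF A X w]
    have "geval (oper (alg X)) (\<lambda>a. w (i a)) r = fn ?g (geval (oper (alg (F (Id_on A)))) (\<eta> (Id_on A)) r)"
      if r: "is_gterm \<Sigma> A r" for r
    proof -
      have "fn ?g (geval (oper (alg (F (Id_on A)))) (\<eta> (Id_on A)) r) = geval (oper (alg X)) (\<lambda>a. fn ?g (\<eta> (Id_on A) a)) r"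
        by (rule hom_geval[OF alg_ordered[OF FA] fn_hom[OF g(1)] r]) (auto simp: \<eta>_closed[OF AP])
      also have "\<dots> = geval (oper (alg X)) (\<lambda>a. w (i a)) r"
        by (rule geval_cong, rule g(2)) (use is_gterm_vars[OF r] in blast)
      finally show ?thesis by simp
    qed
    then show "(geval (oper (alg X)) (\<lambda>a. w (i a)) s, geval (oper (alg X)) (\<lambda>a. w (i a)) t) \<in> und X"
      using fn_mono[OF g(1) le] s t by simp
  qed
  then have "(trm_of i s, trm_of i t) \<in> \<Gamma>"
    using is_term_trm_of[OF s] is_term_trm_of[OF t] by (simp add: \<Gamma>_def)
  then have sat: "satisfies C (trm_of i s, trm_of i t)" using C by (simp add: Obj_Variety)
  \<comment> \<open>Numbers that do not code a variable need a value in the carrier of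
    \<open>C\<close> as well. The terms may be closed and \<open>A\<close> empty, so the value of
    \<open>s\<close> is the element at hand.\<close>
  define v where "v n = (if n \<in> i ` ?V then m (inv_into ?V i n) else geval (oper C) m s)" for n
  have "v n \<in> Field (under C)" for n
  proof (cases "n \<in> i ` ?V")
    case True
    then have "inv_into ?V i n \<in> A" using V inv_into_into[of n i ?V] by blast
    then show ?thesis using True m by (auto simp: v_def)
  qed (use geval_closed[OF CC s m] in \<open>simp add: v_def\<close>)
  then have "(geval (oper C) (\<lambda>x. v (i x)) s, geval (oper C) (\<lambda>x. v (i x)) t) \<in> under C"
    using sat unfolding satisfies_def fst_conv snd_conv eval_trm_of by blast
  moreover have "v (i x) = m x" if "x \<in> ?V" for x
    using that by (simp add: v_def inv_into_f_f[OF i])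
  then have "geval (oper C) (\<lambda>x. v (i x)) s = geval (oper C) m s" "geval (oper C) (\<lambda>x. v (i x)) t = geval (oper C) m t"
    by (auto intro: geval_cong)
  ultimately show ?thesis by simp
qed

text \<open>
  The set \<open>A\<close> is the directed union of its finite subsets, and the finitary functor \<open>U\<close>
  preserves the corresponding colimit of free objects.
\<close>

lemma free_finite_support:
  assumes A: "small A" and y: "y \<in> Field (und (F (Id_on A)))"
  shows "\<exists>B x. finite B \<and> B \<subseteq> A \<and> x \<in> Field (und (F (Id_on B))) \<and>
    y = fn (ext (Id_on B) (F (Id_on A)) (\<eta> (Id_on A))) x"
proof -
  let ?F = "\<lambda>B. F (Id_on B)" and ?e = "\<lambda>B. \<eta> (Id_on B)"
  have FO: "?F B \<in> Obj K" if "small B" for B using F_Obj[OF Id_on_Pos[OF that]] .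
  have ec: "?e B b \<in> Field (und (?F B))" if "small B" "b \<in> B" for B b
    using \<eta>_closed[OF Id_on_Pos[OF that(1)]] that(2) by simp
  have smB: "small B" if "B \<in> Fpow A" for B using that small_finite by (simp add: Fpow_def)
  \<comment> \<open>\<open>finitary\<close> speaks of index posets inside \<open>'u\<close>, so the
    finite subsets of \<open>A\<close> have to be coded by elements.\<close>
  have "sm (Fpow A)" using sm_Fpow A by (simp add: small_iff_sm)
  then obtain enc :: "'u set \<Rightarrow> 'u" where enc: "inj_on enc (Fpow A)" by (rule sm_embed)
  define dec where "dec = inv_into (Fpow A) enc"
  have dec: "dec (enc B) = B" if "B \<in> Fpow A" for B using inv_into_f_f[OF enc that] by (simp add: dec_def)
  define I where "I = {(enc B, enc B') | B B'. B \<in> Fpow A \<and> B' \<in> Fpow A \<and> B \<subseteq> B'}"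
  have FI: "Field I = enc ` Fpow A" by (auto simp: I_def Field_def)
  have II: "(enc B, enc B') \<in> I \<longleftrightarrow> B \<subseteq> B'" if "B \<in> Fpow A" "B' \<in> Fpow A" for B B'
  proof
    assume "(enc B, enc B') \<in> I"
    then obtain C C' where "enc B = enc C" "enc B' = enc C'" "C \<in> Fpow A" "C' \<in> Fpow A" "C \<subseteq> C'"
      by (auto simp: I_def)
    then show "B \<subseteq> B'" using inj_onD[OF enc _ that(1)] inj_onD[OF enc _ that(2)] by metis
  qed (use that in \<open>auto simp: I_def\<close>)
  have IE: "\<exists>B B'. a = enc B \<and> b = enc B' \<and> B \<in> Fpow A \<and> B' \<in> Fpow A \<and> B \<subseteq> B'" if "(a, b) \<in> I" for a b
    using that by (auto simp: I_def)
  have dir: "directed_poset I"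
    unfolding directed_poset_def
  proof (intro conjI ballI)
    show "Partial_order I"
    proof (rule Partial_orderI)
      show "(x, x) \<in> I" if "x \<in> Field I" for x using that II by (auto simp: FI)
      show "(x, z) \<in> I" if xy: "(x, y) \<in> I" and yz: "(y, z) \<in> I" for x y z
      proof -
        obtain B B' where B: "x = enc B" "y = enc B'" "B \<in> Fpow A" "B' \<in> Fpow A" "B \<subseteq> B'" using IE[OF xy] by blast
        obtain C C' where C: "y = enc C" "z = enc C'" "C \<in> Fpow A" "C' \<in> Fpow A" "C \<subseteq> C'" using IE[OF yz] by blast
        have "B' = C" using inj_onD[OF enc _ B(4) C(3)] B(2) C(1) by simp
        then show ?thesis using B C II[OF B(3) C(4)] by auto
      qed
      show "x = y" if xy: "(x, y) \<in> I" and yx: "(y, x) \<in> I" for x y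
      proof -
        obtain B B' where B: "x = enc B" "y = enc B'" "B \<in> Fpow A" "B' \<in> Fpow A" "B \<subseteq> B'" using IE[OF xy] by blast
        then show ?thesis using yx II[OF B(4,3)] by auto
      qed
    qed
    show "Field I \<noteq> {}" unfolding FI by (auto simp: Fpow_def)
    fix a b assume "a \<in> Field I" "b \<in> Field I"
    then obtain B B' where B: "a = enc B" "b = enc B'" "B \<in> Fpow A" "B' \<in> Fpow A" by (auto simp: FI)
    then have "B \<union> B' \<in> Fpow A" by (auto simp: Fpow_def)
    then show "\<exists>z. (a, z) \<in> I \<and> (b, z) \<in> I" using B II by (intro exI[of _ "enc (B \<union> B')"]) auto
  qed
  have smI: "small (Field I)" unfolding FI small_iff_sm by (rule sm_image[OF \<open>sm (Fpow A)\<close>])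
  define d where "d a b = ext (Id_on (dec a)) (?F (dec b)) (?e (dec b))" for a b
  define c where "c a = ext (Id_on (dec a)) (?F A) (?e A)" for a
  have d: "d (enc B) (enc B') \<in> arrows K (?F B) (?F B')" "b \<in> B \<Longrightarrow> fn (d (enc B) (enc B')) (?e B b) = ?e B' b"
    if B: "B \<in> Fpow A" "B' \<in> Fpow A" "B \<subseteq> B'" for B B' b
  proof -
    have "?e B' \<in> B \<rightarrow> Field (und (?F B'))" using ec[OF smB[OF B(2)]] B(3) by auto
    from ext_disc[OF smB[OF B(1)] FO[OF smB[OF B(2)]] this]
    show "d (enc B) (enc B') \<in> arrows K (?F B) (?F B')" "b \<in> B \<Longrightarrow> fn (d (enc B) (enc B')) (?e B b) = ?e B' b"
      by (simp_all add: d_def dec[OF B(1)] dec[OF B(2)])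
  qed
  have c: "c (enc B) \<in> arrows K (?F B) (?F A)" "b \<in> B \<Longrightarrow> fn (c (enc B)) (?e B b) = ?e A b"
    if B: "B \<in> Fpow A" for B b
  proof -
    have "?e A \<in> B \<rightarrow> Field (und (?F A))" using ec[OF A] B by (auto simp: Fpow_def)
    from ext_disc[OF smB[OF B] FO[OF A] this] show "c (enc B) \<in> arrows K (?F B) (?F A)"
      "b \<in> B \<Longrightarrow> fn (c (enc B)) (?e B b) = ?e A b" by (auto simp: c_def dec[OF B])
  qed
  have uniq: "f = g" if B: "B \<in> Fpow A" and f: "f \<in> arrows K (?F B) X" and g: "g \<in> arrows K (?F B) X"
    and eq: "\<And>b. b \<in> B \<Longrightarrow> fn f (?e B b) = fn g (?e B b)" for B X f g
    by (rule free_eq[OF Id_on_Pos[OF smB[OF B]] f g]) (simp add: eq)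
  have dc: "is_diagram K I (\<lambda>a. ?F (dec a)) d"
    unfolding is_diagram_def
  proof (intro conjI ballI allI impI)
    fix a assume "a \<in> Field I"
    then obtain B where B: "a = enc B" "B \<in> Fpow A" by (auto simp: FI)
    show "?F (dec a) \<in> Obj K" using FO smB B dec by simp
    show "d a a = Idt K (?F (dec a))"
      unfolding B(1) dec[OF B(2)]
      by (rule uniq[OF B(2) d(1)[OF B(2,2) order_refl] id_arrow[OF FO[OF smB[OF B(2)]]]])
        (simp add: d(2)[OF B(2,2)] fn_id[OF FO[OF smB[OF B(2)]] ec[OF smB[OF B(2)]]])
  next
    fix z assume "z \<in> I"
    then show "case z of (i, j) \<Rightarrow> d i j \<in> arrows K (?F (dec i)) (?F (dec j))"
      using d(1) dec by (auto simp: I_def)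
  next
    fix i j k assume "(i, j) \<in> I \<and> (j, k) \<in> I"
    then obtain B B' B'' where B: "i = enc B" "j = enc B'" "k = enc B''" "B \<in> Fpow A" "B' \<in> Fpow A" "B'' \<in> Fpow A"
      "B \<subseteq> B'" "B' \<subseteq> B''"
    proof -
      obtain B B' where B: "i = enc B" "j = enc B'" "B \<in> Fpow A" "B' \<in> Fpow A" "B \<subseteq> B'"
        using IE \<open>(i, j) \<in> I \<and> (j, k) \<in> I\<close> by blast
      obtain C C' where C: "j = enc C" "k = enc C'" "C \<in> Fpow A" "C' \<in> Fpow A" "C \<subseteq> C'"
        using IE \<open>(i, j) \<in> I \<and> (j, k) \<in> I\<close> by blast
      have "B' = C" using inj_onD[OF enc _ B(4) C(3)] B(2) C(1) by simp
      then show ?thesis using that B C by blast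
    qed
    note d1 = d[OF B(4,5,7)] and d2 = d[OF B(5,6,8)] and d3 = d[OF B(4,6) order_trans[OF B(7,8)]]
    show "d i k = d j k \<odot> d i j"
      unfolding B(1-3)
    proof (rule uniq[OF B(4) d3(1) comp_arrow[OF d1(1) d2(1)]])
      fix b assume b: "b \<in> B"
      then show "fn (d (enc B) (enc B'')) (?e B b) = fn (d (enc B') (enc B'') \<odot> d (enc B) (enc B')) (?e B b)"
        using d1(2)[OF b] d2(2)[of b] d3(2)[OF b] B(7) fn_comp[OF d1(1) d2(1) ec[OF smB[OF B(4)] b]] by auto
    qed
  qed
  have cc: "is_cocone K I (\<lambda>a. ?F (dec a)) d (?F A) c"
    unfolding is_cocone_def
  proof (intro conjI ballI FO[OF A])
    show "c a \<in> arrows K (?F (dec a)) (?F A)" if "a \<in> Field I" for a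
      using that c(1) dec by (auto simp: FI)
    fix z assume "z \<in> I"
    then obtain B B' where B: "z = (enc B, enc B')" "B \<in> Fpow A" "B' \<in> Fpow A" "B \<subseteq> B'" by (auto simp: I_def)
    note dB = d[OF B(2,3,4)]
    have "c (enc B') \<odot> d (enc B) (enc B') = c (enc B)"
    proof (rule uniq[OF B(2) comp_arrow[OF dB(1) c(1)[OF B(3)]] c(1)[OF B(2)]])
      fix b assume b: "b \<in> B"
      then show "fn (c (enc B') \<odot> d (enc B) (enc B')) (?e B b) = fn (c (enc B)) (?e B b)"
        using dB(2)[OF b] c(2)[OF B(2) b] c(2)[OF B(3), of b] B(4) fn_comp[OF dB(1) c(1)[OF B(3)] ec[OF smB[OF B(2)] b]] by auto
    qed
    then show "case z of (i, j) \<Rightarrow> c j \<odot> d i j = c i" using B(1) by simp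
  qed
  have sing: "{a} \<in> Fpow A" if "a \<in> A" for a using that by (simp add: Fpow_def)
  have "is_colimit K I (\<lambda>a. ?F (dec a)) d (?F A) c"
    unfolding is_colimit_def
  proof (intro conjI allI ballI impI cc)
    fix Z e assume Z: "is_cocone K I (\<lambda>a. ?F (dec a)) d Z e"
    then have ZO: "Z \<in> Obj K" by (simp add: is_cocone_def)
    have e: "e (enc B) \<in> arrows K (?F B) Z" if "B \<in> Fpow A" for B
    proof -
      have "enc B \<in> Field I" using that by (simp add: FI)
      then have "e (enc B) \<in> arrows K (?F (dec (enc B))) Z" using Z unfolding is_cocone_def by blast
      then show ?thesis by (simp add: dec[OF that])
    qed
    \<comment> \<open>An arrow out of \<open>F (Id_on A)\<close> is given by its values at the
      generators, and the generator \<open>a\<close> already lives at the stage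
      \<open>{a}\<close>.\<close>
    let ?m = "\<lambda>a. fn (e (enc {a})) (?e {a} a)"
    have m: "?m \<in> A \<rightarrow> Field (und Z)"
      using fn_closed[OF e[OF sing] ec[OF smB[OF sing]]] by simp
    note g = ext_disc[OF A ZO m]
    have "ext (Id_on A) Z ?m \<odot> c (enc B) = e (enc B)" if B: "B \<in> Fpow A" for B
    proof (rule uniq[OF B comp_arrow[OF c(1)[OF B] g(1)] e[OF B]])
      fix b assume b: "b \<in> B"
      then have bA: "b \<in> A" and bB: "{b} \<subseteq> B" using B by (auto simp: Fpow_def)
      note d = d[OF sing[OF bA] B bB]
      have "(enc {b}, enc B) \<in> I" using II[OF sing[OF bA] B] bB by simp
      then have "e (enc B) \<odot> d (enc {b}) (enc B) = e (enc {b})" using Z unfolding is_cocone_def by blast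
      then have "?m b = fn (e (enc B)) (?e B b)"
        using fn_comp[OF d(1) e[OF B] ec[OF smB[OF sing[OF bA]], of b]] d(2)[of b] by simp
      then show "fn (ext (Id_on A) Z ?m \<odot> c (enc B)) (?e B b) = fn (e (enc B)) (?e B b)"
        using fn_comp[OF c(1)[OF B] g(1) ec[OF smB[OF B] b]] c(2)[OF B b] g(2)[OF bA] by simp
    qed
    then show "\<exists>g \<in> arrows K (?F A) Z. \<forall>i \<in> Field I. g \<odot> c i = e i"
      using g(1) by (intro bexI[of _ "ext (Id_on A) Z ?m"]) (auto simp: FI)
  next
    fix Z g g' assume g: "g \<in> arrows K (?F A) Z" and g': "g' \<in> arrows K (?F A) Z"
      and le: "\<forall>i \<in> Field I. (g \<odot> c i, g' \<odot> c i) \<in> Hom K (?F (dec i)) Z"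
    show "(g, g') \<in> Hom K (?F A) Z"
    proof (rule free_le[OF Id_on_Pos[OF A] g g'])
      fix a assume "a \<in> Field (Id_on A)"
      then have a: "a \<in> A" by simp
      note ca = c[OF sing[OF a]] and ea = ec[OF smB[OF sing[OF a]], of a]
      have "enc {a} \<in> Field I" using sing[OF a] by (simp add: FI)
      then have "(g \<odot> c (enc {a}), g' \<odot> c (enc {a})) \<in> Hom K (?F (dec (enc {a}))) Z" using le by blast
      then have "(fn (g \<odot> c (enc {a})) (?e {a} a), fn (g' \<odot> c (enc {a})) (?e {a} a)) \<in> und Z"
        using ea by (simp add: dec[OF sing[OF a]] Hom_iff[OF comp_arrow[OF ca(1) g] comp_arrow[OF ca(1) g']])
      then show "(fn g (?e A a), fn g' (?e A a)) \<in> und Z"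
        using fn_comp[OF ca(1) g ea] fn_comp[OF ca(1) g' ea] ca(2)[of a] by simp
    qed
  qed
  then have "is_colimit Pos I (\<lambda>a. und (?F (dec a))) (\<lambda>a b. ar U (d a b)) (und (?F A)) (\<lambda>a. ar U (c a))"
    using fin dir smI dc unfolding finitary_def by blast
  from this y obtain a x where a: "a \<in> Field I" "x \<in> Field (und (?F (dec a)))" "y = fst (snd (ar U (c a))) x"
    by (rule pos_colimit_surj)
  then obtain B where B: "a = enc B" "B \<in> Fpow A" by (auto simp: FI)
  then have "finite B" "B \<subseteq> A" "x \<in> Field (und (?F B))" "y = fn (ext (Id_on B) (?F A) (?e A)) x"
    using a dec[OF B(2)] by (simp_all add: fn_def c_def Fpow_def)
  then show ?thesis by blast
qed

text \<open>The element comes from the free object on a finite \<open>B\<close>. Enumerating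
  \<open>B\<close> makes this a retract of the free object on \<open>n\<close> generators, so the
  element is the image of some \<open>\<sigma>\<close> in \<open>\<Sigma> n\<close>. But that image
  is the operation \<open>\<sigma>\<close> applied to generators: a term with a single operation
  symbol suffices.\<close>

lemma generated_disc:
  assumes A: "small A" and y: "y \<in> Field (und (F (Id_on A)))"
  shows "\<exists>t. is_gterm \<Sigma> A t \<and> y = geval (oper (alg (F (Id_on A)))) (\<eta> (Id_on A)) t"
proof -
  let ?FA = "F (Id_on A)"
  note AP = Id_on_Pos[OF A] and FA = F_Obj[OF Id_on_Pos[OF A]]
  obtain B x where B: "finite B" "B \<subseteq> A" and x: "x \<in> Field (und (F (Id_on B)))"
    and yx: "y = fn (ext (Id_on B) ?FA (\<eta> (Id_on A))) x"
    using free_finite_support[OF assms] by blast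
  note smB = small_finite[OF B(1)]
  note BP = Id_on_Pos[OF smB] and FB = F_Obj[OF Id_on_Pos[OF smB]]
  obtain bs where bs: "set bs = B" "distinct bs" using finite_distinct_list[OF B(1)] by blast
  let ?n = "length bs"
  note NP = Id_on_Pos[OF small_N[of ?n]]
  have eB: "set (map (\<eta> (Id_on B)) bs) \<subseteq> Field (und (F (Id_on B)))" using \<eta>_closed[OF BP] bs by auto
  let ?k = "tuple (F (Id_on B)) (map (\<eta> (Id_on B)) bs)"
  have k: "?k \<in> arrows K (F (Id_on (N ?n))) (F (Id_on B))"
    "\<And>i. i < ?n \<Longrightarrow> fn ?k (\<eta> (Id_on (N ?n)) (\<nu> i)) = \<eta> (Id_on B) (bs ! i)"
    using tuple[OF FB eB] by simp_all
  have "\<forall>b \<in> B. \<exists>i. i < ?n \<and> bs ! i = b"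
    using bs(1) by (auto simp: in_set_conv_nth)
  then obtain ix where ix: "\<And>b. b \<in> B \<Longrightarrow> ix b < ?n \<and> bs ! ix b = b" by metis
  have "(\<lambda>b. \<eta> (Id_on (N ?n)) (\<nu> (ix b))) \<in> B \<rightarrow> Field (und (F (Id_on (N ?n))))"
    using \<eta>_closed[OF NP] ix by simp
  note l = ext_disc[OF smB F_Obj[OF NP] this]
  let ?l = "ext (Id_on B) (F (Id_on (N ?n))) (\<lambda>b. \<eta> (Id_on (N ?n)) (\<nu> (ix b)))"
  have "?k \<odot> ?l = Idt K (F (Id_on B))"
  proof (rule free_eq[OF BP comp_arrow[OF l(1) k(1)] id_arrow[OF FB]])
    fix b assume "b \<in> Field (Id_on B)"
    then have b: "b \<in> B" and eb: "\<eta> (Id_on B) b \<in> Field (und (F (Id_on B)))" using \<eta>_closed[OF BP] by auto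
    show "fn (?k \<odot> ?l) (\<eta> (Id_on B) b) = fn (Idt K (F (Id_on B))) (\<eta> (Id_on B) b)"
      using fn_comp[OF l(1) k(1) eb] l(2)[OF b] k(2) ix[OF b] fn_id[OF FB eb] by simp
  qed
  then have x': "x = fn ?k (fn ?l x)" using fn_comp[OF l(1) k(1) x] fn_id[OF FB x] by simp
  let ?\<sigma> = "fn ?l x"
  have \<sigma>: "?\<sigma> \<in> \<Sigma> ?n" using fn_closed[OF l(1) x] by (simp add: \<Sigma>_def)
  let ?c = "ext (Id_on B) ?FA (\<eta> (Id_on A))"
  have "\<eta> (Id_on A) \<in> B \<rightarrow> Field (und ?FA)" using \<eta>_closed[OF AP] B by auto
  note c = ext_disc[OF smB FA this]
  have "fn ?c x = oper (alg ?FA) ?\<sigma> (map (fn ?c) (map (\<eta> (Id_on B)) bs))"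
    using monotone_homsD(2)[OF fn_hom[OF c(1)], where f = ?\<sigma> and xs = "map (\<eta> (Id_on B)) bs"] \<sigma> eB x'
      opr[of ?\<sigma> "map (\<eta> (Id_on B)) bs" "F (Id_on B)"] by simp
  also have "map (fn ?c) (map (\<eta> (Id_on B)) bs) = map (geval (oper (alg ?FA)) (\<eta> (Id_on A))) (map GVar bs)"
    using c(2) bs(1) by simp
  finally have "y = geval (oper (alg ?FA)) (\<eta> (Id_on A)) (GApp ?\<sigma> (map GVar bs))" by (simp only: yx geval.simps)
  moreover have "is_gterm \<Sigma> A (GApp ?\<sigma> (map GVar bs))" using \<sigma> bs(1) B(2) by auto
  ultimately show ?thesis by blast
qed

text \<open>
  A poset \<open>P\<close> is the coinserter of the two projections to its carrier from the set of pairs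
  \<open>p \<le> q\<close>, viewed as discrete posets; the left adjoint preserves this coinserter.
\<close>

lemma free_presentation:
  assumes P: "P \<in> Obj Pos"
  shows "\<exists>A\<^sub>2 \<pi>\<^sub>0 \<pi>\<^sub>1 v\<^sub>0 v\<^sub>1 e. small A\<^sub>2 \<and> (\<forall>w \<in> A\<^sub>2. (\<pi>\<^sub>0 w, \<pi>\<^sub>1 w) \<in> P) \<and>
    v\<^sub>0 \<in> arrows K (F (Id_on A\<^sub>2)) (F (Id_on (Field P))) \<and> v\<^sub>1 \<in> arrows K (F (Id_on A\<^sub>2)) (F (Id_on (Field P))) \<and>
    (\<forall>w \<in> A\<^sub>2. fn v\<^sub>0 (\<eta> (Id_on A\<^sub>2) w) = \<eta> (Id_on (Field P)) (\<pi>\<^sub>0 w) \<and> fn v\<^sub>1 (\<eta> (Id_on A\<^sub>2) w) = \<eta> (Id_on (Field P)) (\<pi>\<^sub>1 w)) \<and>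
    e \<in> arrows K (F (Id_on (Field P))) (F P) \<and> (\<forall>p \<in> Field P. fn e (\<eta> (Id_on (Field P)) p) = \<eta> P p) \<and>
    fn e ` Field (und (F (Id_on (Field P)))) = Field (und (F P)) \<and>
    (\<forall>x \<in> Field (und (F (Id_on (Field P)))). \<forall>y \<in> Field (und (F (Id_on (Field P)))). (fn e x, fn e y) \<in> und (F P) \<longrightarrow>
      (x, y) \<in> coinserter_rel (und (F (Id_on A\<^sub>2))) (und (F (Id_on (Field P)))) (fn v\<^sub>0) (fn v\<^sub>1))"
proof -
  let ?A = "Field P"
  have PP: "Partial_order P" and A: "small ?A" using P by (auto simp: Obj_Pos)
  have "sm (?A \<times> ?A)" using sm_Sigma[of ?A "\<lambda>_. ?A"] A by (simp add: small_iff_sm)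
  then have smP: "sm P" by (rule sm_subset) (auto intro: FieldI1 FieldI2)
  then obtain enc :: "'u \<times> 'u \<Rightarrow> 'u" where enc: "inj_on enc P" by (rule sm_embed)
  let ?W = "enc ` P"
  have W: "small ?W" unfolding small_iff_sm by (rule sm_image[OF smP])
  define \<pi>0 where "\<pi>0 w = fst (inv_into P enc w)" for w
  define \<pi>1 where "\<pi>1 w = snd (inv_into P enc w)" for w
  have \<pi>: "\<pi>0 (enc (p, q)) = p" "\<pi>1 (enc (p, q)) = q" if "(p, q) \<in> P" for p q
    by (simp_all add: \<pi>0_def \<pi>1_def inv_into_f_f[OF enc that])
  have \<pi>P: "(\<pi>0 w, \<pi>1 w) \<in> P" if "w \<in> ?W" for w using that \<pi> by auto
  note AP = Id_on_Pos[OF A] and WP = Id_on_Pos[OF W]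
  let ?FA = "F (Id_on ?A)" and ?FW = "F (Id_on ?W)" and ?eA = "\<eta> (Id_on ?A)" and ?eW = "\<eta> (Id_on ?W)"
  note FA = F_Obj[OF AP] and FW = F_Obj[OF WP] and FP = F_Obj[OF P]
  have eA: "?eA p \<in> Field (und ?FA)" if "p \<in> ?A" for p using \<eta>_closed[OF AP] that by simp
  have eW: "?eW w \<in> Field (und ?FW)" if "w \<in> ?W" for w using \<eta>_closed[OF WP] that by simp
  have "(\<lambda>w. ?eA (\<pi>0 w)) \<in> ?W \<rightarrow> Field (und ?FA)" by (rule Pi_I) (rule eA[OF FieldI1[OF \<pi>P]])
  note v0 = ext_disc[OF W FA this]
  have "(\<lambda>w. ?eA (\<pi>1 w)) \<in> ?W \<rightarrow> Field (und ?FA)" by (rule Pi_I) (rule eA[OF FieldI2[OF \<pi>P]])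
  note v1 = ext_disc[OF W FA this]
  have "\<eta> P \<in> ?A \<rightarrow> Field (und (F P))" using \<eta>_closed[OF P] by simp
  note e = ext_disc[OF A FP this]
  \<comment> \<open>Reflexivity of \<open>P\<close> puts the diagonal among the pairs and so
    supplies the common section of a reflexive pair.\<close>
  have dW: "enc (p, p) \<in> ?W" if "p \<in> ?A" for p using Partial_orderD(1)[OF PP that] by blast
  have "(\<lambda>p. ?eW (enc (p, p))) \<in> ?A \<rightarrow> Field (und ?FW)" by (rule Pi_I) (rule eW[OF dW])
  note d = ext_disc[OF A FW this]
  let ?v0 = "ext (Id_on ?W) ?FA (\<lambda>w. ?eA (\<pi>0 w))" and ?v1 = "ext (Id_on ?W) ?FA (\<lambda>w. ?eA (\<pi>1 w))"
    and ?e = "ext (Id_on ?A) (F P) (\<eta> P)" and ?d = "ext (Id_on ?A) ?FW (\<lambda>p. ?eW (enc (p, p)))"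
  have \<pi>d: "\<pi>0 (enc (p, p)) = p" "\<pi>1 (enc (p, p)) = p" if "p \<in> ?A" for p using \<pi>[OF Partial_orderD(1)[OF PP that]] by auto
  have "?v0 \<odot> ?d = Idt K ?FA"
    by (rule free_eq[OF AP comp_arrow[OF d(1) v0(1)] id_arrow[OF FA]])
      (simp add: fn_comp[OF d(1) v0(1)] eA d(2) v0(2) dW \<pi>d fn_id[OF FA])
  moreover have "?v1 \<odot> ?d = Idt K ?FA"
    by (rule free_eq[OF AP comp_arrow[OF d(1) v1(1)] id_arrow[OF FA]])
      (simp add: fn_comp[OF d(1) v1(1)] eA d(2) v1(2) dW \<pi>d fn_id[OF FA])
  ultimately have rp: "reflexive_pair K ?FW ?FA ?v0 ?v1"
    unfolding reflexive_pair_def using d(1) v0(1) v1(1) by blast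
  have "is_coinserter K ?FW ?FA ?v0 ?v1 (F P) ?e"
    unfolding is_coinserter_def
  proof (intro conjI allI ballI impI e(1))
    show "(?e \<odot> ?v0, ?e \<odot> ?v1) \<in> Hom K ?FW (F P)"
    proof (rule free_le[OF WP comp_arrow[OF v0(1) e(1)] comp_arrow[OF v1(1) e(1)]])
      fix w assume "w \<in> Field (Id_on ?W)"
      then have w: "w \<in> ?W" by simp
      show "(fn (?e \<odot> ?v0) (?eW w), fn (?e \<odot> ?v1) (?eW w)) \<in> und (F P)"
        using \<eta>_mono[OF P \<pi>P[OF w]] e(2)[OF FieldI1[OF \<pi>P[OF w]]] e(2)[OF FieldI2[OF \<pi>P[OF w]]]
        by (simp add: fn_comp[OF v0(1) e(1) eW[OF w]] fn_comp[OF v1(1) e(1) eW[OF w]] v0(2)[OF w] v1(2)[OF w])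
    qed
  next
    fix Y f assume f: "f \<in> arrows K ?FA Y" and le: "(f \<odot> ?v0, f \<odot> ?v1) \<in> Hom K ?FW Y"
    have Y: "Y \<in> Obj K" using arrows_Obj[OF f] by simp
    have m: "\<forall>p q. (p, q) \<in> P \<longrightarrow> (fn f (?eA p), fn f (?eA q)) \<in> und Y"
    proof (intro allI impI)
      fix p q assume pq: "(p, q) \<in> P"
      have w: "enc (p, q) \<in> ?W" using pq by blast
      have "(fn (f \<odot> ?v0) (?eW (enc (p, q))), fn (f \<odot> ?v1) (?eW (enc (p, q)))) \<in> und Y"
        using le eW[OF w] Hom_iff[OF comp_arrow[OF v0(1) f] comp_arrow[OF v1(1) f]] by blast
      then show "(fn f (?eA p), fn f (?eA q)) \<in> und Y"
        using fn_comp[OF v0(1) f eW[OF w]] fn_comp[OF v1(1) f eW[OF w]] v0(2)[OF w] v1(2)[OF w] \<pi>[OF pq] by simp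
    qed
    note g = ext[OF P Y m]
    have "f = ext P Y (\<lambda>p. fn f (?eA p)) \<odot> ?e"
      by (rule free_eq[OF AP f comp_arrow[OF e(1) g(1)]]) (simp add: fn_comp[OF e(1) g(1)] eA e(2) g(2))
    then show "\<exists>g \<in> arrows K (F P) Y. f = g \<odot> ?e" using g(1) by blast
  next
    fix Y g g' assume g: "g \<in> arrows K (F P) Y" and g': "g' \<in> arrows K (F P) Y" and le: "(g \<odot> ?e, g' \<odot> ?e) \<in> Hom K ?FA Y"
    show "(g, g') \<in> Hom K (F P) Y"
    proof (rule free_le[OF P g g'])
      fix p assume p: "p \<in> ?A"
      have "(fn (g \<odot> ?e) (?eA p), fn (g' \<odot> ?e) (?eA p)) \<in> und Y"
        using le eA[OF p] Hom_iff[OF comp_arrow[OF e(1) g] comp_arrow[OF e(1) g']] by blast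
      then show "(fn g (\<eta> P p), fn g' (\<eta> P p)) \<in> und Y"
        using fn_comp[OF e(1) g eA[OF p]] fn_comp[OF e(1) g' eA[OF p]] e(2)[OF p] by simp
    qed
  qed
  \<comment> \<open>Preservation by \<open>U\<close> turns the universal property in
    \<open>K\<close> into a description of the elements and the order of \<open>F P\<close>.\<close>
  then have "is_coinserter Pos (und ?FW) (und ?FA) (ar U ?v0) (ar U ?v1) (und (F P)) (ar U ?e)"
    using pc rp unfolding preserves_reflexive_coinserters_def by blast
  then have co: "is_coinserter Pos (und ?FW) (und ?FA) (und ?FW, fn ?v0, und ?FA) (und ?FW, fn ?v1, und ?FA) (und (F P)) (und ?FA, fn ?e, und (F P))"
    by (simp only: ar_U(1)[OF v0(1)] ar_U(1)[OF v1(1)] ar_U(1)[OF e(1)])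
  note co' = pos_coinserterD[OF co und_Obj[OF FW] ar_U(2)[OF v0(1)] ar_U(2)[OF v1(1)]]
  have 1: "\<forall>w \<in> ?W. (\<pi>0 w, \<pi>1 w) \<in> P" using \<pi>P by blast
  have 2: "\<forall>w \<in> ?W. fn ?v0 (?eW w) = ?eA (\<pi>0 w) \<and> fn ?v1 (?eW w) = ?eA (\<pi>1 w)" using v0(2) v1(2) by blast
  have 3: "\<forall>p \<in> ?A. fn ?e (?eA p) = \<eta> P p" using e(2) by blast
  have 4: "\<forall>x \<in> Field (und ?FA). \<forall>y \<in> Field (und ?FA). (fn ?e x, fn ?e y) \<in> und (F P) \<longrightarrow>
      (x, y) \<in> coinserter_rel (und ?FW) (und ?FA) (fn ?v0) (fn ?v1)"
    using co'(2) by blast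
  show ?thesis
    by (intro exI[of _ ?W] exI[of _ \<pi>0] exI[of _ \<pi>1] exI[of _ ?v0] exI[of _ ?v1] exI[of _ ?e] conjI
      W 1 v0(1) v1(1) 2 e(1) 3 co'(1) 4)
qed

text \<open>The arrow from the discrete free object is surjective and sends generators to
  generators, so a term for a preimage serves.\<close>

lemma generated:
  assumes P: "P \<in> Obj Pos" and y: "y \<in> Field (und (F P))"
  shows "\<exists>t. is_gterm \<Sigma> (Field P) t \<and> y = geval (oper (alg (F P))) (\<eta> P) t"
proof -
  have A: "small (Field P)" using P by (simp add: Obj_Pos)
  note AP = Id_on_Pos[OF A]
  obtain e where e: "e \<in> arrows K (F (Id_on (Field P))) (F P)" "\<forall>p \<in> Field P. fn e (\<eta> (Id_on (Field P)) p) = \<eta> P p"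
    "fn e ` Field (und (F (Id_on (Field P)))) = Field (und (F P))"
    using free_presentation[OF P] by (elim exE conjE)
  obtain z where z: "z \<in> Field (und (F (Id_on (Field P))))" "y = fn e z" using y e(3) by blast
  obtain t where t: "is_gterm \<Sigma> (Field P) t" "z = geval (oper (alg (F (Id_on (Field P))))) (\<eta> (Id_on (Field P))) t"
    using generated_disc[OF A z(1)] by blast
  have "y = geval (oper (alg (F P))) (\<lambda>p. fn e (\<eta> (Id_on (Field P)) p)) t"
    unfolding z(2) t(2) by (rule hom_geval[OF alg_ordered[OF F_Obj[OF AP]] fn_hom[OF e(1)] t(1)]) (auto simp: \<eta>_closed[OF AP])
  also have "\<dots> = geval (oper (alg (F P))) (\<eta> P) t"
    by (rule geval_cong) (use is_gterm_vars[OF t(1)] e(2) in blast)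
  finally show ?thesis using t(1) by blast
qed

text \<open>The universal property of the free object concerns arrows of \<open>K\<close>, and
  \<open>C\<close> is an arbitrary algebra of the variety. The map is therefore defined through
  syntax: \<open>y\<close> is the value of a term \<open>tm y\<close>, which is evaluated again in
  \<open>C\<close>. \<open>free_inequation\<close> makes the result independent of the term and
  monotone in \<open>y\<close>.\<close>

lemma free_hom_disc:
  assumes A: "small A" and C: "C \<in> Obj (Variety \<Sigma> \<Gamma>)" and m: "m \<in> A \<rightarrow> Field (under C)"
  shows "\<exists>h \<in> monotone_homs \<Sigma> (alg (F (Id_on A))) C. \<forall>a \<in> A. h (\<eta> (Id_on A) a) = m a"
proof -
  let ?FA = "F (Id_on A)" and ?e = "\<eta> (Id_on A)"
  note AP = Id_on_Pos[OF A] and FA = F_Obj[OF Id_on_Pos[OF A]]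
  define tm where "tm y = (SOME t. is_gterm \<Sigma> A t \<and> y = geval (oper (alg ?FA)) ?e t)" for y
  have tm: "is_gterm \<Sigma> A (tm y)" "geval (oper (alg ?FA)) ?e (tm y) = y" if "y \<in> Field (und ?FA)" for y
    using someI_ex[OF generated_disc[OF A that]] by (auto simp: tm_def)
  let ?h = "\<lambda>y. geval (oper C) m (tm y)"
  have ev: "?h (geval (oper (alg ?FA)) ?e t) = geval (oper C) m t" if t: "is_gterm \<Sigma> A t" for t
  proof -
    let ?y = "geval (oper (alg ?FA)) ?e t"
    have y: "?y \<in> Field (und ?FA)"
      using geval_closed[OF alg_ordered[OF FA] t, of ?e] \<eta>_closed[OF AP] by (simp add: Pi_def)
    have yy: "(?y, ?y) \<in> und ?FA" by (rule Partial_orderD(1)[OF und_order[OF FA] y])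
    show ?thesis
    proof (rule Partial_orderD(3)[OF Obj_Variety_order[OF C]])
      show "(?h ?y, geval (oper C) m t) \<in> under C"
        by (rule free_inequation[OF A tm(1)[OF y] t C m]) (simp_all add: tm(2)[OF y] yy)
      show "(geval (oper C) m t, ?h ?y) \<in> under C"
        by (rule free_inequation[OF A t tm(1)[OF y] C m]) (simp_all add: tm(2)[OF y] yy)
    qed
  qed
  have "restrict ?h (Field (und ?FA)) \<in> monotone_homs \<Sigma> (alg ?FA) C"
  proof (rule monotone_homsI, unfold under_alg)
    show "restrict ?h (Field (und ?FA)) \<in> monotone_maps (und ?FA) (under C)"
    proof (rule monotone_mapsI)
      fix x y assume xy: "(x, y) \<in> und ?FA"
      note tx = tm[OF FieldI1[OF xy]] and ty = tm[OF FieldI2[OF xy]]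
      show "(?h x, ?h y) \<in> under C"
        by (rule free_inequation[OF A tx(1) ty(1) C m]) (simp_all add: tx(2) ty(2) xy)
    qed
    fix \<sigma> ys assume \<sigma>: "\<sigma> \<in> \<Sigma> (length ys)" and ys: "set ys \<subseteq> Field (und ?FA)"
    let ?t = "GApp \<sigma> (map tm ys)"
    have t: "is_gterm \<Sigma> A ?t" using \<sigma> ys tm(1) by auto
    have eq: "map (geval (oper (alg ?FA)) ?e) (map tm ys) = ys" using ys tm(2) by (induction ys) auto
    have "oper (alg ?FA) \<sigma> ys = geval (oper (alg ?FA)) ?e ?t" by (simp only: geval.simps eq)
    then have "?h (oper (alg ?FA) \<sigma> ys) = geval (oper C) m ?t" by (simp only: ev[OF t])
    also have "\<dots> = oper C \<sigma> (map ?h ys)" by (simp add: comp_def)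
    also have "map ?h ys = map (restrict ?h (Field (und ?FA))) ys" using ys by auto
    finally show "restrict ?h (Field (und ?FA)) (oper (alg ?FA) \<sigma> ys) = oper C \<sigma> (map (restrict ?h (Field (und ?FA))) ys)"
      using opr_closed[OF FA \<sigma> ys] by simp
  qed
  moreover have "restrict ?h (Field (und ?FA)) (?e a) = m a" if a: "a \<in> A" for a
    using ev[of "GVar a"] a \<eta>_closed[OF AP] by simp
  ultimately show ?thesis by blast
qed

text \<open>The homomorphism \<open>a\<close> given by the discrete case respects the pair that
  presents \<open>P\<close>, hence the preorder generated by it, and so descends along the
  surjection \<open>e\<close>.\<close>

lemma free_hom:
  assumes P: "P \<in> Obj Pos" and C: "C \<in> Obj (Variety \<Sigma> \<Gamma>)" and m: "\<forall>p q. (p, q) \<in> P \<longrightarrow> (m p, m q) \<in> under C"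
  shows "\<exists>h \<in> monotone_homs \<Sigma> (alg (F P)) C. \<forall>p \<in> Field P. h (\<eta> P p) = m p"
proof -
  let ?A = "Field P"
  let ?FA = "F (Id_on ?A)" and ?eA = "\<eta> (Id_on ?A)"
  have PP: "Partial_order P" and A: "small ?A" using P by (auto simp: Obj_Pos)
  have CC: "ordered_algebra \<Sigma> C" using C by (simp add: Obj_Variety)
  note AP = Id_on_Pos[OF A] and FA = F_Obj[OF Id_on_Pos[OF A]] and FP = F_Obj[OF P]
  note oC = Partial_orderD[OF Obj_Variety_order[OF C]]
  have eA: "?eA p \<in> Field (und ?FA)" if "p \<in> ?A" for p using \<eta>_closed[OF AP] that by simp
  obtain W \<pi>0 \<pi>1 v0 v1 e where W: "small W" and \<pi>: "\<forall>w \<in> W. (\<pi>0 w, \<pi>1 w) \<in> P"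
    and v0: "v0 \<in> arrows K (F (Id_on W)) ?FA" and v1: "v1 \<in> arrows K (F (Id_on W)) ?FA"
    and v: "\<forall>w \<in> W. fn v0 (\<eta> (Id_on W) w) = ?eA (\<pi>0 w) \<and> fn v1 (\<eta> (Id_on W) w) = ?eA (\<pi>1 w)"
    and e: "e \<in> arrows K ?FA (F P)" and ee: "\<forall>p \<in> ?A. fn e (?eA p) = \<eta> P p"
    and surj: "fn e ` Field (und ?FA) = Field (und (F P))"
    and ord: "\<forall>x \<in> Field (und ?FA). \<forall>y \<in> Field (und ?FA). (fn e x, fn e y) \<in> und (F P) \<longrightarrow>
      (x, y) \<in> coinserter_rel (und (F (Id_on W))) (und ?FA) (fn v0) (fn v1)"
    using free_presentation[OF P] by (elim exE conjE)
  note WP = Id_on_Pos[OF W] and FW = F_Obj[OF Id_on_Pos[OF W]]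
  have mA: "m \<in> ?A \<rightarrow> Field (under C)"
    by (rule Pi_I) (rule FieldI1[OF m[rule_format, OF Partial_orderD(1)[OF PP]]])
  obtain a where a: "a \<in> monotone_homs \<Sigma> (alg ?FA) C" "\<And>p. p \<in> ?A \<Longrightarrow> a (?eA p) = m p"
    using free_hom_disc[OF A C mA] by blast
  have am: "a \<in> monotone_maps (und ?FA) (under C)" using monotone_homsD(1)[OF a(1)] by simp
  \<comment> \<open>At the generators this is monotonicity of \<open>m\<close> at a pair of
    \<open>P\<close>. A general \<open>w\<close> is the value of a term, and the operations of
    \<open>C\<close> are monotone.\<close>
  have av: "(a (fn v0 w), a (fn v1 w)) \<in> under C" if w: "w \<in> Field (und (F (Id_on W)))" for w
  proof -
    obtain t where t: "is_gterm \<Sigma> W t" "w = geval (oper (alg (F (Id_on W)))) (\<eta> (Id_on W)) t"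
      using generated_disc[OF W w] by blast
    have eW: "\<eta> (Id_on W) \<in> W \<rightarrow> Field (under (alg (F (Id_on W))))" using \<eta>_closed[OF WP] by simp
    have ev: "a (fn u w) = geval (oper C) (\<lambda>x. a (fn u (\<eta> (Id_on W) x))) t" if u: "u \<in> arrows K (F (Id_on W)) ?FA" for u
      unfolding t(2) hom_geval[OF alg_ordered[OF FW] fn_hom[OF u] t(1) eW]
      by (rule hom_geval[OF alg_ordered[OF FA] a(1) t(1)]) (use fn_closed[OF u] eW in auto)
    show ?thesis
      unfolding ev[OF v0] ev[OF v1]
    proof (rule geval_mono[OF CC t(1)])
      fix x assume x: "x \<in> W"
      then have "(\<pi>0 x, \<pi>1 x) \<in> P" using \<pi> by blast
      then show "(a (fn v0 (\<eta> (Id_on W) x)), a (fn v1 (\<eta> (Id_on W) x))) \<in> under C"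
        using v x a(2) m by (simp add: FieldI1 FieldI2)
    qed
  qed
  have a_ord: "(a x, a y) \<in> under C" if x: "x \<in> Field (und ?FA)" and y: "y \<in> Field (und ?FA)" and le: "(fn e x, fn e y) \<in> und (F P)" for x y
  proof (rule rtrancl_map_mono[OF ord[rule_format, OF x y le] x])
    show "und ?FA \<union> {(fn v0 w, fn v1 w) | w. w \<in> Field (und (F (Id_on W)))} \<subseteq> Field (und ?FA) \<times> Field (und ?FA)"
      using fn_closed[OF v0] fn_closed[OF v1] by (auto intro: FieldI1 FieldI2)
    show "(a z, a z) \<in> under C" if "z \<in> Field (und ?FA)" for z using oC(1)[OF monotone_mapsD(1)[OF am that]] .
    show "trans (under C)" using oC(2) by (rule transI)
    show "(a z, a z') \<in> under C" if "(z, z') \<in> und ?FA \<union> {(fn v0 w, fn v1 w) | w. w \<in> Field (und (F (Id_on W)))}" for z z'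
      using that monotone_mapsD(2)[OF am] av by blast
  qed
  let ?s = "inv_into (Field (und ?FA)) (fn e)"
  have s: "?s y \<in> Field (und ?FA)" "fn e (?s y) = y" if "y \<in> Field (und (F P))" for y
    using that unfolding surj[symmetric] by (auto intro: inv_into_into f_inv_into_f)
  let ?h = "restrict (\<lambda>y. a (?s y)) (Field (und (F P)))"
  have he: "?h (fn e z) = a z" if z: "z \<in> Field (und ?FA)" for z
  proof -
    have y: "fn e z \<in> Field (und (F P))" by (rule fn_closed[OF e z])
    have yy: "(fn e z, fn e z) \<in> und (F P)" by (rule Partial_orderD(1)[OF und_order[OF FP] y])
    show ?thesis
      using oC(3)[OF a_ord[OF s(1)[OF y] z] a_ord[OF z s(1)[OF y]]] s(2)[OF y] yy y by simp
  qed
  have "?h \<in> monotone_homs \<Sigma> (alg (F P)) C"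
  proof (rule monotone_homsI, unfold under_alg)
    show "?h \<in> monotone_maps (und (F P)) (under C)"
    proof (rule monotone_mapsI)
      fix x y assume xy: "(x, y) \<in> und (F P)"
      note sx = s[OF FieldI1[OF xy]] and sy = s[OF FieldI2[OF xy]]
      show "(a (?s x), a (?s y)) \<in> under C" by (rule a_ord[OF sx(1) sy(1)]) (simp add: sx(2) sy(2) xy)
    qed
    fix \<sigma> ys assume \<sigma>: "\<sigma> \<in> \<Sigma> (length ys)" and ys: "set ys \<subseteq> Field (und (F P))"
    obtain zs where zs: "ys = map (fn e) zs" "set zs \<subseteq> Field (und ?FA)"
      using ys unfolding surj[symmetric] by (rule set_subset_imageE)
    have \<sigma>': "\<sigma> \<in> \<Sigma> (length zs)" using \<sigma> zs by simp
    have "oper (alg (F P)) \<sigma> ys = fn e (oper (alg ?FA) \<sigma> zs)"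
      using monotone_homsD(2)[OF fn_hom[OF e] \<sigma>'] zs by simp
    then have "?h (oper (alg (F P)) \<sigma> ys) = a (oper (alg ?FA) \<sigma> zs)"
      by (simp only: he[OF opr_closed[OF FA \<sigma>' zs(2)]])
    also have "\<dots> = oper C \<sigma> (map a zs)" using monotone_homsD(2)[OF a(1) \<sigma>'] zs(2) by simp
    also have "map a zs = map ?h ys" unfolding zs(1) map_map comp_def
      by (rule map_cong[OF refl], rule he[symmetric], rule subsetD[OF zs(2)])
    finally show "?h (oper (alg (F P)) \<sigma> ys) = oper C \<sigma> (map ?h ys)" .
  qed
  moreover have "?h (\<eta> P p) = m p" if p: "p \<in> ?A" for p
    using he[OF eA[OF p]] ee p a(2)[OF p] by simp
  ultimately show ?thesis by blast
qed

text \<open>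
  The kernel \<open>{(p, q). a p \<le> a q}\<close> of a homomorphism out of \<open>F P\<close> is covered by the free object
  on it. The order on the kernel is the product order, so that the diagonal is monotone and the
  resulting pair is reflexive.
\<close>

lemma kernel_coinserter:
  assumes P: "P \<in> Obj Pos" and C: "C \<in> Obj (Variety \<Sigma> \<Gamma>)" and a: "a \<in> monotone_homs \<Sigma> (alg (F P)) C"
  shows "\<exists>Q v\<^sub>0 v\<^sub>1 X c. v\<^sub>0 \<in> arrows K Q (F P) \<and> v\<^sub>1 \<in> arrows K Q (F P) \<and> is_coinserter K Q (F P) v\<^sub>0 v\<^sub>1 X c \<and>
    (\<forall>w \<in> Field (und Q). (a (fn v\<^sub>0 w), a (fn v\<^sub>1 w)) \<in> under C) \<and>
    fn c ` Field (und (F P)) = Field (und X) \<and>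
    (\<forall>p \<in> Field (und (F P)). \<forall>q \<in> Field (und (F P)). (fn c p, fn c q) \<in> und X \<longleftrightarrow> (a p, a q) \<in> under C)"
proof -
  note FP = F_Obj[OF P]
  note oF = Partial_orderD[OF und_order[OF FP]] and oC = Partial_orderD[OF Obj_Variety_order[OF C]]
  have CC: "ordered_algebra \<Sigma> C" using C by (simp add: Obj_Variety)
  have am: "a \<in> monotone_maps (und (F P)) (under C)" using monotone_homsD(1)[OF a] by simp
  let ?X = "Field (und (F P))"
  define M where "M = {(p, q). p \<in> ?X \<and> q \<in> ?X \<and> (a p, a q) \<in> under C}"
  have "sm (?X \<times> ?X)" using sm_Sigma[of ?X "\<lambda>_. ?X"] und_Obj[OF FP] by (simp add: Obj_Pos small_iff_sm)
  then have smM: "sm M" by (rule sm_subset) (auto simp: M_def)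
  then obtain enc :: "'u \<times> 'u \<Rightarrow> 'u" where enc: "inj_on enc M" by (rule sm_embed)
  define Q where "Q = {(enc (p, q), enc (p', q')) | p q p' q'.
    (p, q) \<in> M \<and> (p', q') \<in> M \<and> (p, p') \<in> und (F P) \<and> (q, q') \<in> und (F P)}"
  have FQ: "Field Q = enc ` M"
  proof
    show "enc ` M \<subseteq> Field Q"
    proof
      fix w assume "w \<in> enc ` M"
      then obtain p q where pq: "w = enc (p, q)" "(p, q) \<in> M" by auto
      then have "(p, p) \<in> und (F P)" "(q, q) \<in> und (F P)" using oF(1) by (auto simp: M_def)
      then have "(w, w) \<in> Q" using pq unfolding Q_def by blast
      then show "w \<in> Field Q" by (rule FieldI1)
    qed
  qed (auto simp: Q_def Field_def)
  have QI: "(enc (p, q), enc (p', q')) \<in> Q \<longleftrightarrow> (p, p') \<in> und (F P) \<and> (q, q') \<in> und (F P)"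
    if "(p, q) \<in> M" "(p', q') \<in> M" for p q p' q'
    using that inj_onD[OF enc] unfolding Q_def by blast
  have Q: "Q \<in> Obj Pos"
    unfolding Obj_Pos
  proof
    show "small (Field Q)" unfolding FQ small_iff_sm by (rule sm_image[OF smM])
    show "Partial_order Q"
    proof (rule Partial_orderI)
      show "(x, x) \<in> Q" if "x \<in> Field Q" for x
        using that oF(1) unfolding FQ by (auto simp: QI) (auto simp: M_def)
      have F: "\<exists>p q. x = enc (p, q) \<and> (p, q) \<in> M" "\<exists>p q. y = enc (p, q) \<and> (p, q) \<in> M" if "(x, y) \<in> Q" for x y
        using that unfolding Q_def by blast+
      show "(x, z) \<in> Q" if xy: "(x, y) \<in> Q" and yz: "(y, z) \<in> Q" for x y z
      proof -
        obtain p q p' q' p'' q'' where e: "x = enc (p, q)" "y = enc (p', q')" "z = enc (p'', q'')"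
          and M: "(p, q) \<in> M" "(p', q') \<in> M" "(p'', q'') \<in> M"
          using F(1)[OF xy] F(1)[OF yz] F(2)[OF yz] by (elim exE conjE)
        show ?thesis using xy yz oF(2) unfolding e QI[OF M(1,2)] QI[OF M(2,3)] QI[OF M(1,3)] by blast
      qed
      show "x = y" if xy: "(x, y) \<in> Q" and yx: "(y, x) \<in> Q" for x y
      proof -
        obtain p q p' q' where e: "x = enc (p, q)" "y = enc (p', q')" and M: "(p, q) \<in> M" "(p', q') \<in> M"
          using F(1)[OF xy] F(2)[OF xy] by (elim exE conjE)
        show ?thesis using xy yx oF(3) unfolding e QI[OF M(1,2)] QI[OF M(2,1)] by blast
      qed
    qed
  qed
  note FQO = F_Obj[OF Q]
  define f0 where "f0 w = fst (inv_into M enc w)" for w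
  define f1 where "f1 w = snd (inv_into M enc w)" for w
  have f: "f0 (enc (p, q)) = p" "f1 (enc (p, q)) = q" if "(p, q) \<in> M" for p q
    by (simp_all add: f0_def f1_def inv_into_f_f[OF enc that])
  have "\<forall>x y. (x, y) \<in> Q \<longrightarrow> (f0 x, f0 y) \<in> und (F P)" using f unfolding Q_def by auto
  note v0 = ext[OF Q FP this]
  have "\<forall>x y. (x, y) \<in> Q \<longrightarrow> (f1 x, f1 y) \<in> und (F P)" using f unfolding Q_def by auto
  note v1 = ext[OF Q FP this]
  let ?v0 = "ext Q (F P) f0" and ?v1 = "ext Q (F P) f1"
  have eQ: "\<And>w. w \<in> Field Q \<Longrightarrow> \<eta> Q w \<in> Field (und (F Q))" by (rule \<eta>_closed[OF Q])
  have eP: "\<And>p. p \<in> Field P \<Longrightarrow> \<eta> P p \<in> ?X" by (rule \<eta>_closed[OF P])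
  have dM: "(p, p) \<in> M" if "p \<in> ?X" for p using that oC(1)[OF monotone_mapsD(1)[OF am that]] by (simp add: M_def)
  have dF: "enc (p, p) \<in> Field Q" if "p \<in> ?X" for p using dM[OF that] by (auto simp: FQ)
  have "\<forall>p q. (p, q) \<in> P \<longrightarrow> (\<eta> Q (enc (\<eta> P p, \<eta> P p)), \<eta> Q (enc (\<eta> P q, \<eta> P q))) \<in> und (F Q)"
  proof (intro allI impI)
    fix p q assume pq: "(p, q) \<in> P"
    show "(\<eta> Q (enc (\<eta> P p, \<eta> P p)), \<eta> Q (enc (\<eta> P q, \<eta> P q))) \<in> und (F Q)"
      using \<eta>_mono[OF P pq] QI[OF dM[OF eP[OF FieldI1[OF pq]]] dM[OF eP[OF FieldI2[OF pq]]]] \<eta>_mono[OF Q] by simp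
  qed
  note d = ext[OF P FQO this]
  let ?d = "ext P (F Q) (\<lambda>p. \<eta> Q (enc (\<eta> P p, \<eta> P p)))"
  have "?v0 \<odot> ?d = Idt K (F P)"
    by (rule free_eq[OF P comp_arrow[OF d(1) v0(1)] id_arrow[OF FP]])
      (simp add: fn_comp[OF d(1) v0(1)] eP d(2) v0(2) dF f(1) dM fn_id[OF FP])
  moreover have "?v1 \<odot> ?d = Idt K (F P)"
    by (rule free_eq[OF P comp_arrow[OF d(1) v1(1)] id_arrow[OF FP]])
      (simp add: fn_comp[OF d(1) v1(1)] eP d(2) v1(2) dF f(2) dM fn_id[OF FP])
  ultimately have rp: "reflexive_pair K (F Q) (F P) ?v0 ?v1"
    unfolding reflexive_pair_def using d(1) v0(1) v1(1) by blast
  then obtain X c where co: "is_coinserter K (F Q) (F P) ?v0 ?v1 X c"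
    using rc unfolding has_reflexive_coinserters_def by blast
  have c: "c \<in> arrows K (F P) X" and cv: "(c \<odot> ?v0, c \<odot> ?v1) \<in> Hom K (F Q) X"
    using co by (auto simp: is_coinserter_def)
  have "is_coinserter Pos (und (F Q)) (und (F P)) (ar U ?v0) (ar U ?v1) (und X) (ar U c)"
    using pc rp co unfolding preserves_reflexive_coinserters_def by blast
  then have "is_coinserter Pos (und (F Q)) (und (F P)) (und (F Q), fn ?v0, und (F P)) (und (F Q), fn ?v1, und (F P)) (und X) (und (F P), fn c, und X)"
    by (simp only: ar_U(1)[OF v0(1)] ar_U(1)[OF v1(1)] ar_U(1)[OF c])
  note co' = pos_coinserterD[OF this und_Obj[OF FQO] ar_U(2)[OF v0(1)] ar_U(2)[OF v1(1)]]
  \<comment> \<open>The coded pairs are only the generators of \<open>F Q\<close>. The condition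
    extends to every \<open>w\<close> through a term for \<open>w\<close>, because \<open>a\<close>
    is a homomorphism and the operations of \<open>C\<close> are monotone.\<close>
  have av: "(a (fn ?v0 w), a (fn ?v1 w)) \<in> under C" if w: "w \<in> Field (und (F Q))" for w
  proof -
    obtain t where t: "is_gterm \<Sigma> (Field Q) t" "w = geval (oper (alg (F Q))) (\<eta> Q) t"
      using generated[OF Q w] by blast
    have eQ': "\<eta> Q \<in> Field Q \<rightarrow> Field (under (alg (F Q)))" using eQ by simp
    have ev: "a (fn u w) = geval (oper C) (\<lambda>x. a (fn u (\<eta> Q x))) t" if u: "u \<in> arrows K (F Q) (F P)" for u
      unfolding t(2) hom_geval[OF alg_ordered[OF FQO] fn_hom[OF u] t(1) eQ']
      by (rule hom_geval[OF alg_ordered[OF FP] a t(1)]) (use fn_closed[OF u] eQ in auto)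
    show ?thesis
      unfolding ev[OF v0(1)] ev[OF v1(1)]
    proof (rule geval_mono[OF CC t(1)])
      fix x assume x: "x \<in> Field Q"
      then obtain p q where pq: "x = enc (p, q)" "(p, q) \<in> M" by (auto simp: FQ)
      have "(a p, a q) \<in> under C" using pq(2) by (simp add: M_def)
      then show "(a (fn ?v0 (\<eta> Q x)), a (fn ?v1 (\<eta> Q x))) \<in> under C"
        using v0(2)[OF x] v1(2)[OF x] f[OF pq(2)] by (simp add: pq(1))
    qed
  qed
  have "(fn c p, fn c q) \<in> und X \<longleftrightarrow> (a p, a q) \<in> under C" if p: "p \<in> ?X" and q: "q \<in> ?X" for p q
  proof
    assume le: "(fn c p, fn c q) \<in> und X"
    show "(a p, a q) \<in> under C"
    proof (rule rtrancl_map_mono[OF co'(2)[OF p q le] p])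
      show "und (F P) \<union> {(fn ?v0 w, fn ?v1 w) | w. w \<in> Field (und (F Q))} \<subseteq> ?X \<times> ?X"
        using fn_closed[OF v0(1)] fn_closed[OF v1(1)] by (auto intro: FieldI1 FieldI2)
      show "(a z, a z) \<in> under C" if "z \<in> ?X" for z using oC(1)[OF monotone_mapsD(1)[OF am that]] .
      show "trans (under C)" using oC(2) by (rule transI)
      show "(a z, a z') \<in> under C" if "(z, z') \<in> und (F P) \<union> {(fn ?v0 w, fn ?v1 w) | w. w \<in> Field (und (F Q))}" for z z'
        using that monotone_mapsD(2)[OF am] av by blast
    qed
  next
    assume "(a p, a q) \<in> under C"
    then have M: "(p, q) \<in> M" using p q by (simp add: M_def)
    then have w: "enc (p, q) \<in> Field Q" by (auto simp: FQ)
    have "(fn (c \<odot> ?v0) (\<eta> Q (enc (p, q))), fn (c \<odot> ?v1) (\<eta> Q (enc (p, q)))) \<in> und X"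
      using cv eQ[OF w] Hom_iff[OF comp_arrow[OF v0(1) c] comp_arrow[OF v1(1) c]] by blast
    then show "(fn c p, fn c q) \<in> und X"
      using fn_comp[OF v0(1) c eQ[OF w]] fn_comp[OF v1(1) c eQ[OF w]] v0(2)[OF w] v1(2)[OF w] f[OF M] by simp
  qed
  then show ?thesis using v0(1) v1(1) co av co'(1) by blast
qed

text \<open>The transpose \<open>?h\<close> of the homomorphism is an arrow, and on values of terms
  it agrees with \<open>h\<close> after the counit \<open>?e\<close>. So both \<open>?e\<close> and
  \<open>?h\<close> factor through the coinserter \<open>Z\<close> of the kernel of
  \<open>?e\<close>. The factor \<open>k\<close> of the counit is surjective and order-reflecting,
  hence invertible by reflection of isomorphisms, and \<open>l \<odot> k'\<close> has underlying
  function \<open>h\<close>.\<close>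

lemma full:
  assumes X: "X \<in> Obj K" and Y: "Y \<in> Obj K" and h: "h \<in> monotone_homs \<Sigma> (alg X) (alg Y)"
  shows "\<exists>f \<in> arrows K X Y. fn f = h"
proof -
  let ?P = "und X"
  note P = und_Obj[OF X]
  note FP = F_Obj[OF P]
  have hm: "h \<in> monotone_maps (und X) (und Y)" using monotone_homsD(1)[OF h] by simp
  have "\<forall>p q. (p, q) \<in> und X \<longrightarrow> (p, q) \<in> und X" by simp
  note e = ext[OF P X this]
  have "\<forall>p q. (p, q) \<in> und X \<longrightarrow> (h p, h q) \<in> und Y" using monotone_mapsD(2)[OF hm] by blast
  note g = ext[OF P Y this]
  let ?e = "ext ?P X (\<lambda>x. x)" and ?h = "ext ?P Y h"
  have he: "fn ?h y = h (fn ?e y)" if y: "y \<in> Field (und (F ?P))" for y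
  proof -
    obtain t where t: "is_gterm \<Sigma> (Field ?P) t" "y = geval (oper (alg (F ?P))) (\<eta> ?P) t"
      using generated[OF P y] by blast
    have eP: "\<eta> ?P \<in> Field ?P \<rightarrow> Field (under (alg (F ?P)))" using \<eta>_closed[OF P] by simp
    have "fn ?h y = geval (oper (alg Y)) (\<lambda>x. fn ?h (\<eta> ?P x)) t"
      unfolding t(2) by (rule hom_geval[OF alg_ordered[OF FP] fn_hom[OF g(1)] t(1) eP])
    also have "\<dots> = geval (oper (alg Y)) (\<lambda>x. h (fn ?e (\<eta> ?P x))) t"
      by (rule geval_cong) (use is_gterm_vars[OF t(1)] g(2) e(2) in auto)
    also have "\<dots> = h (geval (oper (alg X)) (\<lambda>x. fn ?e (\<eta> ?P x)) t)"
      by (rule hom_geval[OF alg_ordered[OF X] h t(1), symmetric]) (use fn_closed[OF e(1)] eP in auto)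
    also have "geval (oper (alg X)) (\<lambda>x. fn ?e (\<eta> ?P x)) t = fn ?e y"
      unfolding t(2) by (rule hom_geval[OF alg_ordered[OF FP] fn_hom[OF e(1)] t(1) eP, symmetric])
    finally show ?thesis .
  qed
  obtain Q v0 v1 Z c where v0: "v0 \<in> arrows K Q (F ?P)" and v1: "v1 \<in> arrows K Q (F ?P)"
    and co: "is_coinserter K Q (F ?P) v0 v1 Z c"
    and ev: "\<forall>w \<in> Field (und Q). (fn ?e (fn v0 w), fn ?e (fn v1 w)) \<in> under (alg X)"
    and surj: "fn c ` Field (und (F ?P)) = Field (und Z)"
    and ord: "\<forall>p \<in> Field (und (F ?P)). \<forall>q \<in> Field (und (F ?P)). (fn c p, fn c q) \<in> und Z \<longleftrightarrow> (fn ?e p, fn ?e q) \<in> under (alg X)"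
    using kernel_coinserter[OF P alg_Obj[OF X] fn_hom[OF e(1)]] by (elim exE conjE)
  have c: "c \<in> arrows K (F ?P) Z" using co by (simp add: is_coinserter_def)
  have fac: "\<exists>k \<in> arrows K Z Y'. f = k \<odot> c"
    if f: "f \<in> arrows K (F ?P) Y'" and le: "\<And>w. w \<in> Field (und Q) \<Longrightarrow> (fn f (fn v0 w), fn f (fn v1 w)) \<in> und Y'" for f Y'
  proof -
    have "(f \<odot> v0, f \<odot> v1) \<in> Hom K Q Y'"
      unfolding Hom_iff[OF comp_arrow[OF v0 f] comp_arrow[OF v1 f]]
      by (simp add: fn_comp[OF v0 f] fn_comp[OF v1 f] le)
    then show ?thesis using co f unfolding is_coinserter_def by blast
  qed
  obtain k where k: "k \<in> arrows K Z X" "?e = k \<odot> c" using fac[OF e(1)] ev by auto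
  have "(fn ?h (fn v0 w), fn ?h (fn v1 w)) \<in> und Y" if w: "w \<in> Field (und Q)" for w
    using ev w monotone_mapsD(2)[OF hm] he[OF fn_closed[OF v0 w]] he[OF fn_closed[OF v1 w]] by simp
  then obtain l where l: "l \<in> arrows K Z Y" "?h = l \<odot> c" using fac[OF g(1)] by blast
  have kc: "fn k (fn c p) = fn ?e p" if "p \<in> Field (und (F ?P))" for p
    using fn_comp[OF c k(1) that] k(2) by simp
  have "is_iso Pos (und Z) (und X) (ar U k)"
  proof (rule iso_posI[OF k(1)])
    show "Field (und X) \<subseteq> fn k ` Field (und Z)"
    proof
      fix x assume x: "x \<in> Field (und X)"
      have "x = fn k (fn c (\<eta> ?P x))" using kc[OF \<eta>_closed[OF P x]] e(2)[OF x] by simp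
      then show "x \<in> fn k ` Field (und Z)" using fn_closed[OF c \<eta>_closed[OF P x]] by blast
    qed
    fix y y' assume y: "y \<in> Field (und Z)" "y' \<in> Field (und Z)" and le: "(fn k y, fn k y') \<in> und X"
    obtain p p' where p: "p \<in> Field (und (F ?P))" "y = fn c p" "p' \<in> Field (und (F ?P))" "y' = fn c p'"
      using y surj by blast
    then show "(y, y') \<in> und Z" using le ord kc by simp
  qed
  then have "is_iso K Z X k" using ri k(1) unfolding reflects_isos_def by blast
  then obtain k' where k': "k' \<in> arrows K X Z" "k' \<odot> k = Idt K Z" by (rule is_isoE)
  have f: "l \<odot> k' \<in> arrows K X Y" by (rule comp_arrow[OF k'(1) l(1)])
  have "fn (l \<odot> k') x = h x" if x: "x \<in> Field (und X)" for x
  proof -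
    let ?z = "fn c (\<eta> ?P x)"
    have z: "?z \<in> Field (und Z)" by (rule fn_closed[OF c \<eta>_closed[OF P x]])
    have "fn k ?z = x" using kc[OF \<eta>_closed[OF P x]] e(2)[OF x] by simp
    then have "fn k' x = ?z" using fn_comp[OF k(1) k'(1) z] k'(2) fn_id[OF arrows_Obj(1)[OF k(1)] z] by simp
    then have "fn (l \<odot> k') x = fn l ?z" using fn_comp[OF k'(1) l(1) x] by simp
    also have "\<dots> = fn ?h (\<eta> ?P x)" using fn_comp[OF c l(1) \<eta>_closed[OF P x]] l(2) by simp
    also have "\<dots> = h x" by (rule g(2)[OF x])
    finally show ?thesis .
  qed
  then have "fn (l \<odot> k') = h" by (intro monotone_maps_ext[OF ar_U(2)[OF f] hm])
  then show ?thesis using f by blast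
qed

text \<open>The homomorphism \<open>a\<close> extends the identity of the underlying poset of
  \<open>C\<close>, hence is surjective. The coinserter \<open>X\<close> of its kernel and the
  algebra \<open>C\<close> are then quotients of the same free algebra by the same preorder, and the
  induced bijection is a homomorphism because \<open>c\<close> and \<open>a\<close> are.\<close>

lemma ess_surj:
  assumes C: "C \<in> Obj (Variety \<Sigma> \<Gamma>)"
  shows "\<exists>X \<in> Obj K. \<exists>j. is_iso (Variety \<Sigma> \<Gamma>) (alg X) C j"
proof -
  have CC: "ordered_algebra \<Sigma> C" using C by (simp add: Obj_Variety)
  note oC = Partial_orderD[OF Obj_Variety_order[OF C]]
  let ?P = "under C"
  have P: "?P \<in> Obj Pos" by (rule ordered_algebraD(1)[OF CC])
  note FP = F_Obj[OF P]
  obtain a where a: "a \<in> monotone_homs \<Sigma> (alg (F ?P)) C" "\<And>p. p \<in> Field ?P \<Longrightarrow> a (\<eta> ?P p) = p"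
    using free_hom[OF P C, of "\<lambda>p. p"] by blast
  obtain Q v0 v1 X c where co: "is_coinserter K Q (F ?P) v0 v1 X c"
    and surj: "fn c ` Field (und (F ?P)) = Field (und X)"
    and ord: "\<forall>p \<in> Field (und (F ?P)). \<forall>q \<in> Field (und (F ?P)). (fn c p, fn c q) \<in> und X \<longleftrightarrow> (a p, a q) \<in> ?P"
    using kernel_coinserter[OF P C a(1)] by (elim exE conjE)
  have ord': "(a p, a q) \<in> ?P"
    if "p \<in> Field (und (F ?P))" "q \<in> Field (und (F ?P))" "(fn c p, fn c q) \<in> und X" for p q
    using ord that by blast
  have c: "c \<in> arrows K (F ?P) X" using co by (simp add: is_coinserter_def)
  have X: "X \<in> Obj K" using arrows_Obj[OF c] by simp
  let ?s = "inv_into (Field (und (F ?P))) (fn c)"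
  have s: "?s x \<in> Field (und (F ?P))" "fn c (?s x) = x" if "x \<in> Field (und X)" for x
    using that unfolding surj[symmetric] by (auto intro: inv_into_into f_inv_into_f)
  let ?j = "restrict (\<lambda>x. a (?s x)) (Field (und X))"
  have jc: "?j (fn c p) = a p" if p: "p \<in> Field (und (F ?P))" for p
  proof -
    have x: "fn c p \<in> Field (und X)" by (rule fn_closed[OF c p])
    have xx: "(fn c p, fn c p) \<in> und X" by (rule Partial_orderD(1)[OF und_order[OF X] x])
    have "(a (?s (fn c p)), a p) \<in> ?P" "(a p, a (?s (fn c p))) \<in> ?P"
      by (rule ord'; simp add: s[OF x] p xx)+
    then show ?thesis using oC(3) x by simp
  qed
  have j: "?j \<in> monotone_homs \<Sigma> (alg X) C"
  proof (rule monotone_homsI, unfold under_alg)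
    show "?j \<in> monotone_maps (und X) ?P"
    proof (rule monotone_mapsI)
      fix x y assume xy: "(x, y) \<in> und X"
      show "(a (?s x), a (?s y)) \<in> ?P"
        by (rule ord'; simp add: s[OF FieldI1[OF xy]] s[OF FieldI2[OF xy]] xy)
    qed
    fix \<sigma> ys assume \<sigma>: "\<sigma> \<in> \<Sigma> (length ys)" and ys: "set ys \<subseteq> Field (und X)"
    obtain zs where zs: "ys = map (fn c) zs" "set zs \<subseteq> Field (und (F ?P))"
      using ys unfolding surj[symmetric] by (rule set_subset_imageE)
    have \<sigma>': "\<sigma> \<in> \<Sigma> (length zs)" using \<sigma> zs by simp
    have "oper (alg X) \<sigma> ys = fn c (oper (alg (F ?P)) \<sigma> zs)"
      using monotone_homsD(2)[OF fn_hom[OF c] \<sigma>'] zs by simp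
    then have "?j (oper (alg X) \<sigma> ys) = a (oper (alg (F ?P)) \<sigma> zs)"
      by (simp only: jc[OF opr_closed[OF FP \<sigma>' zs(2)]])
    also have "\<dots> = oper C \<sigma> (map a zs)" using monotone_homsD(2)[OF a(1) \<sigma>'] zs(2) by simp
    also have "map a zs = map ?j ys" unfolding zs(1) map_map comp_def
      by (rule map_cong[OF refl], rule jc[symmetric], rule subsetD[OF zs(2)])
    finally show "?j (oper (alg X) \<sigma> ys) = oper C \<sigma> (map ?j ys)" .
  qed
  have "is_iso (Variety \<Sigma> \<Gamma>) (alg X) C (alg X, ?j, C)"
  proof (rule variety_isoI[OF alg_Obj[OF X] C j], unfold under_alg)
    show "Field ?P \<subseteq> ?j ` Field (und X)"
    proof
      fix p assume p: "p \<in> Field ?P"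
      have "p = ?j (fn c (\<eta> ?P p))" using jc[OF \<eta>_closed[OF P p]] a(2)[OF p] by simp
      then show "p \<in> ?j ` Field (und X)" using fn_closed[OF c \<eta>_closed[OF P p]] by blast
    qed
    show "(x, y) \<in> und X" if xy: "x \<in> Field (und X)" "y \<in> Field (und X)" and le: "(?j x, ?j y) \<in> ?P" for x y
    proof -
      have "(a (?s x), a (?s y)) \<in> ?P" using le xy by simp
      then show ?thesis using ord[rule_format, OF s(1)[OF xy(1)] s(1)[OF xy(2)]] s(2) xy by simp
    qed
  qed
  then show ?thesis using X by blast
qed

section \<open>The comparison functor\<close>

lemma concretely_equivalent_variety: "concretely_equivalent K U (Variety \<Sigma> \<Gamma>) Underlying"
proof -
  \<comment> \<open>Arrows of the variety carry their domain and codomain, whereas those of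
    \<open>K\<close> are bare; disjointness of hom-sets makes both recoverable.\<close>
  define dm where "dm f = (SOME X. \<exists>Y. f \<in> arrows K X Y)" for f
  define cd where "cd f = (SOME Y. \<exists>X. f \<in> arrows K X Y)" for f
  have dm: "dm f = X" and cd: "cd f = Y" if f: "f \<in> arrows K X Y" for f X Y
  proof -
    have "\<exists>X Y. f \<in> arrows K X Y" "\<exists>Y X. f \<in> arrows K X Y" using f by blast+
    from someI_ex[OF this(1)] someI_ex[OF this(2)] show "dm f = X" "cd f = Y"
      using hom_disjoint[OF f] unfolding dm_def cd_def by blast+
  qed
  let ?E = "\<lparr>ob = alg, ar = \<lambda>f. (alg (dm f), fn f, alg (cd f))\<rparr>"
  have ar: "ar ?E f = (alg X, fn f, alg Y)" if "f \<in> arrows K X Y" for f X Y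
    using dm[OF that] cd[OF that] by simp
  have ord: "(f, g) \<in> Hom K X Y \<longleftrightarrow> (ar ?E f, ar ?E g) \<in> Hom (Variety \<Sigma> \<Gamma>) (alg X) (alg Y)"
    if f: "f \<in> arrows K X Y" and g: "g \<in> arrows K X Y" for f g X Y
    unfolding ar[OF f] ar[OF g] Hom_Variety Hom_iff[OF f g] using fn_hom[OF f] fn_hom[OF g] by auto
  have E: "enriched_functor K (Variety \<Sigma> \<Gamma>) ?E"
    unfolding enriched_functor_def
  proof (intro conjI ballI allI, goal_cases)
    case (1 X)
    then show ?case using alg_Obj by simp
  next
    case (2 X)
    have "fn (Idt K X) = (\<lambda>x \<in> Field (und X). x)"
      by (rule monotone_maps_ext[OF ar_U(2)[OF id_arrow[OF 2]] id_monotone]) (simp add: fn_id[OF 2])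
    then show ?case unfolding ar[OF id_arrow[OF 2]] by (simp add: Idt_Variety)
  next
    case (3 X Y z)
    obtain f g where z: "z = (f, g)" by force
    then have fg: "(f, g) \<in> Hom K X Y" using 3 by simp
    have f: "f \<in> arrows K X Y" and g: "g \<in> arrows K X Y"
      using Hom_arrows[OF 3(1,2) fg] by auto
    show ?case using ord[OF f g] fg z by simp
  next
    case (4 X Y Z f g)
    have "fn (g \<odot> f) = compose (Field (und X)) (fn g) (fn f)"
      by (rule monotone_maps_ext[OF ar_U(2)[OF comp_arrow[OF 4]] compose_monotone[OF ar_U(2)[OF 4(1)] ar_U(2)[OF 4(2)]]])
        (simp add: fn_comp[OF 4] compose_eq)
    then show ?case unfolding ar[OF 4(1)] ar[OF 4(2)] ar[OF comp_arrow[OF 4]] by (simp add: Cmp_Variety)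
  qed
  have "equivalence K (Variety \<Sigma> \<Gamma>) ?E"
  proof (rule equivalenceI[OF pos_category_axioms pos_category_Variety E])
    fix X Y h assume X: "X \<in> Obj K" and Y: "Y \<in> Obj K" and h: "h \<in> arrows (Variety \<Sigma> \<Gamma>) (ob ?E X) (ob ?E Y)"
    then obtain m where m: "h = (alg X, m, alg Y)" "m \<in> monotone_homs \<Sigma> (alg X) (alg Y)"
      by (auto simp: arrows_Variety)
    obtain f where f: "f \<in> arrows K X Y" "fn f = m" using full[OF X Y m(2)] by blast
    then show "\<exists>f \<in> arrows K X Y. ar ?E f = h" using ar[OF f(1)] m(1) by blast
  next
    fix X Y f g assume "f \<in> arrows K X Y" "g \<in> arrows K X Y"
      "(ar ?E f, ar ?E g) \<in> Hom (Variety \<Sigma> \<Gamma>) (ob ?E X) (ob ?E Y)"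
    then show "(f, g) \<in> Hom K X Y" using ord by simp
  next
    fix C assume "C \<in> Obj (Variety \<Sigma> \<Gamma>)"
    then show "\<exists>X \<in> Obj K. \<exists>j. is_iso (Variety \<Sigma> \<Gamma>) (ob ?E X) C j" using ess_surj by simp
  qed
  moreover have "functor_eq K U (comp_functor Underlying ?E)"
    unfolding functor_eq_def
  proof (intro conjI allI ballI)
    show "ob U X = ob (comp_functor Underlying ?E) X" if "X \<in> Obj K" for X
      by (simp add: comp_functor_def Underlying_def)
    show "ar U f = ar (comp_functor Underlying ?E) f" if "f \<in> arrows K X Y" for X Y f
      using ar_U(1)[OF that] dm[OF that] cd[OF that] by (simp add: comp_functor_def Underlying_def)
  qed
  ultimately show ?thesis unfolding concretely_equivalent_def by blast
qed

lemma is_signature_\<Sigma>: "is_signature \<Sigma>"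
  unfolding is_signature_def \<Sigma>_def using und_Obj[OF F_Obj[OF Id_on_Pos[OF small_N]]] by (simp add: Obj_Pos)

lemma are_inequations_\<Gamma>: "are_inequations \<Sigma> \<Gamma>"
  unfolding are_inequations_def \<Gamma>_def by auto

end

theorem corollary6p2:
  fixes K :: "('o, 'm) pcat"
    and U :: "('o, 'm, 'u rel, 'u pos_arrow) pfunctor"
  assumes "uncountable (UNIV :: 'u set)" and "regularCard |UNIV :: 'u set|"
    and "concrete_category K U"
  shows "(\<exists>(S :: 'u signature) \<Gamma>. is_signature S \<and> are_inequations S \<Gamma> \<and>
            concretely_equivalent K U (Variety S \<Gamma>) Underlying) \<longleftrightarrow>
         (has_tensors TYPE('u) K \<and> has_subkernel_pairs K \<and> has_reflexive_coinserters K) \<and>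
         (finitary TYPE('u) K Pos U \<and> right_adjoint K Pos U \<and> reflects_isos K Pos U \<and>
          preserves_reflexive_coinserters K Pos U)"
    (is "?variety \<longleftrightarrow> ?props")
proof
  have univ: "universe (UNIV :: 'u set)" using assms(1,2) by (simp add: universe_def)
  show ?props if ?variety
    using that algebraic_of_equivalent[OF univ assms(3)] algebraic.algebraic_properties by blast
  show ?variety if ?props
  proof -
    interpret varietal K U UNIV
      unfolding varietal_def varietal_axioms_def using concreteI[OF assms(3)] univ that by blast
    show ?thesis using is_signature_\<Sigma> are_inequations_\<Gamma> concretely_equivalent_variety by blast
  qed
qed

end
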